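(* Let $D=\{\zeta\in\mathbb{C}:|\zeta|<1\}$ be the hyperbolic (Poincaré) disk with boundary $B=\{\zeta:|\zeta|=1\}$. Write $\zeta=|\zeta|e^{i\theta}\in D$ and $b=e^{i\phi}\in B$. Then: (i) The Poisson kernel $$P(\zeta,b)=\frac{1-|\zeta|^2}{1+|\zeta|^2-2|\zeta|\cos(\theta-\phi)}$$ is constant on each horocycle $H_b$ with normal $b$. (ii) The function $$[P(\zeta,b)]^\nu=\left[\frac{1-|\zeta|^2}{1+|\zeta|^2-2|\zeta|\cos(\theta-\phi)}\right]^\nu\qquad(\nu\in\mathbb{C})$$ is an eigenfunction of the Laplace–Beltrami operator on the hyperbolic disk $D$ corresponding to the eigenvalue $\nu(\nu-1)$. (iii) The hyperbolic waves (horocyclic waves) are represented by the expression $$e^{\nu\langle\zeta,b\rangle}=\left[\frac{1-|\zeta|^2}{1+|\zeta|^2-2|\zeta|\cos(\theta-\phi)}\right]^\nu\qquad(\nu\in\mathbb{C}),$$ where $\langle\zeta,b\rangle$ is the (signed) hyperbolic distance between the origin of $D$ and the horocycle of normal $b$ passing through $\zeta\in D$. (iv) The conical functions $\mathcal{P}_{-\frac12+i\lambda}(\cosh r)$ (i.e., the first kind Legendre functions of index $-\frac12+i\lambda$, $\lambda\in\mathbb{R}$) can be represented by $$\mathcal{P}_{-\frac12+i\lambda}(\cosh r)=\int_B e^{(\frac12-i\lambda)\langle\zeta,b\rangle}\,\mathrm{d}b\qquad(\lambda\in\mathbb{R}),$$ where $|\zeta|=\tanh(r/2)$, and correspond to the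 fundamental series of the irreducible unitary representation of the group $SU(1,1)$, which acts transitively on the hyperbolic disk $D$. (v) The following equality holds: $$\mathcal{P}_{-\frac12+i\lambda}(\cosh r)=\mathcal{P}_{-\frac12-i\lambda}(\cosh r)\qquad(\lambda\in\mathbb{R}).$$
   Context: $D$ carries the Riemannian metric $\mathrm{d}s^2=4(\mathrm{d}\xi^2+\mathrm{d}\eta^2)/(1-\xi^2-\eta^2)^2$, where $\zeta=\xi+i\eta$; the hyperbolic distance from $0$ to $\zeta$ is $d(0,\zeta)=\ln\frac{1+|\zeta|}{1-|\zeta|}$, and the Laplace–Beltrami operator is $$\Delta_D=\tfrac14\left[1-(\xi^2+\eta^2)\right]^2\left(\frac{\partial^2}{\partial\xi^2}+\frac{\partial^2}{\partial\eta^2}\right).$$ A horocycle $H_b$ with normal $b\in B$ is a circle inside $D$ tangent to the unit circle $B$ at $b$; such circles intersect orthogonally all the geodesics of $D$ having $b$ as endpoint. The distance $\langle\zeta,b\rangle$ is taken positive if the origin is external to the horocycle of normal $b$ through $\zeta$ and negative if the origin is internal to it. $\mathrm{d}b$ is the normalized measure $\frac{1}{2\pi}\mathrm{d}\phi$ on $B$, and $r\ge 0$. $\mathcal{P}_\mu$ denotes the Legendre function of the first kind of index $\mu$. $SU(1,1)$ is the group of matrices $\begin{pmatrix}a&c\\ \bar c&\bar a\end{pmatrix}$, $a,c\in\mathbb{C}$, $|a|^2-|c|^2=1$, which acts as a group of isometries of $D$ by $g(\zeta)=(a\zeta+c)/(\bar c\zeta+\bar a)$. *)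

theory Defs
  imports "HOL-Complex_Analysis.Complex_Analysis" "HOL-Probability.Probability"
    "HOL-Algebra.Group_Action"
begin

abbreviation hdisk :: "complex set" where "hdisk \<equiv> ball 0 1"
abbreviation hboundary :: "complex set" where "hboundary \<equiv> sphere 0 1"

definition poisson :: "complex \<Rightarrow> complex \<Rightarrow> real" where
  "poisson \<zeta> b =
     (1 - (cmod \<zeta>)\<^sup>2) / (1 + (cmod \<zeta>)\<^sup>2 - 2 * cmod \<zeta> * cos (Arg \<zeta> - Arg b))"

lemma poisson_polar:
  assumes "\<zeta> = of_real (cmod \<zeta>) * cis \<theta>" and "b = cis \<phi>"
  shows "poisson \<zeta> b =
    (1 - (cmod \<zeta>)\<^sup>2) / (1 + (cmod \<zeta>)\<^sup>2 - 2 * cmod \<zeta> * cos (\<theta> - \<phi>))"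
proof -
  have *: "r * cos (\<alpha> - \<beta>) = Re (z * cnj w)"
    if "z = of_real r * cis \<alpha>" "w = cis \<beta>" for z w r \<alpha> \<beta>
    using that by (simp add: cos_diff algebra_simps)
  have "b \<noteq> 0" "cmod b = 1" using assms by simp_all
  then have "b = cis (Arg b)"
    by (simp add: cis_Arg sgn_div_norm)
  moreover have "\<zeta> = of_real (cmod \<zeta>) * cis (Arg \<zeta>)"
    by (metis rcis_cmod_Arg rcis_def)
  ultimately have "cmod \<zeta> * cos (Arg \<zeta> - Arg b) = cmod \<zeta> * cos (\<theta> - \<phi>)"
    using * assms by metis
  then show ?thesis by (simp add: poisson_def mult.assoc)
qed

definition hyp_dist0 :: "complex \<Rightarrow> real" where
  "hyp_dist0 \<zeta> = ln ((1 + cmod \<zeta>) / (1 - cmod \<zeta>))"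

definition hyp_dist0_set :: "complex set \<Rightarrow> real" where
  "hyp_dist0_set H = (INF z\<in>H. hyp_dist0 z)"

definition circle_tangent :: "complex \<Rightarrow> complex \<Rightarrow> complex set" where
  "circle_tangent c b = {z. (z - b) \<bullet> (b - c) = 0}"

text \<open>The point of tangency \<open>b\<close> does not belong to the disk, so a horocycle, as a subset of the
  disk, is a Euclidean circle with this point removed.\<close>

definition horo_circle :: "complex \<Rightarrow> complex \<Rightarrow> real \<Rightarrow> bool" where
  "horo_circle b c r \<longleftrightarrow> 0 < r \<and> b \<in> sphere c r \<and> circle_tangent c b = circle_tangent 0 b
     \<and> sphere c r - {b} \<subseteq> hdisk"

definition horocycle :: "complex \<Rightarrow> complex set \<Rightarrow> bool" where
  "horocycle b H \<longleftrightarrow> (\<exists>c r. horo_circle b c r \<and> H = sphere c r - {b})"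

text \<open>Negative if the origin is internal to the horocycle of normal \<open>b\<close> through \<open>\<zeta>\<close>; this
  horocycle exists uniquely, and the lemma below determines its centre from its radius.\<close>

definition horo_bracket :: "complex \<Rightarrow> complex \<Rightarrow> real" where
  "horo_bracket \<zeta> b = (THE s. \<exists>c r. horo_circle b c r \<and> \<zeta> \<in> sphere c r - {b} \<and>
     s = (if 0 \<in> ball c r then - hyp_dist0_set (sphere c r - {b})
          else hyp_dist0_set (sphere c r - {b})))"

lemma horo_circle_iff:
  assumes "cmod b = 1"
  shows "horo_circle b c r \<longleftrightarrow> 0 < r \<and> r < 1 \<and> c = of_real (1 - r) * b"
proof
  assume h: "horo_circle b c r"
  have bb: "b \<bullet> b = 1" using assms by (simp add: dot_square_norm)
  have "(b + \<i> * b) \<in> circle_tangent 0 b"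
    by (simp add: circle_tangent_def inner_complex_def)
  then have "(b + \<i> * b) \<in> circle_tangent c b" using h by (simp add: horo_circle_def)
  then have i: "Im (c * cnj b) = 0"
    by (simp add: circle_tangent_def inner_complex_def algebra_simps)
  define t where "t = Re (c * cnj b)"
  have bcb: "cnj b * b = 1" using assms
    by (metis complex_norm_square mult.commute of_real_1 power_one)
  have "c * cnj b = of_real t" using i by (simp add: t_def complex_eq_iff)
  then have c: "c = of_real t * b"
    by (metis bcb mult.assoc mult.right_neutral)
  have r: "r = \<bar>1 - t\<bar>"
  proof -
    have "r = cmod (c - b)" using h by (simp add: horo_circle_def dist_norm)
    also have "c - b = of_real (t - 1) * b" by (simp add: c algebra_simps)
    finally show ?thesis using assms by (simp add: norm_mult del: of_real_diff)
  qed
  have r0: "r > 0" using h by (simp add: horo_circle_def)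
  define p where "p = of_real (2 * t - 1) * b"
  have "p - c = of_real (t - 1) * b" by (simp add: c p_def algebra_simps)
  then have "cmod (p - c) = r" using r assms by (simp add: norm_mult del: of_real_diff)
  moreover have "p \<noteq> b"
  proof
    assume "p = b"
    moreover have "b \<noteq> 0" using bcb by auto
    ultimately have "complex_of_real (2 * t - 1) = 1"
      unfolding p_def using mult_right_cancel[of b _ 1] by simp
    then have "2 * t - 1 = 1" using of_real_eq_1_iff by blast
    then show False using r r0 by simp
  qed
  ultimately have "p \<in> hdisk"
    using h unfolding horo_circle_def by (auto simp: dist_norm norm_minus_commute)
  then have "\<bar>2 * t - 1\<bar> < 1" using assms by (simp add: p_def norm_mult del: of_real_diff)
  then have "0 < t" "t < 1" by auto
  then show "0 < r \<and> r < 1 \<and> c = of_real (1 - r) * b" using r c r0 by simp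
next
  assume h: "0 < r \<and> r < 1 \<and> c = of_real (1 - r) * b"
  have bc: "b - c = of_real r * b" using h by (simp add: algebra_simps)
  have "circle_tangent c b = circle_tangent 0 b"
    using h unfolding circle_tangent_def bc by (simp add: inner_complex_def)
       (metis (no_types, opaque_lifting) distrib_left mult.left_commute mult_eq_0_iff less_irrefl)
  moreover have "b \<in> sphere c r"
    using bc h assms by (simp add: dist_norm norm_minus_commute norm_mult)
  moreover have "z \<in> hdisk" if z: "z \<in> sphere c r" "z \<noteq> b" for z
  proof -
    have "z \<in> cball 0 1"
    proof -
      have "cmod z \<le> cmod c + cmod (z - c)" using norm_triangle_sub[of z c] by simp
      also have "\<dots> = (1 - r) + r" using z h assms
        by (simp add: dist_norm norm_minus_commute norm_mult del: of_real_diff)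
      finally show ?thesis by simp
    qed
    moreover have "cmod z \<noteq> 1"
    proof
      assume n: "cmod z = 1"
      have zz: "z \<bullet> z = 1" "b \<bullet> b = 1" using n assms by (simp_all add: dot_square_norm)
      have c: "c = (1 - r) *\<^sub>R b" using h by (simp add: scaleR_conv_of_real)
      have "(z - c) \<bullet> (z - c) = r\<^sup>2"
        using z by (simp add: dot_square_norm dist_norm norm_minus_commute)
      then have "(1 - r) * (z \<bullet> b) = 1 - r"
        using zz unfolding c
        by (simp add: inner_diff_left inner_diff_right inner_commute[of b z] power2_eq_square algebra_simps)
      then have "z \<bullet> b = 1" using h by simp
      then have "(z - b) \<bullet> (z - b) = 0"
        using zz by (simp add: inner_diff_left inner_diff_right inner_commute[of b z])
      then show False using z by simp
    qed
    ultimately show ?thesis by simp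
  qed
  ultimately show "horo_circle b c r" using h unfolding horo_circle_def by blast
qed

definition dx :: "(complex \<Rightarrow> complex) \<Rightarrow> complex \<Rightarrow> complex" where
  "dx f z = vector_derivative (\<lambda>t. f (z + complex_of_real t)) (at 0)"

definition dy :: "(complex \<Rightarrow> complex) \<Rightarrow> complex \<Rightarrow> complex" where
  "dy f z = vector_derivative (\<lambda>t. f (z + \<i> * complex_of_real t)) (at 0)"

definition C1_on :: "complex set \<Rightarrow> (complex \<Rightarrow> complex) \<Rightarrow> bool" where
  "C1_on S f \<longleftrightarrow> (\<forall>z\<in>S. f differentiable (at z)) \<and> continuous_on S (dx f) \<and> continuous_on S (dy f)"

definition C2_on :: "complex set \<Rightarrow> (complex \<Rightarrow> complex) \<Rightarrow> bool" where
  "C2_on S f \<longleftrightarrow> C1_on S f \<and> C1_on S (dx f) \<and> C1_on S (dy f)"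

definition laplace_beltrami :: "(complex \<Rightarrow> complex) \<Rightarrow> complex \<Rightarrow> complex" where
  "laplace_beltrami f z =
     of_real (1/4 * (1 - ((Re z)\<^sup>2 + (Im z)\<^sup>2))\<^sup>2) * (dx (dx f) z + dy (dy f) z)"

definition laplace_eigenfunction :: "(complex \<Rightarrow> complex) \<Rightarrow> complex \<Rightarrow> bool" where
  "laplace_eigenfunction f \<kappa> \<longleftrightarrow> C2_on hdisk f \<and> (\<exists>z\<in>hdisk. f z \<noteq> 0) \<and>
     (\<forall>z\<in>hdisk. laplace_beltrami f z = \<kappa> * f z)"

text \<open>Principal branch of Gauss's hypergeometric function: the analytic continuation of the
  hypergeometric series along the segment from \<open>0\<close> to \<open>z\<close>.\<close>

definition hyp2F1 :: "complex \<Rightarrow> complex \<Rightarrow> complex \<Rightarrow> complex \<Rightarrow> complex" where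
  "hyp2F1 a b c z = (THE w. \<exists>f S. open S \<and> z \<in> S \<and> (\<forall>x\<in>S. closed_segment 0 x \<subseteq> S) \<and>
     f holomorphic_on S \<and> f has_fps_expansion fps_hypergeo [a, b] [c] 1 \<and> w = f z)"

definition legendre_P :: "complex \<Rightarrow> complex \<Rightarrow> complex" where
  "legendre_P \<mu> z = hyp2F1 (- \<mu>) (\<mu> + 1) 1 ((1 - z) / 2)"

lemma hyp2F1_eqI:
  assumes "open S" "z \<in> S" "\<And>x. x \<in> S \<Longrightarrow> closed_segment 0 x \<subseteq> S"
    and "f holomorphic_on S" "f has_fps_expansion fps_hypergeo [a, b] [c] 1"
  shows "hyp2F1 a b c z = f z"
  unfolding hyp2F1_def
proof (rule the_equality)
  fix w assume "\<exists>f S. open S \<and> z \<in> S \<and> (\<forall>x\<in>S. closed_segment 0 x \<subseteq> S) \<and>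
     f holomorphic_on S \<and> f has_fps_expansion fps_hypergeo [a, b] [c] 1 \<and> w = f z"
  then obtain g T where g: "open T" "z \<in> T" "\<And>x. x \<in> T \<Longrightarrow> closed_segment 0 x \<subseteq> T"
     "g holomorphic_on T" "g has_fps_expansion fps_hypergeo [a, b] [c] 1" "w = g z"
    by blast
  let ?U = "S \<inter> T"
  have 0: "0 \<in> ?U" using assms(2,3) g(2,3) by (metis IntI ends_in_segment(1) subsetD)
  have "starlike ?U" unfolding starlike_def using 0 assms(3) g(3) by blast
  then have conn: "connected ?U" by (rule starlike_imp_connected)
  have op: "open ?U" using assms(1) g(1) by auto
  have "eventually (\<lambda>x. f x = g x) (nhds 0)"
    using assms(5) g(5) unfolding has_fps_expansion_def
    by (auto elim: eventually_elim2)
  then obtain V where V: "open V" "0 \<in> V" "\<And>x. x \<in> V \<Longrightarrow> f x = g x"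
    unfolding eventually_nhds by blast
  have "f z = g z"
  proof (rule analytic_continuation_open[of "V \<inter> ?U" ?U f g])
    show "V \<inter> ?U \<noteq> {}" using V 0 by blast
    show "z \<in> ?U" using assms g by blast
  qed (use V op conn assms g in \<open>auto intro: holomorphic_on_subset\<close>)
  then show "w = f z" using g by simp
qed (use assms in blast)

definition bmeasure :: "complex measure" where
  "bmeasure = distr (uniform_measure lborel {0..2 * pi}) borel cis"

text \<open>Elements of \<open>L\<^sup>2\<close> of the boundary are represented by functions on the plane; only their
  classes modulo almost everywhere equality with respect to the boundary measure matter below.\<close>

definition L2B :: "(complex \<Rightarrow> complex) set" where
  "L2B = {f \<in> borel_measurable borel. integrable bmeasure (\<lambda>b. (cmod (f b))\<^sup>2)}"

definition L2_inner :: "(complex \<Rightarrow> complex) \<Rightarrow> (complex \<Rightarrow> complex) \<Rightarrow> complex" where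
  "L2_inner f h = (LINT b|bmeasure. f b * cnj (h b))"

definition L2_norm :: "(complex \<Rightarrow> complex) \<Rightarrow> real" where
  "L2_norm f = sqrt (LINT b|bmeasure. (cmod (f b))\<^sup>2)"

definition L2_eq :: "(complex \<Rightarrow> complex) \<Rightarrow> (complex \<Rightarrow> complex) \<Rightarrow> bool" where
  "L2_eq f h \<longleftrightarrow> (AE b in bmeasure. f b = h b)"

definition L2_null :: "(complex \<Rightarrow> complex) set" where
  "L2_null = {f \<in> L2B. L2_eq f (\<lambda>_. 0)}"

definition closed_subspace :: "(complex \<Rightarrow> complex) set \<Rightarrow> bool" where
  "closed_subspace V \<longleftrightarrow> V \<subseteq> L2B \<and> (\<lambda>_. 0) \<in> V \<and>
     (\<forall>f\<in>V. \<forall>h\<in>V. \<forall>\<alpha> \<beta>. (\<lambda>b. \<alpha> * f b + \<beta> * h b) \<in> V) \<and>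
     (\<forall>F f. (\<forall>n::nat. F n \<in> V) \<and> f \<in> L2B \<and> (\<lambda>n. L2_norm (\<lambda>b. F n b - f b)) \<longlonglongrightarrow> 0 \<longrightarrow> f \<in> V)"

definition unitary_rep ::
    "('g::topological_space) monoid \<Rightarrow> ('g \<Rightarrow> (complex \<Rightarrow> complex) \<Rightarrow> complex \<Rightarrow> complex) \<Rightarrow> bool" where
  "unitary_rep G T \<longleftrightarrow> group G \<and>
     (\<forall>g\<in>carrier G. \<forall>f\<in>L2B. T g f \<in> L2B) \<and>
     (\<forall>g\<in>carrier G. \<forall>f\<in>L2B. \<forall>h\<in>L2B. \<forall>\<alpha> \<beta>.
        L2_eq (T g (\<lambda>b. \<alpha> * f b + \<beta> * h b)) (\<lambda>b. \<alpha> * T g f b + \<beta> * T g h b)) \<and>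
     (\<forall>g\<in>carrier G. \<forall>f\<in>L2B. \<forall>h\<in>L2B. L2_inner (T g f) (T g h) = L2_inner f h) \<and>
     (\<forall>f\<in>L2B. L2_eq (T \<one>\<^bsub>G\<^esub> f) f) \<and>
     (\<forall>g\<in>carrier G. \<forall>h\<in>carrier G. \<forall>f\<in>L2B. L2_eq (T (g \<otimes>\<^bsub>G\<^esub> h) f) (T g (T h f))) \<and>
     (\<forall>f\<in>L2B. \<forall>g\<in>carrier G.
        ((\<lambda>x. L2_norm (\<lambda>b. T x f b - T g f b)) \<longlongrightarrow> 0) (at g within carrier G))"

definition irreducible_rep ::
    "'g monoid \<Rightarrow> ('g \<Rightarrow> (complex \<Rightarrow> complex) \<Rightarrow> complex \<Rightarrow> complex) \<Rightarrow> bool" where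
  "irreducible_rep G T \<longleftrightarrow> L2B \<noteq> L2_null \<and>
     (\<forall>V. closed_subspace V \<and> (\<forall>g\<in>carrier G. \<forall>f\<in>V. T g f \<in> V) \<longrightarrow> V = L2_null \<or> V = L2B)"

definition SU11 :: "(complex^2^2) monoid" where
  "SU11 = \<lparr>carrier = {A. A $ 2 $ 1 = cnj (A $ 1 $ 2) \<and> A $ 2 $ 2 = cnj (A $ 1 $ 1) \<and>
              (cmod (A $ 1 $ 1))\<^sup>2 - (cmod (A $ 1 $ 2))\<^sup>2 = 1},
     mult = (**), one = mat 1\<rparr>"

definition moebius :: "complex^2^2 \<Rightarrow> complex \<Rightarrow> complex" where
  "moebius A z = (A $ 1 $ 1 * z + A $ 1 $ 2) / (A $ 2 $ 1 * z + A $ 2 $ 2)"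

text \<open>The restriction is needed because library group actions are by extensional functions.\<close>

definition SU11_action :: "complex^2^2 \<Rightarrow> complex \<Rightarrow> complex" where
  "SU11_action A = restrict (moebius A) hdisk"

text \<open>The spherical principal (= fundamental) series: for
  \<open>g = (a, c; cnj c, cnj a)\<close> the map \<open>b \<mapsto> g\<inverse>(b)\<close> of the boundary has Jacobian
  \<open>\<bar>a - cnj c * b\<bar> powr (-2)\<close>, and \<open>(T g f)(b) = Jacobian powr (1/2 - \<i> lam) * f (g\<inverse>(b))\<close>.\<close>

definition fundamental_series ::
    "real \<Rightarrow> complex^2^2 \<Rightarrow> (complex \<Rightarrow> complex) \<Rightarrow> complex \<Rightarrow> complex" where
  "fundamental_series lam g f b =
     complex_of_real (cmod (g $ 1 $ 1 - g $ 2 $ 1 * b)) powr (- 1 + 2 * \<i> * of_real lam)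
       * f (moebius (inv\<^bsub>SU11\<^esub> g) b)"

definition spherical_function ::
    "(complex^2^2 \<Rightarrow> (complex \<Rightarrow> complex) \<Rightarrow> complex \<Rightarrow> complex) \<Rightarrow> (complex^2^2 \<Rightarrow> complex) \<Rightarrow> bool" where
  "spherical_function T \<Phi> \<longleftrightarrow> (\<exists>v\<in>L2B. L2_norm v = 1 \<and>
     (\<forall>k\<in>stabilizer SU11 SU11_action 0. L2_eq (T k v) v) \<and>
     (\<forall>g\<in>carrier SU11. \<Phi> g = L2_inner (T g v) v))"

end

theory Submission
  imports Defs
begin

text \<open>The horocycle through \<open>\<zeta>\<close> with normal \<open>b\<close> has Euclidean radius \<open>r\<close> with
  \<open>P(\<zeta>, b) = (1 - r) / r\<close>, and its point nearest to the origin is \<open>(1 - 2 r) b\<close>; this gives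
  \<open>\<langle>\<zeta>, b\<rangle> = ln P(\<zeta>, b)\<close>. With \<open>s = 1/2 - i \<lambda>\<close> and \<open>x = |\<zeta>|\<^sup>2\<close>, expanding the two factors of
  \<open>|1 - |\<zeta>| b| powr (-2 s) = (1 - |\<zeta>| b) powr (-s) * (1 - |\<zeta>| cnj b) powr (-s)\<close> in binomial series
  shows that the mean of \<open>P powr s\<close> over the circle is \<open>(1 - x) powr s * F(s, s; 1; x)\<close>, which Pfaff's
  transformation turns into the Legendre function.

  For the representation, the Jacobian of a Moebius map of the circle makes every operator unitary,
  and density of the trigonometric polynomials gives strong continuity. Irreducibility: averaging over
  the rotations by \<open>N\<close>-th roots of unity, \<open>N \<rightarrow> \<infinity>\<close>, shows that a closed invariant subspace
  contains every Fourier mode \<open>b powi n\<close> that occurs in one of its elements. A boost with parameter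
  \<open>q\<close> maps \<open>b powi n\<close> to a function whose coefficients at \<open>n \<plusminus> 1\<close> are \<open>(s \<plusminus> n) q + O(q\<^sup>3)\<close>, up to a
  nonzero factor, and \<open>s \<plusminus> n \<noteq> 0\<close> since \<open>Re s = 1/2\<close>. So a nonzero closed invariant subspace
  contains all modes.\<close>

text \<open>The eigenvalue equation rests on ln P having hyperbolic gradient of length 1 and
  hyperbolic Laplacian -1: the Laplacian of exp (\<nu> ln P) is then \<nu> * \<nu> - \<nu> times
  that function. The detour through Pfaff is forced, because (1 - cosh r) / 2 runs through the whole
  half-line of nonpositive numbers and leaves the disc of convergence, whereas z / (z - 1) maps the
  half-plane Re z < 1/2 into the unit disc. The spherical vector is the constant 1: its translate by
  g has the value P(g 0, b) powr s at b, so the integral representing the conical function is a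
  matrix coefficient of the representation. The equality of the functions for \<lambda> and
  -\<lambda> is the symmetry of the hypergeometric function in its two upper parameters. Elements of
  L2 are functions and not classes, so the zero subspace appears as the set of null functions, and
  identities valid on the circle are passed on as almost everywhere equalities. Averages over roots
  of unity stand in for an integral over the rotation group: being finite linear combinations of
  rotates, they lie in an invariant subspace without any vector-valued integration.\<close>

no_notation fps_nth (infixl \<open>$\<close> 75)

section \<open>Horocycles and the Poisson kernel\<close>

text \<open>Law of cosines. The denominator of the Poisson kernel is the instance t = 1, the
  equation of a horocycle the instance t = 1 - r; eliminating Re (z * cnj b) between the two relates
  them.\<close>

lemma cmod_diff_power2_unit:
  assumes "cmod b = 1"
  shows "(cmod (z - of_real t * b))\<^sup>2 = (cmod z)\<^sup>2 - 2 * t * Re (z * cnj b) + t\<^sup>2"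
proof -
  have "(Re b)\<^sup>2 + (Im b)\<^sup>2 = 1" using assms by (metis cmod_power2 one_power2)
  moreover have "(cmod (z - of_real t * b))\<^sup>2 = (cmod z)\<^sup>2 - 2 * t * Re (z * cnj b) + t\<^sup>2 * ((Re b)\<^sup>2 + (Im b)\<^sup>2)"
    unfolding cmod_power2 by (simp add: power2_eq_square algebra_simps)
  ultimately show ?thesis by simp
qed

lemma poisson_eq:
  assumes "cmod b = 1"
  shows "poisson \<zeta> b = (1 - (cmod \<zeta>)\<^sup>2) / (cmod (\<zeta> - b))\<^sup>2"
proof -
  have b: "b = cis (Arg b)" using assms by (metis cis_Arg norm_zero sgn_div_norm
    zero_neq_one inverse_1 scaleR_one)
  have z: "\<zeta> = of_real (cmod \<zeta>) * cis (Arg \<zeta>)" by (metis rcis_cmod_Arg rcis_def)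
  have "cmod \<zeta> * cos (Arg \<zeta> - Arg b) = Re (of_real (cmod \<zeta>) * cis (Arg \<zeta>) * cnj (cis (Arg b)))"
    by (simp add: cos_diff algebra_simps)
  also have "\<dots> = Re (\<zeta> * cnj b)" using b z by simp
  finally show ?thesis
    using cmod_diff_power2_unit[OF assms, of \<zeta> 1] by (simp add: poisson_def algebra_simps)
qed

lemma poisson_pos:
  assumes "\<zeta> \<in> hdisk" "cmod b = 1"
  shows "poisson \<zeta> b > 0"
proof -
  have "\<zeta> \<noteq> b" using assms by auto
  then show ?thesis using assms by (simp add: poisson_eq power_less_one_iff)
qed

lemma poisson_horo_circle:
  assumes "horo_circle b c r" "\<zeta> \<in> sphere c r - {b}" "cmod b = 1"
  shows "poisson \<zeta> b = (1 - r) / r"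
proof -
  have r: "0 < r" "r < 1" and c: "c = of_real (1 - r) * b"
    using assms(1) horo_circle_iff[OF assms(3)] by auto
  have "cmod (\<zeta> - c) = r" using assms(2) by (simp add: dist_norm norm_minus_commute)
  then have "r\<^sup>2 = (cmod \<zeta>)\<^sup>2 - 2 * (1 - r) * Re (\<zeta> * cnj b) + (1 - r)\<^sup>2"
    using cmod_diff_power2_unit[OF assms(3), of \<zeta> "1 - r"] c by simp
  moreover have w: "(cmod (\<zeta> - b))\<^sup>2 = (cmod \<zeta>)\<^sup>2 - 2 * Re (\<zeta> * cnj b) + 1"
    using cmod_diff_power2_unit[OF assms(3), of \<zeta> 1] by simp
  ultimately have "(1 - (cmod \<zeta>)\<^sup>2) * r = (1 - r) * (cmod (\<zeta> - b))\<^sup>2"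
    unfolding w by (simp add: power2_eq_square algebra_simps)
  moreover have "(cmod (\<zeta> - b))\<^sup>2 \<noteq> 0" using assms(2) by simp
  ultimately show ?thesis using r by (simp add: poisson_eq[OF assms(3)] frac_eq_eq)
qed

lemma hyp_dist0_mono:
  assumes "cmod w \<le> cmod z" "cmod z < 1"
  shows "hyp_dist0 w \<le> hyp_dist0 z"
proof -
  have "(1 + cmod w) / (1 - cmod w) \<le> (1 + cmod z) / (1 - cmod z)"
    by (rule frac_le) (use assms in auto)
  moreover have "0 < (1 + cmod w) / (1 - cmod w)"
    by (rule divide_pos_pos) (use assms norm_ge_zero[of w] in linarith)+
  ultimately show ?thesis unfolding hyp_dist0_def by (intro ln_mono)
qed

lemma hyp_dist0_set_horo_circle:
  assumes h: "horo_circle b c r" and b: "cmod b = 1"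
  shows "hyp_dist0_set (sphere c r - {b}) = ln ((1 + \<bar>1 - 2 * r\<bar>) / (1 - \<bar>1 - 2 * r\<bar>))"
proof -
  have r: "0 < r" "r < 1" and c: "c = of_real (1 - r) * b"
    using h horo_circle_iff[OF b] by auto
  define p where "p = complex_of_real (1 - 2 * r) * b"
  have cp: "cmod p = \<bar>1 - 2 * r\<bar>" using b by (simp add: p_def norm_mult del: of_real_diff)
  have "c - p = of_real r * b" by (simp add: c p_def algebra_simps)
  then have "dist c p = r" using b r by (simp add: dist_norm norm_mult)
  moreover have "p \<noteq> b" using cp b r by auto
  ultimately have p: "p \<in> sphere c r - {b}" by simp
  have "hyp_dist0_set (sphere c r - {b}) = hyp_dist0 p"
    unfolding hyp_dist0_set_def
  proof (rule cInf_eq_minimum)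
    fix y assume "y \<in> hyp_dist0 ` (sphere c r - {b})"
    then obtain z where z: "z \<in> sphere c r - {b}" "y = hyp_dist0 z" by blast
    have "cmod z < 1" using z h by (auto simp: horo_circle_def)
    moreover have "cmod c = 1 - r" using b r c by (simp add: norm_mult del: of_real_diff)
    moreover have "cmod (z - c) = r" using z by (simp add: dist_norm norm_minus_commute)
    ultimately show "hyp_dist0 p \<le> y"
      unfolding z cp[symmetric]
      by (intro hyp_dist0_mono)
        (use cp norm_triangle_ineq2[of c z] norm_triangle_ineq2[of "c - z" c] norm_triangle_ineq2[of "z - c" "-c"] in
          \<open>auto simp: norm_minus_commute\<close>)
  qed (use p in blast)
  then show ?thesis by (simp add: hyp_dist0_def cp)
qed

lemma horo_bracket_eq_ln_poisson:
  assumes z: "\<zeta> \<in> hdisk" and b: "cmod b = 1"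
  shows "horo_bracket \<zeta> b = ln (poisson \<zeta> b)"
proof -
  \<comment> \<open>Serves both halves of \<open>the_equality\<close>: every admissible pair of
    centre and radius yields the same number, so uniqueness of the value follows without comparing
    two horocycles. The origin is internal exactly when r > 1/2, and the sign convention then turns
    ln (r / (1 - r)) into ln ((1 - r) / r).\<close>
  have key: "s = ln (poisson \<zeta> b)"
    if h: "horo_circle b c r" "\<zeta> \<in> sphere c r - {b}"
      and s: "s = (if 0 \<in> ball c r then - hyp_dist0_set (sphere c r - {b})
          else hyp_dist0_set (sphere c r - {b}))" for s c r
  proof -
    have r: "0 < r" "r < 1" and c: "c = of_real (1 - r) * b"
      using h horo_circle_iff[OF b] by auto
    have "cmod c = 1 - r" using b r c by (simp add: norm_mult del: of_real_diff)
    then have i: "0 \<in> ball c r \<longleftrightarrow> 1 / 2 < r" by auto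
    have l: "ln (r / (1 - r)) = - ln ((1 - r) / r)" using r by (simp add: ln_div)
    show ?thesis
    proof (cases "1 / 2 < r")
      case True
      moreover have "2 * r / (2 - 2 * r) = r / (1 - r)" using r by (simp add: field_simps)
      ultimately show ?thesis using s i l r hyp_dist0_set_horo_circle[OF h(1) b] poisson_horo_circle[OF h b]
        by simp
    next
      case False
      moreover have "(2 - 2 * r) / (2 * r) = (1 - r) / r" using r by (simp add: field_simps)
      ultimately show ?thesis using s i r hyp_dist0_set_horo_circle[OF h(1) b] poisson_horo_circle[OF h b]
        by simp
    qed
  qed
  define q where "q = Re (\<zeta> * cnj b)"
  \<comment> \<open>The condition that the circle of centre (1 - r) b and radius r passes through
    \<zeta> is linear in r, since the squares of r cancel; this is its solution. The bound r < 1
    amounts to |\<zeta>| < 1.\<close>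
  define r where "r = (cmod (\<zeta> - b))\<^sup>2 / (2 * (1 - q))"
  have "q \<le> cmod (\<zeta> * cnj b)" unfolding q_def by (rule complex_Re_le_cmod)
  then have q: "q < 1" using z b by (simp add: norm_mult)
  have w: "(cmod (\<zeta> - b))\<^sup>2 = (cmod \<zeta>)\<^sup>2 - 2 * q + 1"
    using cmod_diff_power2_unit[OF b, of \<zeta> 1] by (simp add: q_def)
  have zb: "\<zeta> \<noteq> b" using z b by auto
  have "(cmod \<zeta>)\<^sup>2 < 1" using z by (simp add: power_less_one_iff)
  then have r: "0 < r" "r < 1" using q zb unfolding r_def
    by (simp, simp add: w)
  have "r * (2 * (1 - q)) = (cmod \<zeta>)\<^sup>2 - 2 * q + 1" using q by (simp add: r_def w[symmetric])
  then have "(cmod \<zeta>)\<^sup>2 - 2 * (1 - r) * q + (1 - r)\<^sup>2 = r\<^sup>2"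
    by (simp add: algebra_simps power2_eq_square)
  then have "(cmod (\<zeta> - of_real (1 - r) * b))\<^sup>2 = r\<^sup>2"
    using cmod_diff_power2_unit[OF b, of \<zeta> "1 - r"] by (simp add: q_def)
  then have "cmod (\<zeta> - of_real (1 - r) * b) = r" using r
    by (metis norm_ge_zero order_less_imp_le power2_eq_imp_eq)
  then have m: "\<zeta> \<in> sphere (of_real (1 - r) * b) r - {b}" using zb
    by (simp add: dist_norm norm_minus_commute)
  have h: "horo_circle b (of_real (1 - r) * b) r" using r horo_circle_iff[OF b] by simp
  show ?thesis unfolding horo_bracket_def
  proof (rule the_equality)
    show "\<exists>c r. horo_circle b c r \<and> \<zeta> \<in> sphere c r - {b} \<and>
      ln (poisson \<zeta> b) = (if 0 \<in> ball c r then - hyp_dist0_set (sphere c r - {b})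
          else hyp_dist0_set (sphere c r - {b}))"
      using key[OF h m refl] by (intro exI conjI) (rule h, rule m, rule sym)
  qed (elim exE conjE, rule key)
qed

lemma exp_horo_bracket:
  assumes "\<zeta> \<in> hdisk" "cmod b = 1"
  shows "exp (\<nu> * complex_of_real (horo_bracket \<zeta> b)) = complex_of_real (poisson \<zeta> b) powr \<nu>"
  using poisson_pos[OF assms] by (simp add: horo_bracket_eq_ln_poisson[OF assms] powr_def Ln_of_real)

section \<open>The eigenvalue equation for powers of the Poisson kernel\<close>

lemma dx_dy_eq:
  assumes "(f has_derivative f') (at z)"
  shows "dx f z = f' 1" "dy f z = f' \<i>"
proof -
  have "((\<lambda>t. f (z + w * complex_of_real t)) has_vector_derivative f' w) (at 0)" for w
  proof -
    have "((\<lambda>t. z + w * complex_of_real t) has_derivative (\<lambda>h. w * of_real h)) (at 0)"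
      by (auto intro!: derivative_eq_intros)
    moreover have "(f has_derivative f') (at (z + w * complex_of_real 0))" using assms by simp
    ultimately have "((\<lambda>t. f (z + w * complex_of_real t)) has_derivative (\<lambda>h. f' (w * of_real h))) (at 0)"
      by (rule has_derivative_compose)
    moreover have "linear f'" using assms has_derivative_linear by blast
    then have "f' (w * of_real h) = h *\<^sub>R f' w" for h
      by (metis linear_cmul mult.commute scaleR_conv_of_real)
    ultimately show ?thesis by (simp add: has_vector_derivative_def)
  qed
  from this[of 1] this[of \<i>] show "dx f z = f' 1" "dy f z = f' \<i>"
    by (auto simp: dx_def dy_def intro: vector_derivative_at)
qed

text \<open>On an open set the values of f there determine its derivatives, so f may be replaced by
  a closed formula g known only on S. This is applied twice: to the power itself, and then to its
  partial derivatives, whose formulas are known only in the disk.\<close>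

lemma C1_onI:
  assumes S: "open S"
    and d: "\<And>z. z \<in> S \<Longrightarrow> (g has_derivative (\<lambda>h. of_real (Re h) * gx z + of_real (Im h) * gy z)) (at z)"
    and c: "continuous_on S gx" "continuous_on S gy"
    and eq: "\<And>z. z \<in> S \<Longrightarrow> f z = g z"
  shows "C1_on S f" "\<And>z. z \<in> S \<Longrightarrow> dx f z = gx z" "\<And>z. z \<in> S \<Longrightarrow> dy f z = gy z"
proof -
  have D: "(f has_derivative (\<lambda>h. of_real (Re h) * gx z + of_real (Im h) * gy z)) (at z)"
    if "z \<in> S" for z
    by (rule has_derivative_transform_within_open[OF d[OF that] S that]) (simp add: eq)
  show x: "dx f z = gx z" and y: "dy f z = gy z" if "z \<in> S" for z
    using dx_dy_eq[OF D[OF that]] by simp_all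
  show "C1_on S f"
    unfolding C1_on_def using D c
    by (auto simp: differentiable_def x y cong: continuous_on_cong)
qed

context
  fixes b :: complex and \<nu> :: complex
  assumes b: "cmod b = 1"
begin

definition conf :: "complex \<Rightarrow> real" where
  "conf z = 1 - (Re z)\<^sup>2 - (Im z)\<^sup>2"

lemma conf_pos: "z \<in> hdisk \<Longrightarrow> conf z > 0"
  using cmod_power2[of z] by (simp add: conf_def power_less_one_iff flip: diff_diff_eq2 diff_diff_eq)
     (smt (verit) norm_ge_zero power_less_one_iff zero_less_numeral)

definition gap :: "complex \<Rightarrow> real" where
  "gap z = (Re z - Re b)\<^sup>2 + (Im z - Im b)\<^sup>2"

lemma gap_pos: "z \<in> hdisk \<Longrightarrow> gap z > 0"
  using b by (cases "z = b") (auto simp: gap_def sum_power2_gt_zero_iff complex_eq_iff)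

text \<open>The power of the Poisson kernel written as exp (\<nu> ln P), with ln P = ln
  \<open>conf\<close> - ln \<open>gap\<close>. The functions \<open>wave_x\<close> to
  \<open>wave_yy\<close> below are the partial derivatives of the real function ln P, so \<nu>
  enters only through the exponential.\<close>

definition wave :: "complex \<Rightarrow> complex" where
  "wave z = exp (\<nu> * of_real (ln (conf z) - ln (gap z)))"

definition wave_x :: "complex \<Rightarrow> real" where
  "wave_x z = - 2 * Re z / conf z - 2 * (Re z - Re b) / gap z"

definition wave_y :: "complex \<Rightarrow> real" where
  "wave_y z = - 2 * Im z / conf z - 2 * (Im z - Im b) / gap z"

definition wave_xx :: "complex \<Rightarrow> real" where
  "wave_xx z = (- 2 * conf z - 4 * (Re z)\<^sup>2) / (conf z)\<^sup>2 - (2 * gap z - 4 * (Re z - Re b)\<^sup>2) / (gap z)\<^sup>2"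

definition wave_xy :: "complex \<Rightarrow> real" where
  "wave_xy z = - 4 * Re z * Im z / (conf z)\<^sup>2 + 4 * (Re z - Re b) * (Im z - Im b) / (gap z)\<^sup>2"

definition wave_yy :: "complex \<Rightarrow> real" where
  "wave_yy z = (- 2 * conf z - 4 * (Im z)\<^sup>2) / (conf z)\<^sup>2 - (2 * gap z - 4 * (Im z - Im b)\<^sup>2) / (gap z)\<^sup>2"

lemma conf_deriv: "(conf has_derivative (\<lambda>h. - 2 * Re z * Re h - 2 * Im z * Im h)) (at z)"
  unfolding conf_def[abs_def] by (auto intro!: derivative_eq_intros)

lemma gap_deriv: "(gap has_derivative (\<lambda>h. 2 * (Re z - Re b) * Re h + 2 * (Im z - Im b) * Im h)) (at z)"
  unfolding gap_def[abs_def] by (auto intro!: derivative_eq_intros simp: algebra_simps)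

lemma wave_deriv:
  assumes z: "z \<in> hdisk"
  shows "(wave has_derivative (\<lambda>h. of_real (Re h) * (wave z * \<nu> * of_real (wave_x z))
     + of_real (Im h) * (wave z * \<nu> * of_real (wave_y z)))) (at z)"
proof -
  have "((\<lambda>z. ln (conf z) - ln (gap z)) has_derivative (\<lambda>h. wave_x z * Re h + wave_y z * Im h)) (at z)"
    by (rule derivative_eq_intros conf_deriv gap_deriv conf_pos gap_pos z refl)+
      (simp add: wave_x_def wave_y_def fun_eq_iff divide_inverse algebra_simps)
  then have "((\<lambda>z. \<nu> * of_real (ln (conf z) - ln (gap z))) has_derivative
      (\<lambda>h. \<nu> * of_real (wave_x z * Re h + wave_y z * Im h))) (at z)"
    by (intro has_derivative_mult_right has_derivative_of_real)
  from has_derivative_compose[OF this DERIV_exp[unfolded has_field_derivative_def]] show ?thesis unfolding wave_def[abs_def]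
    by (simp add: algebra_simps)
qed

text \<open>With the two inverse squares treated as atoms this is a polynomial identity. It turns
  the quotient rule applied to the gradient of ln P into the second partials, once as stated and
  once with the coordinates exchanged.\<close>

lemma quotient_gradient_eq:
  fixes x y X Y u w s t :: real
  shows "(- 2 * s * u - - 2 * x * (- 2 * x * s - 2 * y * t)) / (u * u)
       - (2 * s * w - 2 * X * (2 * X * s + 2 * Y * t)) / (w * w)
     = ((- 2 * u - 4 * x\<^sup>2) / u\<^sup>2 - (2 * w - 4 * X\<^sup>2) / w\<^sup>2) * s
       + (- 4 * x * y / u\<^sup>2 + 4 * X * Y / w\<^sup>2) * t"
proof -
  define a c where "a = inverse (u * u)" and "c = inverse (w * w)"
  show ?thesis unfolding divide_inverse power2_eq_square a_def[symmetric] c_def[symmetric]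
    by (simp add: algebra_simps)
qed

lemma wave_x_deriv:
  assumes z: "z \<in> hdisk"
  shows "(wave_x has_derivative (\<lambda>h. wave_xx z * Re h + wave_xy z * Im h)) (at z)"
proof -
  have n: "((\<lambda>z. - 2 * Re z) has_derivative (\<lambda>h. - 2 * Re h)) (at z)"
    "((\<lambda>z. 2 * (Re z - Re b)) has_derivative (\<lambda>h. 2 * Re h)) (at z)"
    by (auto intro!: derivative_eq_intros)
  have u: "(conf has_derivative (\<lambda>h. - 2 * Re z * Re h - 2 * Im z * Im h)) (at z)"
    and w: "(gap has_derivative (\<lambda>h. 2 * (Re z - Re b) * Re h + 2 * (Im z - Im b) * Im h)) (at z)"
    using conf_deriv[of z] gap_deriv[of z] by (auto elim!: has_derivative_eq_rhs)
  have "conf z \<noteq> 0" "gap z \<noteq> 0" using conf_pos[OF z] gap_pos[OF z] by auto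
  then have "(wave_x has_derivative (\<lambda>h.
      (- 2 * Re h * conf z - - 2 * Re z * (- 2 * Re z * Re h - 2 * Im z * Im h)) / (conf z * conf z)
       - (2 * Re h * gap z - 2 * (Re z - Re b) * (2 * (Re z - Re b) * Re h + 2 * (Im z - Im b) * Im h))
          / (gap z * gap z))) (at z)"
    unfolding wave_x_def[abs_def]
    by (intro has_derivative_diff has_derivative_divide' u w n)
  then show ?thesis
    unfolding quotient_gradient_eq wave_xx_def wave_xy_def .
qed

lemma wave_y_deriv:
  assumes z: "z \<in> hdisk"
  shows "(wave_y has_derivative (\<lambda>h. wave_yy z * Im h + wave_xy z * Re h)) (at z)"
proof -
  have n: "((\<lambda>z. - 2 * Im z) has_derivative (\<lambda>h. - 2 * Im h)) (at z)"
    "((\<lambda>z. 2 * (Im z - Im b)) has_derivative (\<lambda>h. 2 * Im h)) (at z)"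
    by (auto intro!: derivative_eq_intros)
  have u: "(conf has_derivative (\<lambda>h. - 2 * Im z * Im h - 2 * Re z * Re h)) (at z)"
    and w: "(gap has_derivative (\<lambda>h. 2 * (Im z - Im b) * Im h + 2 * (Re z - Re b) * Re h)) (at z)"
    using conf_deriv[of z] gap_deriv[of z] by (auto elim!: has_derivative_eq_rhs)
  have "conf z \<noteq> 0" "gap z \<noteq> 0" using conf_pos[OF z] gap_pos[OF z] by auto
  then have "(wave_y has_derivative (\<lambda>h.
      (- 2 * Im h * conf z - - 2 * Im z * (- 2 * Im z * Im h - 2 * Re z * Re h)) / (conf z * conf z)
       - (2 * Im h * gap z - 2 * (Im z - Im b) * (2 * (Im z - Im b) * Im h + 2 * (Re z - Re b) * Re h))
          / (gap z * gap z))) (at z)"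
    unfolding wave_y_def[abs_def]
    by (intro has_derivative_diff has_derivative_divide' u w n)
  then show ?thesis
    unfolding quotient_gradient_eq wave_yy_def wave_xy_def by (simp only: mult_ac)
qed

lemma continuous_on_wave: "continuous_on hdisk wave" "continuous_on hdisk wave_x" "continuous_on hdisk wave_y"
  using has_derivative_continuous[OF wave_deriv] has_derivative_continuous[OF wave_x_deriv]
    has_derivative_continuous[OF wave_y_deriv]
  by (simp_all add: continuous_at_imp_continuous_on)

lemma continuous_on_conf_gap: "continuous_on hdisk conf" "continuous_on hdisk gap"
  unfolding conf_def[abs_def] gap_def[abs_def] by (intro continuous_intros)+

lemma continuous_on_wave_second:
  "continuous_on hdisk wave_xx" "continuous_on hdisk wave_xy" "continuous_on hdisk wave_yy"
proof -
  have "\<forall>z\<in>hdisk. (conf z)\<^sup>2 \<noteq> 0" "\<forall>z\<in>hdisk. (gap z)\<^sup>2 \<noteq> 0"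
    using conf_pos gap_pos by fastforce+
  then show "continuous_on hdisk wave_xx" "continuous_on hdisk wave_xy" "continuous_on hdisk wave_yy"
    unfolding wave_xx_def[abs_def] wave_xy_def[abs_def] wave_yy_def[abs_def]
    by - (intro continuous_intros continuous_on_conf_gap; assumption)+
qed

lemma clear_square_denominators:
  fixes u w M N :: real
  assumes "u \<noteq> 0" "w \<noteq> 0"
  shows "u\<^sup>2 * w\<^sup>2 * (N / u\<^sup>2 - M / w\<^sup>2) = N * w\<^sup>2 - M * u\<^sup>2"
  using assms by (simp add: right_diff_distrib)

text \<open>In the hyperbolic metric ln P has gradient of length 1, being a signed distance from
  horocycles, and Laplacian -1. Multiplying by the square of \<open>gap\<close> clears the
  denominators and leaves polynomial identities in \<open>conf\<close> and
  \<open>gap\<close>.\<close>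

lemma wave_laplace:
  assumes z: "z \<in> hdisk"
  shows "(conf z)\<^sup>2 * ((wave_x z)\<^sup>2 + (wave_y z)\<^sup>2) = 4"
    and "(conf z)\<^sup>2 * (wave_xx z + wave_yy z) = - 4"
proof -
  note pos = conf_pos[OF z] gap_pos[OF z]
  define x y p q where "x = Re z" and "y = Im z" and "p = Re b" and "q = Im b"
  have pq: "q\<^sup>2 = 1 - p\<^sup>2" using b cmod_power2[of b] by (simp add: p_def q_def)
  have c: "conf z = 1 - x\<^sup>2 - y\<^sup>2" by (simp add: conf_def x_def y_def)
  then have xy: "x\<^sup>2 + y\<^sup>2 = 1 - conf z" by simp
  have g: "gap z = x\<^sup>2 + y\<^sup>2 + 1 - 2 * (x * p + y * q)"
    using pq by (simp add: gap_def x_def y_def p_def q_def power2_eq_square algebra_simps)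
  have gx: "(x - p)\<^sup>2 + (y - q)\<^sup>2 = gap z" by (simp add: gap_def x_def y_def p_def q_def)
  \<comment> \<open>The cross term between the gradients of ln \<open>conf\<close> and ln
    \<open>gap\<close>; it reduces to \<open>gap\<close> and \<open>conf\<close> alone because b has
    modulus 1.\<close>
  have m: "2 * (x * (x - p) + y * (y - q)) = gap z - conf z"
    unfolding c g by (simp add: power2_eq_square algebra_simps)
  have ux: "conf z * gap z * wave_x z = - 2 * (x * gap z + (x - p) * conf z)"
    and uy: "conf z * gap z * wave_y z = - 2 * (y * gap z + (y - q) * conf z)"
    using pos by (simp_all add: wave_x_def wave_y_def x_def y_def p_def q_def field_simps)
  have uxx: "(conf z)\<^sup>2 * (gap z)\<^sup>2 * wave_xx z
      = (- 2 * conf z - 4 * x\<^sup>2) * (gap z)\<^sup>2 - (2 * gap z - 4 * (x - p)\<^sup>2) * (conf z)\<^sup>2"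
    and uyy: "(conf z)\<^sup>2 * (gap z)\<^sup>2 * wave_yy z
      = (- 2 * conf z - 4 * y\<^sup>2) * (gap z)\<^sup>2 - (2 * gap z - 4 * (y - q)\<^sup>2) * (conf z)\<^sup>2"
    using pos unfolding wave_xx_def wave_yy_def x_def y_def p_def q_def by (intro clear_square_denominators; simp)+
  have "(conf z)\<^sup>2 * ((wave_x z)\<^sup>2 + (wave_y z)\<^sup>2) * (gap z)\<^sup>2
      = (conf z * gap z * wave_x z)\<^sup>2 + (conf z * gap z * wave_y z)\<^sup>2"
    by (simp add: power_mult_distrib distrib_left distrib_right)
  also have "\<dots> = 4 * (x\<^sup>2 + y\<^sup>2) * (gap z)\<^sup>2 + 4 * ((x - p)\<^sup>2 + (y - q)\<^sup>2) * (conf z)\<^sup>2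
        + 4 * (2 * (x * (x - p) + y * (y - q))) * conf z * gap z"
    unfolding ux uy by algebra
  also have "\<dots> = 4 * (gap z)\<^sup>2"
    unfolding gx m xy by algebra
  finally show "(conf z)\<^sup>2 * ((wave_x z)\<^sup>2 + (wave_y z)\<^sup>2) = 4" using pos by simp
  have "(conf z)\<^sup>2 * (wave_xx z + wave_yy z) * (gap z)\<^sup>2
      = (conf z)\<^sup>2 * (gap z)\<^sup>2 * wave_xx z + (conf z)\<^sup>2 * (gap z)\<^sup>2 * wave_yy z"
    by (simp add: algebra_simps)
  also have "\<dots> = (- 4 * conf z - 4 * (x\<^sup>2 + y\<^sup>2)) * (gap z)\<^sup>2 - 4 * (gap z - ((x - p)\<^sup>2 + (y - q)\<^sup>2)) * (conf z)\<^sup>2"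
    unfolding uxx uyy by algebra
  also have "\<dots> = - 4 * (gap z)\<^sup>2"
    unfolding gx xy by algebra
  finally have "(conf z)\<^sup>2 * (wave_xx z + wave_yy z) * (gap z)\<^sup>2 = - 4 * (gap z)\<^sup>2" .
  moreover have "(gap z)\<^sup>2 \<noteq> 0" using pos by simp
  ultimately show "(conf z)\<^sup>2 * (wave_xx z + wave_yy z) = - 4"
    using mult_right_cancel by blast
qed

lemma poisson_powr_eq_wave:
  assumes z: "z \<in> hdisk"
  shows "complex_of_real (poisson z b) powr \<nu> = wave z"
proof -
  have "poisson z b = conf z / gap z"
    unfolding poisson_eq[OF b] conf_def gap_def cmod_power2 by simp
  moreover have "conf z / gap z > 0" using conf_pos[OF z] gap_pos[OF z] by simp
  ultimately show ?thesis using conf_pos[OF z] gap_pos[OF z]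
    by (simp add: wave_def powr_def Ln_of_real ln_div del: of_real_divide)
qed

lemma laplace_eigenfunction_poisson:
  "laplace_eigenfunction (\<lambda>\<zeta>. complex_of_real (poisson \<zeta> b) powr \<nu>) (\<nu> * (\<nu> - 1))"
proof -
  let ?f = "\<lambda>\<zeta>. complex_of_real (poisson \<zeta> b) powr \<nu>"
  note cont = continuous_on_wave continuous_on_wave_second
  note 0 = C1_onI[of hdisk wave "\<lambda>z. wave z * \<nu> * of_real (wave_x z)"
      "\<lambda>z. wave z * \<nu> * of_real (wave_y z)" ?f, OF open_ball wave_deriv _ _ poisson_powr_eq_wave]
  have f: "C1_on hdisk ?f" by (rule 0(1)) (assumption | intro continuous_intros cont)+
  have fx: "dx ?f z = wave z * \<nu> * of_real (wave_x z)" if "z \<in> hdisk" for z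
    by (rule 0(2)) (assumption | rule that | intro continuous_intros cont)+
  have fy: "dy ?f z = wave z * \<nu> * of_real (wave_y z)" if "z \<in> hdisk" for z
    by (rule 0(3)) (assumption | rule that | intro continuous_intros cont)+
  have X: "((\<lambda>z. wave z * \<nu> * of_real (wave_x z)) has_derivative
       (\<lambda>h. of_real (Re h) * (wave z * (\<nu>\<^sup>2 * of_real ((wave_x z)\<^sup>2) + \<nu> * of_real (wave_xx z)))
          + of_real (Im h) * (wave z * (\<nu>\<^sup>2 * of_real (wave_x z * wave_y z) + \<nu> * of_real (wave_xy z))))) (at z)"
    if z: "z \<in> hdisk" for z
    by (rule derivative_eq_intros wave_deriv[OF z] wave_x_deriv[OF z] refl)+
      (simp add: fun_eq_iff power2_eq_square algebra_simps)
  have Y: "((\<lambda>z. wave z * \<nu> * of_real (wave_y z)) has_derivative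
       (\<lambda>h. of_real (Re h) * (wave z * (\<nu>\<^sup>2 * of_real (wave_x z * wave_y z) + \<nu> * of_real (wave_xy z)))
          + of_real (Im h) * (wave z * (\<nu>\<^sup>2 * of_real ((wave_y z)\<^sup>2) + \<nu> * of_real (wave_yy z))))) (at z)"
    if z: "z \<in> hdisk" for z
    by (rule derivative_eq_intros wave_deriv[OF z] wave_y_deriv[OF z] refl)+
      (simp add: fun_eq_iff power2_eq_square algebra_simps)
  note 1 = C1_onI[of hdisk _ _ _ "dx ?f", OF open_ball X _ _ fx] and 2 = C1_onI[of hdisk _ _ _ "dy ?f", OF open_ball Y _ _ fy]
  have fX: "C1_on hdisk (dx ?f)" by (rule 1(1)) (assumption | intro continuous_intros cont)+
  have fY: "C1_on hdisk (dy ?f)" by (rule 2(1)) (assumption | intro continuous_intros cont)+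
  have fxx: "dx (dx ?f) z = wave z * (\<nu>\<^sup>2 * of_real ((wave_x z)\<^sup>2) + \<nu> * of_real (wave_xx z))"
    if "z \<in> hdisk" for z
    by (rule 1(2)) (assumption | rule that | intro continuous_intros cont)+
  have fyy: "dy (dy ?f) z = wave z * (\<nu>\<^sup>2 * of_real ((wave_y z)\<^sup>2) + \<nu> * of_real (wave_yy z))"
    if "z \<in> hdisk" for z
    by (rule 2(3)) (assumption | rule that | intro continuous_intros cont)+
  have "laplace_beltrami ?f z = \<nu> * (\<nu> - 1) * ?f z" if z: "z \<in> hdisk" for z
  proof -
    have c: "1 - ((Re z)\<^sup>2 + (Im z)\<^sup>2) = conf z" by (simp add: conf_def)
    have "laplace_beltrami ?f z = wave z / 4 * (\<nu>\<^sup>2 * of_real ((conf z)\<^sup>2 * ((wave_x z)\<^sup>2 + (wave_y z)\<^sup>2))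
        + \<nu> * of_real ((conf z)\<^sup>2 * (wave_xx z + wave_yy z)))"
      unfolding laplace_beltrami_def fxx[OF z] fyy[OF z] c by (simp add: algebra_simps)
    then show ?thesis unfolding wave_laplace[OF z] poisson_powr_eq_wave[OF z]
      by (simp add: algebra_simps power2_eq_square)
  qed
  moreover have "?f 0 \<noteq> 0" using poisson_pos[of 0 b] b by (simp add: powr_def)
  then have "\<exists>z\<in>hdisk. ?f z \<noteq> 0" by (intro bexI[of _ 0]) auto
  ultimately show ?thesis unfolding laplace_eigenfunction_def C2_on_def using f fX fY
    by (metis centre_in_ball zero_less_one)
qed

end

section \<open>Brackets for normals off the circle, and Borel measurability\<close>

text \<open>When b lies inside the disk, the removed point b may itself be the point of the circle
  nearest to the origin. The infimum is then not attained, but it is still the value at a limit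
  point.\<close>

lemma INF_eq_limit_point:
  fixes f :: "'a :: metric_space \<Rightarrow> real"
  assumes p: "p islimpt S" and f: "isCont f p" and le: "\<And>z. z \<in> S \<Longrightarrow> f p \<le> f z"
  shows "(INF z\<in>S. f z) = f p"
proof (rule cInf_eq_non_empty)
  show "f ` S \<noteq> {}" using p by auto
  show "f p \<le> x" if "x \<in> f ` S" for x using that le by auto
  show "y \<le> f p" if y: "\<And>x. x \<in> f ` S \<Longrightarrow> y \<le> x" for y
  proof (rule tendsto_lowerbound)
    show "(f \<longlongrightarrow> f p) (at p within S)"
      using f unfolding isCont_def by (rule tendsto_within_subset) simp
    show "eventually (\<lambda>x. y \<le> f x) (at p within S)"
      using y by (auto simp: eventually_at_filter)
    show "at p within S \<noteq> bot" using p by (simp add: trivial_limit_within)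
  qed
qed

lemma sphere_islimpt:
  fixes c :: complex
  assumes "r > 0" "p \<in> sphere c r"
  shows "p islimpt sphere c r"
proof (rule connected_imp_perfect)
  show "connected (sphere c r)" by (rule connected_sphere) simp
  have "c + of_real r \<in> sphere c r" "c - of_real r \<in> sphere c r" "c + of_real r \<noteq> c - of_real r"
    using assms(1) by (auto simp: dist_norm)
  then show "sphere c r \<noteq> {x}" for x by (metis singletonD)
qed (rule assms)

text \<open>The point b is a limit of the rest of the circle, which lies in the open disk, so |b| >
  1 is impossible.\<close>

lemma horo_circle_outside:
  assumes "cmod b > 1"
  shows "\<not> horo_circle b c r"
proof
  assume h: "horo_circle b c r"
  then have r: "r > 0" "b \<in> sphere c r" "sphere c r - {b} \<subseteq> ball 0 1" by (auto simp: horo_circle_def)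
  have "b islimpt sphere c r" by (rule sphere_islimpt) (use r in auto)
  then have "b islimpt (sphere c r - {b})" by (simp add: islimpt_punctured[symmetric])
  then have "b \<in> closure (ball 0 1)" using r(3) by (metis closure_mono closure_def UnCI mem_Collect_eq subsetD)
  then show False using assms by simp
qed

text \<open>Equality of the tangent lines puts the centre on the real line through 0 and b. Unlike
  for |b| = 1, the circle may lie on either side of b, so t carries a sign and the radius is |t|
  |b|; the last condition says that the farthest point of the circle is still in the disk.\<close>

lemma horo_circle_inside_iff:
  assumes b: "b \<noteq> 0" "cmod b < 1"
  shows "horo_circle b c r \<longleftrightarrow> (\<exists>t. t \<noteq> 0 \<and> c = of_real (1 - t) * b \<and> r = \<bar>t\<bar> * cmod b
    \<and> \<bar>1 - t\<bar> * cmod b + \<bar>t\<bar> * cmod b < 1)" (is "_ = ?R")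
proof
  assume h: "horo_circle b c r"
  have "(b + \<i> * b) \<in> circle_tangent 0 b"
    by (simp add: circle_tangent_def inner_complex_def)
  then have "(b + \<i> * b) \<in> circle_tangent c b" using h by (simp add: horo_circle_def)
  then have i: "Im (c * cnj b) = 0"
    by (simp add: circle_tangent_def inner_complex_def algebra_simps)
  define t where "t = 1 - Re (c * cnj b) / (cmod b)\<^sup>2"
  have "c * cnj b = of_real (Re (c * cnj b))" using i by (simp add: complex_eq_iff)
  then have "c * cnj b * b = of_real (Re (c * cnj b)) * b" by simp
  moreover have "cnj b * b = of_real ((cmod b)\<^sup>2)" by (metis complex_norm_square mult.commute)
  ultimately have "c * of_real ((cmod b)\<^sup>2) = of_real (Re (c * cnj b)) * b" by (simp only: mult.assoc)
  then have c: "c = of_real (1 - t) * b" using b by (simp add: t_def field_simps)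
  have cb: "b - c = of_real t * b" by (simp add: c algebra_simps)
  have r: "r > 0" "r = \<bar>t\<bar> * cmod b"
    using h cb by (auto simp: horo_circle_def dist_norm norm_mult norm_minus_commute)
  then have t0: "t \<noteq> 0" by auto
  \<comment> \<open>The unit vector with c = |c| e, also usable when c = 0; then c + r e is the
    point of the circle farthest from the origin.\<close>
  define e where "e = (if 1 - t \<ge> 0 then sgn b else - sgn b)"
  have e: "cmod e = 1" using b by (simp add: e_def norm_sgn)
  have cn: "cmod c = \<bar>1 - t\<bar> * cmod b" by (simp add: c norm_mult del: of_real_diff)
  have "b = of_real (cmod b) * sgn b" using b by (simp add: sgn_eq)
  then have "c = of_real (1 - t) * (of_real (cmod b) * sgn b)" using c by simp
  also have "\<dots> = of_real (\<bar>1 - t\<bar> * cmod b) * e"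
    by (simp add: e_def abs_if algebra_simps del: of_real_diff)
      (simp add: algebra_simps)
  finally have ce: "c = of_real (cmod c) * e" unfolding cn .
  have "c + of_real r * e = of_real (cmod c + r) * e" using ce by (simp add: distrib_right)
  then have n: "cmod (c + of_real r * e) = cmod c + r" using e r by (simp add: norm_mult del: of_real_add)
  have "c + of_real r * e \<in> sphere c r" using e r(1) by (simp add: dist_norm norm_mult)
  then have "cmod (c + of_real r * e) < 1"
  proof (cases "c + of_real r * e = b")
    case False
    then have "c + of_real r * e \<in> hdisk"
      using h \<open>c + of_real r * e \<in> sphere c r\<close> unfolding horo_circle_def by blast
    then show ?thesis by simp
  qed (use b in simp)
  then show ?R using n t0 c r cn by auto
next
  assume ?R
  then obtain t where t: "t \<noteq> 0" "c = of_real (1 - t) * b" "r = \<bar>t\<bar> * cmod b"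
    "\<bar>1 - t\<bar> * cmod b + \<bar>t\<bar> * cmod b < 1" by blast
  have bc: "b - c = t *\<^sub>R b" using t by (simp add: algebra_simps scaleR_conv_of_real)
  have "circle_tangent c b = circle_tangent 0 b" unfolding circle_tangent_def bc using t(1) by simp
  moreover have "b \<in> sphere c r" using bc t(3)
    by (simp only: mem_sphere dist_norm norm_minus_commute[of c b] norm_scaleR)
  moreover have "sphere c r - {b} \<subseteq> ball 0 1"
  proof
    fix z assume "z \<in> sphere c r - {b}"
    then have "cmod (z - c) = r" by (simp add: dist_norm norm_minus_commute)
    moreover have "cmod c = \<bar>1 - t\<bar> * cmod b" using t by (simp add: norm_mult del: of_real_diff)
    ultimately show "z \<in> ball 0 1" using norm_triangle_sub[of z c] t by simp
  qed
  ultimately show "horo_circle b c r" using t b unfolding horo_circle_def by simp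
qed

lemma hyp_dist0_set_inside:
  assumes b: "b \<noteq> 0" "cmod b < 1" and h: "horo_circle b c r"
  shows "hyp_dist0_set (sphere c r - {b}) = ln ((1 + \<bar>cmod c - r\<bar>) / (1 - \<bar>cmod c - r\<bar>))"
proof -
  have r: "r > 0" using h by (simp add: horo_circle_def)
  have lt: "z \<in> sphere c r \<Longrightarrow> cmod z < 1" for z
    using h b by (cases "z = b") (auto simp: horo_circle_def)
  \<comment> \<open>The point nearest to the origin. For a circle centred at 0 all points are
    equally near, and one is picked.\<close>
  define p where "p = (if c = 0 then of_real r else c - of_real r * sgn c)"
  have cp: "p \<in> sphere c r" using r by (simp add: p_def dist_norm norm_mult norm_sgn)
  have np: "cmod p = \<bar>cmod c - r\<bar>"
  proof (cases "c = 0")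
    case False
    then have "p = of_real (cmod c - r) * sgn c" by (simp add: p_def sgn_eq algebra_simps)
    then show ?thesis using False by (simp add: norm_mult norm_sgn del: of_real_diff)
  qed (use r in \<open>simp add: p_def\<close>)
  have "p islimpt insert b (sphere c r - {b})"
    using sphere_islimpt[OF r cp] by (rule islimpt_subset) auto
  then have lim: "p islimpt sphere c r - {b}" by (simp only: islimpt_insert)
  have "hyp_dist0_set (sphere c r - {b}) = hyp_dist0 p"
    unfolding hyp_dist0_set_def
  proof (rule INF_eq_limit_point[OF lim])
    have "(1 + cmod p) / (1 - cmod p) \<noteq> 0"
      using lt[OF cp] norm_ge_zero[of p] by (simp add: add_nonneg_eq_0_iff)
    then show "isCont hyp_dist0 p"
      unfolding hyp_dist0_def[abs_def] using lt[OF cp] by (intro continuous_intros) auto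
    fix z assume z: "z \<in> sphere c r - {b}"
    then have "cmod (z - c) = r" by (simp add: dist_norm norm_minus_commute)
    then have "cmod p \<le> cmod z"
      using norm_triangle_ineq3[of c z] norm_triangle_ineq3[of c "c - z"] norm_triangle_ineq2[of c z]
        norm_triangle_ineq2[of "c - z" c]
      unfolding np by (simp add: norm_minus_commute)
    then show "hyp_dist0 p \<le> hyp_dist0 z" using lt z by (intro hyp_dist0_mono) auto
  qed
  then show ?thesis by (simp add: hyp_dist0_def np)
qed

text \<open>The t for which the circle with centre (1 - t) b through b also passes through \<zeta>:
  in |\<zeta> - b + t b| = |t b| the squares of t cancel, leaving a linear equation. It has no
  solution when \<zeta> lies on the tangent at b.\<close>

definition horo_param :: "complex \<Rightarrow> complex \<Rightarrow> real" where
  "horo_param \<zeta> b = - (cmod (\<zeta> - b))\<^sup>2 / (2 * ((\<zeta> - b) \<bullet> b))"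

lemma sphere_horo_param:
  assumes "\<zeta> \<noteq> b" "b \<noteq> 0"
  shows "\<zeta> \<in> sphere (of_real (1 - t) * b) (\<bar>t\<bar> * cmod b) \<longleftrightarrow> (\<zeta> - b) \<bullet> b \<noteq> 0 \<and> t = horo_param \<zeta> b"
proof -
  have "of_real (1 - t) * b - \<zeta> = - ((\<zeta> - b) + t *\<^sub>R b)"
    by (simp add: scaleR_conv_of_real algebra_simps)
  then have "dist (of_real (1 - t) * b) \<zeta> = norm ((\<zeta> - b) + t *\<^sub>R b)"
    unfolding dist_norm by (simp only: norm_minus_cancel)
  then have "\<zeta> \<in> sphere (of_real (1 - t) * b) (\<bar>t\<bar> * cmod b) \<longleftrightarrow> norm ((\<zeta> - b) + t *\<^sub>R b) = norm (t *\<^sub>R b)"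
    by simp
  also have "\<dots> \<longleftrightarrow> (norm (\<zeta> - b + t *\<^sub>R b))\<^sup>2 = (norm (t *\<^sub>R b))\<^sup>2" by simp
  also have "\<dots> \<longleftrightarrow> (cmod (\<zeta> - b))\<^sup>2 + 2 * t * ((\<zeta> - b) \<bullet> b) = 0"
    unfolding power2_norm_eq_inner
    by (simp add: inner_add_left inner_add_right inner_commute[of b "\<zeta> - b"] distrib_left)
      (simp add: add.commute mult.assoc)
  also have "\<dots> \<longleftrightarrow> (\<zeta> - b) \<bullet> b \<noteq> 0 \<and> t = horo_param \<zeta> b"
  proof (cases "(\<zeta> - b) \<bullet> b = 0")
    case False
    then have "t = horo_param \<zeta> b \<longleftrightarrow> t * (2 * ((\<zeta> - b) \<bullet> b)) = - (cmod (\<zeta> - b))\<^sup>2"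
      unfolding horo_param_def by (intro nonzero_eq_divide_eq) simp
    also have "\<dots> \<longleftrightarrow> (cmod (\<zeta> - b))\<^sup>2 + 2 * t * ((\<zeta> - b) \<bullet> b) = 0"
      by (rule iffI) linarith+
    finally show ?thesis using False by simp
  qed (use assms in simp)
  finally show ?thesis .
qed

text \<open>The bracket as a function of the modulus x of the centre and the radius r; x < r means
  that the origin is internal.\<close>

definition horo_value :: "real \<Rightarrow> real \<Rightarrow> real" where
  "horo_value x r = (if x < r then -1 else 1) * ln ((1 + \<bar>x - r\<bar>) / (1 - \<bar>x - r\<bar>))"

lemma horo_bracket_inside:
  assumes b: "b \<noteq> 0" "cmod b < 1" "\<zeta> \<noteq> b" and nz: "(\<zeta> - b) \<bullet> b \<noteq> 0"
    and lt: "\<bar>1 - horo_param \<zeta> b\<bar> * cmod b + \<bar>horo_param \<zeta> b\<bar> * cmod b < 1"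
  shows "horo_bracket \<zeta> b = horo_value (\<bar>1 - horo_param \<zeta> b\<bar> * cmod b) (\<bar>horo_param \<zeta> b\<bar> * cmod b)"
proof -
  let ?t = "horo_param \<zeta> b"
  let ?c = "of_real (1 - ?t) * b" and ?r = "\<bar>?t\<bar> * cmod b"
  have t0: "?t \<noteq> 0" using assms by (simp add: horo_param_def)
  have val: "(if 0 \<in> ball c r then - hyp_dist0_set (sphere c r - {b})
          else hyp_dist0_set (sphere c r - {b})) = horo_value (cmod c) r" if "horo_circle b c r" for c r
    using hyp_dist0_set_inside[OF b(1,2) that] by (simp add: horo_value_def)
  have h: "horo_circle b ?c ?r" using horo_circle_inside_iff[OF b(1,2)] t0 lt by blast
  have m: "\<zeta> \<in> sphere ?c ?r - {b}" using sphere_horo_param[OF b(3,1), of ?t] nz b(3) by blast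
  have cn: "cmod ?c = \<bar>1 - ?t\<bar> * cmod b" by (simp add: norm_mult del: of_real_diff)
  show ?thesis unfolding horo_bracket_def
  proof (rule the_equality)
    show "\<exists>c r. horo_circle b c r \<and> \<zeta> \<in> sphere c r - {b} \<and>
        horo_value (\<bar>1 - ?t\<bar> * cmod b) ?r = (if 0 \<in> ball c r then - hyp_dist0_set (sphere c r - {b})
          else hyp_dist0_set (sphere c r - {b}))"
      using h m val[OF h] unfolding cn by metis
    fix s assume "\<exists>c r. horo_circle b c r \<and> \<zeta> \<in> sphere c r - {b} \<and>
        s = (if 0 \<in> ball c r then - hyp_dist0_set (sphere c r - {b}) else hyp_dist0_set (sphere c r - {b}))"
    then obtain c r where cr: "horo_circle b c r" "\<zeta> \<in> sphere c r - {b}" "s = horo_value (cmod c) r"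
      using val by metis
    then obtain t where t: "c = of_real (1 - t) * b" "r = \<bar>t\<bar> * cmod b"
      using horo_circle_inside_iff[OF b(1,2)] by blast
    then have "t = ?t" using cr(2) sphere_horo_param[OF b(3,1), of t] by blast
    then show "s = horo_value (\<bar>1 - ?t\<bar> * cmod b) ?r" using cr(3) t cn by simp
  qed
qed

text \<open>Without a horocycle the description ranges over the empty predicate, whatever \<zeta>
  and b are. All such b thus share one unspecified value, and a constant is measurable.\<close>

lemma horo_bracket_none:
  assumes "\<And>c r. \<not> (horo_circle b c r \<and> \<zeta> \<in> sphere c r - {b})"
  shows "horo_bracket \<zeta> b = (THE s. False)"
  unfolding horo_bracket_def by (rule arg_cong[of _ _ The]) (use assms in blast)

text \<open>For b = 0 the tangent taken with centre 0 degenerates to the whole plane, while the one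
  taken with centre c misses c.\<close>

lemma horo_circle_zero: "\<not> horo_circle 0 c r"
proof
  assume h: "horo_circle 0 c r"
  have "c \<in> circle_tangent 0 0" by (simp add: circle_tangent_def)
  then have "c \<in> circle_tangent c 0" using h by (simp add: horo_circle_def)
  then show False using h by (auto simp: circle_tangent_def horo_circle_def)
qed

text \<open>A function is integrable on the circle only if it is Borel measurable on the whole plane, so the
  values of the bracket at \<open>b\<close> off the circle, which mean nothing geometrically, have to be computed too.\<close>

lemma horo_bracket_measurable:
  assumes z: "\<zeta> \<in> hdisk"
  shows "horo_bracket \<zeta> \<in> borel_measurable borel"
proof -
  define t where "t = horo_param \<zeta>"
  have [measurable]: "t \<in> borel_measurable borel" unfolding t_def horo_param_def by measurable
  define C where "C b \<longleftrightarrow> b \<noteq> 0 \<and> cmod b < 1 \<and> \<zeta> \<noteq> b \<and> (\<zeta> - b) \<bullet> b \<noteq> 0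
     \<and> \<bar>1 - t b\<bar> * cmod b + \<bar>t b\<bar> * cmod b < 1" for b
  have [measurable]: "Measurable.pred borel C" unfolding C_def by measurable
  have "horo_bracket \<zeta> b = (if cmod b = 1 then ln ((1 - (cmod \<zeta>)\<^sup>2) / (cmod (\<zeta> - b))\<^sup>2)
     else if C b then horo_value (\<bar>1 - t b\<bar> * cmod b) (\<bar>t b\<bar> * cmod b) else (THE s. False))" for b
  proof -
    consider "cmod b = 1" | "cmod b \<noteq> 1" "C b" | "cmod b > 1" | "cmod b < 1" "\<not> C b" by linarith
    then show ?thesis
    proof cases
      case 1
      then show ?thesis using horo_bracket_eq_ln_poisson[OF z] poisson_eq by simp
    next
      case 2
      then show ?thesis using horo_bracket_inside by (simp add: C_def t_def)
    next
      case 3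
      then show ?thesis using horo_circle_outside horo_bracket_none by (auto simp: C_def)
    next
      case 4
      have "\<not> (horo_circle b c r \<and> \<zeta> \<in> sphere c r - {b})" for c r
      proof
        assume h: "horo_circle b c r \<and> \<zeta> \<in> sphere c r - {b}"
        then have b: "b \<noteq> 0" "\<zeta> \<noteq> b" using horo_circle_zero by auto
        then obtain x where x: "c = of_real (1 - x) * b" "r = \<bar>x\<bar> * cmod b"
            "\<bar>1 - x\<bar> * cmod b + \<bar>x\<bar> * cmod b < 1"
          using h horo_circle_inside_iff[OF b(1) 4(1)] by blast
        then have "(\<zeta> - b) \<bullet> b \<noteq> 0" "x = t b"
          using h sphere_horo_param[OF b(2,1), of x] by (auto simp: t_def)
        then show False using 4 b x by (simp add: C_def)
      qed
      then show ?thesis using 4 horo_bracket_none by auto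
    qed
  qed
  then have "horo_bracket \<zeta> = (\<lambda>b. if cmod b = 1 then ln ((1 - (cmod \<zeta>)\<^sup>2) / (cmod (\<zeta> - b))\<^sup>2)
     else if C b then horo_value (\<bar>1 - t b\<bar> * cmod b) (\<bar>t b\<bar> * cmod b) else (THE s. False))" by blast
  also have "\<dots> \<in> borel_measurable borel" unfolding horo_value_def by measurable
  finally show ?thesis .
qed

section \<open>Moebius maps and the measure on the circle\<close>

lemma sets_bmeasure [measurable_cong, simp]: "sets bmeasure = sets borel"
  by (simp add: bmeasure_def)

lemma space_bmeasure [simp]: "space bmeasure = UNIV"
  by (simp add: bmeasure_def)

lemma cis_measurable [measurable]: "cis \<in> borel_measurable borel"
  by (intro borel_measurable_continuous_onI continuous_intros)

lemma nn_integral_bmeasure: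
  assumes [measurable]: "F \<in> borel_measurable borel"
  shows "(\<integral>\<^sup>+ b. F b \<partial>bmeasure) = (\<integral>\<^sup>+ x. F (cis x) * indicator {0..2*pi} x \<partial>lborel) / ennreal (2 * pi)"
  unfolding bmeasure_def by (subst nn_integral_distr) (auto simp: nn_integral_uniform_measure)

lemma prob_space_bmeasure: "prob_space bmeasure"
  unfolding bmeasure_def
  by (intro prob_space.prob_space_distr prob_space_uniform_measure)
    (auto simp: emeasure_lborel_Icc)

interpretation bmeasure: prob_space bmeasure
  by (rule prob_space_bmeasure)

lemma AE_bmeasure: "AE b in bmeasure. cmod b = 1"
  unfolding bmeasure_def by (subst AE_distr_iff) auto

text \<open>The part beyond 2 pi is moved back by one period. Half-open intervals are used so that
  the pieces do not overlap.\<close>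

lemma nn_integral_periodic_interval:
  fixes f :: "real \<Rightarrow> ennreal"
  assumes [measurable]: "f \<in> borel_measurable borel" and p: "\<And>x. f (x + 2 * pi) = f x"
    and s: "0 \<le> s" "s < 2 * pi"
  shows "(\<integral>\<^sup>+ x. f x * indicator {s..s + 2*pi} x \<partial>lborel) = (\<integral>\<^sup>+ x. f x * indicator {0..2*pi} x \<partial>lborel)"
proof -
  have closed: "(\<integral>\<^sup>+ x. f x * indicator {a..b} x \<partial>lborel) = (\<integral>\<^sup>+ x. f x * indicator {a..<b} x \<partial>lborel)" for a b
  proof (rule nn_integral_cong_AE)
    show "AE x in lborel. f x * indicator {a..b} x = f x * indicator {a..<b} x"
      using AE_lborel_singleton[of b] by eventually_elim (auto simp: indicator_def)
  qed
  have shift: "(\<integral>\<^sup>+ x. f x * indicator {2*pi..<s + 2*pi} x \<partial>lborel) = (\<integral>\<^sup>+ x. f x * indicator {0..<s} x \<partial>lborel)"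
    by (subst nn_integral_real_affine[where c=1 and t="2*pi"])
      (auto simp: p add.commute intro!: nn_integral_cong split: split_indicator)
  have "(\<integral>\<^sup>+ x. f x * indicator {s..<s + 2*pi} x \<partial>lborel)
     = (\<integral>\<^sup>+ x. f x * indicator {s..<2*pi} x + f x * indicator {2*pi..<s+2*pi} x \<partial>lborel)"
    using s by (intro nn_integral_cong) (auto split: split_indicator)
  also have "\<dots> = (\<integral>\<^sup>+ x. f x * indicator {s..<2*pi} x \<partial>lborel) + (\<integral>\<^sup>+ x. f x * indicator {0..<s} x \<partial>lborel)"
    by (subst nn_integral_add) (auto simp: shift)
  also have "\<dots> = (\<integral>\<^sup>+ x. f x * indicator {s..<2*pi} x + f x * indicator {0..<s} x \<partial>lborel)"
    by (subst nn_integral_add) auto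
  also have "\<dots> = (\<integral>\<^sup>+ x. f x * indicator {0..<2*pi} x \<partial>lborel)"
    using s by (intro nn_integral_cong) (auto split: split_indicator)
  finally show ?thesis unfolding closed .
qed

lemma cis_minus_two_Im_Ln:
  assumes "w \<noteq> 0"
  shows "cis (- 2 * Im (Ln w)) = cnj w / w"
proof -
  have "cis (Im (Ln w)) = w / of_real (cmod w)"
    using assms by (simp add: Arg_eq_Im_Ln[symmetric] cis_Arg sgn_eq)
  then have "cis (- Im (Ln w)) = cnj w / of_real (cmod w)"
    by (metis cis_cnj complex_cnj_complex_of_real complex_cnj_divide)
  then have "cis (- Im (Ln w) + - Im (Ln w)) = (cnj w * cnj w) / (of_real (cmod w))\<^sup>2"
    unfolding cis_mult[symmetric] by (simp add: power2_eq_square)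
  also have "\<dots> = (cnj w * cnj w) / (w * cnj w)"
    using complex_norm_square[of w] by simp
  finally show ?thesis using assms by simp
qed

text \<open>On the circle b - cnj k = b cnj (1 - k b), so m(b) = u b cnj (1 - k b) / (1 - k b), and
  the phase of the quotient is -2 Im (Ln (1 - k b)), smooth because Re (1 - k b) > 0. This gives a
  lift \<psi> of m to the real line that advances by 2 pi over a period and has derivative J, to
  which the substitution rule applies.\<close>

lemma distr_disk_automorphism_bmeasure:
  fixes k u :: complex
  assumes k: "cmod k < 1" and u: "cmod u = 1"
  defines "J \<equiv> \<lambda>b. (1 - (cmod k)\<^sup>2) / (cmod (1 - k * b))\<^sup>2"
    and "m \<equiv> \<lambda>b. u * (b - cnj k) / (1 - k * b)"
  shows "distr (density bmeasure (\<lambda>b. ennreal (J b))) borel m = bmeasure"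
proof -
  have [measurable]: "J \<in> borel_measurable borel" "m \<in> borel_measurable borel"
    unfolding J_def m_def by measurable
  \<comment> \<open>The angle of m(1) in [0, 2 pi), the range in which the image interval can be
    shifted back by periodicity. The constants in \<psi> are chosen to make \<psi> 0 equal to
    \<open>s0\<close>.\<close>
  define s0 where "s0 = Arg2pi (u * (1 - cnj k) / (1 - k))"
  define \<psi> where "\<psi> x = x + (s0 + 2 * Im (Ln (1 - k))) - 2 * Im (Ln (1 - k * cis x))" for x
  define \<psi>' where "\<psi>' x = J (cis x)" for x
  have pos: "Re (1 - k * cis x) > 0" for x
  proof -
    have "Re (k * cis x) \<le> cmod (k * cis x)" by (rule complex_Re_le_cmod)
    then show ?thesis using k by (simp add: norm_mult)
  qed
  then have nz: "1 - k * cis x \<noteq> 0" for x by (metis less_irrefl zero_complex.sel(1))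
  have nz1: "1 - k \<noteq> 0" using k by auto
  have s0: "0 \<le> s0" "s0 < 2 * pi" unfolding s0_def by (auto simp: Arg2pi)
  have "cmod (u * (1 - cnj k) / (1 - k)) = 1"
  proof -
    have "cmod (1 - cnj k) = cmod (1 - k)" by (metis complex_cnj_diff complex_cnj_one complex_mod_cnj)
    then show ?thesis using u nz1 by (simp add: norm_mult norm_divide)
  qed
  then have cs0: "cis s0 = u * (1 - cnj k) / (1 - k)"
    unfolding s0_def using Arg2pi_eq[of "u * (1 - cnj k) / (1 - k)"] by (simp add: cis_conv_exp)
  have cis\<psi>: "cis (\<psi> x) = m (cis x)" for x
  proof -
    have "cis (\<psi> x) = cis x * (cis s0 / cis (- 2 * Im (Ln (1 - k)))) * cis (- 2 * Im (Ln (1 - k * cis x)))"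
      unfolding \<psi>_def by (simp add: cis_mult cis_divide algebra_simps)
    also have "\<dots> = cis x * u * (cnj (1 - k * cis x) / (1 - k * cis x))"
      unfolding cis_minus_two_Im_Ln[OF nz] cis_minus_two_Im_Ln[OF nz1] cs0
      using nz1 by (simp add: divide_simps)
    also have "\<dots> = u * (cis x * cnj (1 - k * cis x)) / (1 - k * cis x)" by simp
    also have "cis x * cnj (1 - k * cis x) = cis x - cnj k"
      using cis_mult[of x "-x"] by (simp add: algebra_simps cis_cnj)
    finally show ?thesis by (simp add: m_def)
  qed
  have deriv: "(\<psi> has_real_derivative \<psi>' x) (at x)" for x
  proof -
    \<comment> \<open>The derivative is 1 + 2 Re (q / (1 - q)), one of the classical forms of the
      Poisson kernel.\<close>
    define q where "q = k * cis x"
    have "((\<lambda>z. Ln (1 - k * exp (\<i> * z))) has_field_derivative (- (k * (\<i> * exp (\<i> * of_real x))) / (1 - k * exp (\<i> * of_real x))))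
       (at (of_real x))"
      using pos[of x] by (auto intro!: derivative_eq_intros simp: cis_conv_exp complex_nonpos_Reals_iff divide_inverse)
    then have "((\<lambda>x. Ln (1 - k * exp (\<i> * of_real x))) has_vector_derivative (- (k * (\<i> * exp (\<i> * of_real x))) / (1 - k * exp (\<i> * of_real x)))) (at x)"
      by (rule has_vector_derivative_real_field)
    then have "((\<lambda>x. Ln (1 - k * cis x)) has_vector_derivative (- (\<i> * q) / (1 - q))) (at x)"
      by (simp add: cis_conv_exp q_def mult_ac)
    then have "((\<lambda>x. Im (Ln (1 - k * cis x))) has_vector_derivative Im (- (\<i> * q) / (1 - q))) (at x)"
      by (rule bounded_linear.has_vector_derivative[OF bounded_linear_Im])
    then have "((\<lambda>x. Im (Ln (1 - k * cis x))) has_real_derivative Im (- (\<i> * q) / (1 - q))) (at x)"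
      by (simp add: has_real_derivative_iff_has_vector_derivative)
    from DERIV_diff[OF DERIV_add[OF DERIV_ident DERIV_const] DERIV_cmult[OF this, of 2]]
    have d: "(\<psi> has_real_derivative (1 - 2 * Im (- (\<i> * q) / (1 - q)))) (at x)"
      unfolding \<psi>_def[abs_def] by (simp only: add_0_right)
    have "Im (- (\<i> * q) / (1 - q)) = - Re (q / (1 - q))"
      by (metis Im_i_times minus_divide_left times_divide_eq_right uminus_complex.sel(2))
    also have "q / (1 - q) = (q - of_real ((cmod q)\<^sup>2)) / of_real ((cmod (1 - q))\<^sup>2)"
    proof -
      have "q / (1 - q) = q * cnj (1 - q) / of_real ((cmod (1 - q))\<^sup>2)"
        by (metis complex_div_cnj)
      then show ?thesis unfolding complex_norm_square by (simp add: algebra_simps)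
    qed
    finally have "1 - 2 * Im (- (\<i> * q) / (1 - q)) = 1 + 2 * ((Re q - (cmod q)\<^sup>2) / (cmod (1 - q))\<^sup>2)"
      by (simp only: Re_divide_of_real) simp
    also have "\<dots> = ((cmod (1 - q))\<^sup>2 + 2 * (Re q - (cmod q)\<^sup>2)) / (cmod (1 - q))\<^sup>2"
      using nz[of x] by (simp add: q_def field_simps)
    also have "(cmod (1 - q))\<^sup>2 + 2 * (Re q - (cmod q)\<^sup>2) = 1 - (cmod q)\<^sup>2"
      unfolding cmod_power2 by (simp add: power2_eq_square algebra_simps)
    finally show ?thesis using d by (simp add: \<psi>'_def J_def q_def norm_mult)
  qed
  have J0: "J b \<ge> 0" for b using k by (simp add: J_def power_le_one)
  have \<psi>0: "\<psi> 0 = s0" and \<psi>1: "\<psi> (2 * pi) = s0 + 2 * pi" by (simp_all add: \<psi>_def)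
  have cont: "continuous_on {0..2*pi} \<psi>'"
    unfolding \<psi>'_def J_def using nz by (auto intro!: continuous_intros)
  have key: "emeasure (distr (density bmeasure (\<lambda>b. ennreal (J b))) borel m) A = emeasure bmeasure A"
    if A[measurable]: "A \<in> sets borel" for A
  proof -
    have [measurable]: "m -` A \<in> sets borel" by (rule measurable_sets_borel[of _ borel]) auto
    have "emeasure (distr (density bmeasure (\<lambda>b. ennreal (J b))) borel m) A
       = (\<integral>\<^sup>+ b. ennreal (J b) * indicator A (m b) \<partial>bmeasure)"
      by (simp add: emeasure_distr emeasure_density) (auto intro!: nn_integral_cong split: split_indicator)
    also have "\<dots> = (\<integral>\<^sup>+ x. ennreal (J (cis x)) * indicator A (m (cis x)) * indicator {0..2*pi} x \<partial>lborel) / ennreal (2 * pi)"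
      by (rule nn_integral_bmeasure) simp
    also have "(\<integral>\<^sup>+ x. ennreal (J (cis x)) * indicator A (m (cis x)) * indicator {0..2*pi} x \<partial>lborel)
      = (\<integral>\<^sup>+ x. ennreal (indicator A (cis (\<psi> x)) * \<psi>' x * indicator {0..2*pi} x) \<partial>lborel)"
      by (intro nn_integral_cong) (auto simp: cis\<psi> \<psi>'_def split: split_indicator)
    also have "\<dots> = (\<integral>\<^sup>+ x. ennreal (indicator A (cis x) * indicator {\<psi> 0..\<psi> (2*pi)} x) \<partial>lborel)"
      using deriv cont J0
      by (intro nn_integral_substitution[symmetric]) (auto simp: set_borel_measurable_def \<psi>'_def)
    also have "\<dots> = (\<integral>\<^sup>+ x. indicator A (cis x) * indicator {s0..s0 + 2*pi} x \<partial>lborel)"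
      unfolding \<psi>0 \<psi>1 by (intro nn_integral_cong) (auto split: split_indicator)
    also have "\<dots> = (\<integral>\<^sup>+ x. indicator A (cis x) * indicator {0..2*pi} x \<partial>lborel)"
      by (rule nn_integral_periodic_interval) (use s0 in \<open>auto simp flip: cis_mult\<close>)
    also have "\<dots> / ennreal (2 * pi) = (\<integral>\<^sup>+ b. indicator A b \<partial>bmeasure)"
      by (rule nn_integral_bmeasure[symmetric]) simp
    finally show ?thesis by simp
  qed
  show ?thesis by (rule measure_eqI) (use key in auto)
qed

lemma distr_rotation_bmeasure:
  assumes u: "cmod u = 1"
  shows "distr bmeasure borel (\<lambda>b. u * b) = bmeasure"
  using distr_disk_automorphism_bmeasure[of 0 u] u by (simp add: density_1)

lemma integral_bmeasure_rotation:
  fixes F :: "complex \<Rightarrow> 'a :: {banach, second_countable_topology}"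
  assumes [measurable]: "F \<in> borel_measurable borel" and "cmod u = 1"
  shows "(LINT b|bmeasure. F (u * b)) = (LINT b|bmeasure. F b)"
proof -
  have "(LINT b|bmeasure. F b) = (LINT b|distr bmeasure borel (\<lambda>b. u * b). F b)"
    using assms distr_rotation_bmeasure by simp
  also have "\<dots> = (LINT b|bmeasure. F (u * b))" by (subst integral_distr) auto
  finally show ?thesis ..
qed

lemma power_int_borel_measurable [measurable]:
  "(\<lambda>b::complex. b powi n) \<in> borel_measurable borel"
  unfolding power_int_def by (cases "n \<ge> 0") simp_all

text \<open>Rotation by cis (pi / n) preserves the integral but multiplies the integrand by
  -1.\<close>

lemma integral_bmeasure_power_int:
  "(LINT b|bmeasure. b powi n) = (if n = 0 then 1 else 0)"
proof (cases "n = 0")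
  case False
  define u where "u = cis (pi / real_of_int n)"
  have "u powi n = cis (of_int n * (pi / real_of_int n))" by (simp add: u_def cis_power_int)
  then have un: "u powi n = - 1" using False by simp
  have "(LINT b|bmeasure. b powi n) = (LINT b|bmeasure. (u * b) powi n)"
    by (subst integral_bmeasure_rotation) (auto simp: u_def)
  also have "\<dots> = u powi n * (LINT b|bmeasure. b powi n)" by (simp add: power_int_mult_distrib)
  finally show ?thesis using False un by simp
qed (use bmeasure.prob_space in simp)

section \<open>Conical functions\<close>

lemma cnj_measurable [measurable]: "cnj \<in> borel_measurable borel"
  by (intro borel_measurable_continuous_onI continuous_intros)

lemma unit_mult_cnj:
  assumes "cmod b = 1"
  shows "b * cnj b = 1"
  using complex_norm_square[of b] assms by simp

text \<open>The Taylor coefficients of (1 - z) powr (-\<alpha>); in this normalization no signs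
  appear.\<close>

definition binom_coeff :: "complex \<Rightarrow> nat \<Rightarrow> complex" where
  "binom_coeff \<alpha> k = pochhammer \<alpha> k / fact k"

lemma binom_coeff_sums:
  assumes "cmod z < 1"
  shows "(\<lambda>k. binom_coeff \<alpha> k * z ^ k) sums (1 - z) powr (- \<alpha>)"
proof -
  have "((- \<alpha>) gchoose k) * (- z) ^ k = binom_coeff \<alpha> k * z ^ k" for k
    by (simp add: gbinomial_pochhammer binom_coeff_def power_minus[of z] flip: power_add)
  then show ?thesis using gen_binomial_complex[of "- z" "- \<alpha>"] assms by simp
qed

lemma summable_binom_coeff:
  assumes "0 \<le> q" "q < 1"
  shows "summable (\<lambda>k. cmod (binom_coeff \<alpha> k) * q ^ k)"
proof -
  \<comment> \<open>Convergence at the midpoint (1 + q) / 2, which is beyond q and still below 1,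
    gives absolute convergence at q.\<close>
  have "summable (\<lambda>k. binom_coeff \<alpha> k * complex_of_real ((1 + q) / 2) ^ k)"
    using assms by (intro sums_summable[OF binom_coeff_sums]) (simp del: of_real_divide of_real_add)
  then have "summable (\<lambda>k. norm (binom_coeff \<alpha> k * complex_of_real q ^ k))"
    by (rule powser_insidea) (use assms in \<open>simp del: of_real_divide of_real_add\<close>)
  then show ?thesis using assms by (simp add: norm_mult norm_power)
qed

text \<open>Termwise integration: on the circle the terms are dominated by M |c k|. It is used to
  expand first one and then the other of the two binomial factors.\<close>

lemma sums_integral_bmeasure:
  fixes G :: "complex \<Rightarrow> complex" and e :: "nat \<Rightarrow> complex \<Rightarrow> complex"
  assumes [measurable]: "G \<in> borel_measurable borel" "\<And>k. e k \<in> borel_measurable borel"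
    and G: "\<And>b. cmod b = 1 \<Longrightarrow> cmod (G b) \<le> M"
    and e: "\<And>b k. cmod b = 1 \<Longrightarrow> cmod (e k b) \<le> 1"
    and c: "summable (\<lambda>k. cmod (c k))"
  shows "(\<lambda>k. c k * (LINT b|bmeasure. G b * e k b)) sums (LINT b|bmeasure. G b * (\<Sum>k. c k * e k b))"
proof -
  define h where "h k b = c k * (G b * e k b)" for k b
  have [measurable]: "h k \<in> borel_measurable bmeasure" for k unfolding h_def by measurable
  have M: "M \<ge> 0" using order_trans[OF norm_ge_zero G[of 1]] by simp
  have bound: "cmod (h k b) \<le> cmod (c k) * M" if "cmod b = 1" for k b
  proof -
    have "cmod (G b) * cmod (e k b) \<le> M * 1"
      by (rule mult_mono) (use G[OF that] e[OF that, of k] M in auto)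
    then show ?thesis unfolding h_def norm_mult by (intro mult_left_mono) auto
  qed
  have AE_bound: "AE b in bmeasure. cmod (h k b) \<le> cmod (c k) * M" for k
    using AE_bmeasure by eventually_elim (rule bound)
  have int: "integrable bmeasure (h k)" for k
    by (rule bmeasure.integrable_const_bound[OF AE_bound]) simp
  have "(\<lambda>k. LINT b|bmeasure. h k b) sums (LINT b|bmeasure. (\<Sum>k. h k b))"
  proof (rule sums_integral[OF int])
    show "AE b in bmeasure. summable (\<lambda>k. cmod (h k b))"
      using AE_bmeasure
    proof eventually_elim
      case (elim b)
      show ?case by (rule summable_comparison_test'[OF summable_mult2[OF c, of M], of 0])
        (use bound[OF elim] in simp)
    qed
    have "(LINT b|bmeasure. cmod (h k b)) \<le> (LINT b|bmeasure. cmod (c k) * M)" for k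
      by (rule integral_mono_AE[OF _ _ AE_bound]) (use int in auto)
    then have "(LINT b|bmeasure. cmod (h k b)) \<le> cmod (c k) * M" for k
      using bmeasure.prob_space by simp
    then show "summable (\<lambda>k. LINT b|bmeasure. cmod (h k b))"
      by (intro summable_comparison_test'[OF summable_mult2[OF c, of M], of 0]) simp
  qed
  moreover have "(LINT b|bmeasure. (\<Sum>k. h k b)) = (LINT b|bmeasure. G b * (\<Sum>k. c k * e k b))"
  proof (rule integral_cong_AE)
    show "AE b in bmeasure. (\<Sum>k. h k b) = G b * (\<Sum>k. c k * e k b)"
      using AE_bmeasure
    proof eventually_elim
      case (elim b)
      have "summable (\<lambda>k. cmod (c k * e k b))"
        by (rule summable_comparison_test'[OF c, of 0])
          (use e[OF elim] in \<open>simp add: norm_mult mult_left_le\<close>)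
      then have "summable (\<lambda>k. c k * e k b)" by (rule summable_norm_cancel)
      then show ?case unfolding h_def by (subst suminf_mult[symmetric]) (auto simp: mult_ac)
    qed
  qed measurable
  ultimately show ?thesis by (simp add: h_def)
qed

lemma integral_bmeasure_power_cnj:
  "(LINT b|bmeasure. b ^ j * cnj b ^ k) = (if j = k then 1 else 0)"
proof -
  have "(LINT b|bmeasure. b ^ j * cnj b ^ k) = (LINT b|bmeasure. b powi (int j - int k))"
  proof (rule integral_cong_AE)
    show "AE b in bmeasure. b ^ j * cnj b ^ k = b powi (int j - int k)"
      using AE_bmeasure
    proof eventually_elim
      case (elim b)
      then have "cnj b = inverse b" "b \<noteq> 0"
        using inverse_unique[OF unit_mult_cnj[OF elim]] by auto
      then show ?case by (simp add: power_int_diff power_inverse divide_inverse)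
    qed
  qed simp_all
  then show ?thesis by (simp add: integral_bmeasure_power_int)
qed

context
  fixes q :: real
  assumes q: "0 \<le> q" "q < 1"
begin

lemma norm_binomial_le:
  assumes b: "cmod b = 1"
  shows "cmod ((1 - of_real q * b) powr (- \<alpha>)) \<le> (\<Sum>k. cmod (binom_coeff \<alpha> k) * q ^ k)"
proof -
  have "cmod (of_real q * b) < 1" using b q by (simp add: norm_mult)
  from binom_coeff_sums[OF this] have "(1 - of_real q * b) powr (- \<alpha>) = (\<Sum>k. binom_coeff \<alpha> k * (of_real q * b) ^ k)"
    by (rule sums_unique)
  also have "cmod \<dots> \<le> (\<Sum>k. cmod (binom_coeff \<alpha> k * (of_real q * b) ^ k))"
    using summable_binom_coeff[OF q] b q by (intro summable_norm) (simp add: norm_mult norm_power)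
  finally show ?thesis using b q by (simp add: norm_mult norm_power)
qed

lemma binomial_eq_suminf:
  assumes b: "cmod b = 1"
  shows "(1 - of_real q * b) powr (- \<alpha>) = (\<Sum>k. binom_coeff \<alpha> k * of_real q ^ k * b ^ k)"
proof -
  have "cmod (of_real q * b) < 1" using b q by (simp add: norm_mult)
  from sums_unique[OF binom_coeff_sums[OF this, of \<alpha>]] show ?thesis
    by (simp add: power_mult_distrib mult.assoc)
qed

lemma integral_binomial_power:
  "(LINT b|bmeasure. (1 - of_real q * b) powr (- \<alpha>) * cnj b ^ m) = binom_coeff \<alpha> m * of_real q ^ m"
proof -
  have "(\<lambda>k. binom_coeff \<alpha> k * of_real q ^ k * (LINT b|bmeasure. cnj b ^ m * b ^ k))
      sums (LINT b|bmeasure. cnj b ^ m * (\<Sum>k. binom_coeff \<alpha> k * of_real q ^ k * b ^ k))"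
    by (rule sums_integral_bmeasure[where M=1]) (auto simp: norm_power norm_mult summable_binom_coeff q)
  also have "(\<lambda>k. binom_coeff \<alpha> k * of_real q ^ k * (LINT b|bmeasure. cnj b ^ m * b ^ k))
     = (\<lambda>k. if k = m then binom_coeff \<alpha> m * of_real q ^ m else 0)"
    using integral_bmeasure_power_cnj by (auto simp: fun_eq_iff mult.commute)
  finally have "(LINT b|bmeasure. cnj b ^ m * (\<Sum>k. binom_coeff \<alpha> k * of_real q ^ k * b ^ k))
      = binom_coeff \<alpha> m * of_real q ^ m"
    by (rule sums_unique2[OF _ sums_single])
  moreover have "(LINT b|bmeasure. cnj b ^ m * (\<Sum>k. binom_coeff \<alpha> k * of_real q ^ k * b ^ k))
     = (LINT b|bmeasure. (1 - of_real q * b) powr (- \<alpha>) * cnj b ^ m)"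
  proof (rule integral_cong_AE)
    show "AE b in bmeasure. cnj b ^ m * (\<Sum>k. binom_coeff \<alpha> k * of_real q ^ k * b ^ k)
      = (1 - of_real q * b) powr (- \<alpha>) * cnj b ^ m"
      using AE_bmeasure by eventually_elim (simp add: binomial_eq_suminf)
  qed measurable
  ultimately show ?thesis by simp
qed

text \<open>The m-th Fourier coefficient of the product of the two factors. The case m = 0 gives the
  circle mean behind the conical functions, the case m = 1 the coefficients that move between
  neighbouring modes in the proof of irreducibility.\<close>

lemma integral_binomial_binomial:
  "(\<lambda>k. binom_coeff \<beta> k * binom_coeff \<alpha> (k + m) * of_real q ^ (2 * k + m))
     sums (LINT b|bmeasure. (1 - of_real q * b) powr (- \<alpha>) * (1 - of_real q * cnj b) powr (- \<beta>) * cnj b ^ m)"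
proof -
  let ?G = "\<lambda>b. (1 - of_real q * b) powr (- \<alpha>) * cnj b ^ m"
  have "(\<lambda>k. binom_coeff \<beta> k * of_real q ^ k * (LINT b|bmeasure. ?G b * cnj b ^ k))
      sums (LINT b|bmeasure. ?G b * (\<Sum>k. binom_coeff \<beta> k * of_real q ^ k * cnj b ^ k))"
    by (rule sums_integral_bmeasure[where M="\<Sum>k. cmod (binom_coeff \<alpha> k) * q ^ k"])
      (auto simp: norm_mult norm_power norm_binomial_le summable_binom_coeff q)
  also have "(\<lambda>k. binom_coeff \<beta> k * of_real q ^ k * (LINT b|bmeasure. ?G b * cnj b ^ k))
     = (\<lambda>k. binom_coeff \<beta> k * binom_coeff \<alpha> (k + m) * of_real q ^ (2 * k + m))"
  proof (rule ext)
    fix k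
    have "(LINT b|bmeasure. ?G b * cnj b ^ k) = binom_coeff \<alpha> (k + m) * of_real q ^ (k + m)"
      using integral_binomial_power[of \<alpha> "k + m"] by (simp add: mult.assoc power_add mult.commute[of "cnj _ ^ k"])
    then show "binom_coeff \<beta> k * of_real q ^ k * (LINT b|bmeasure. ?G b * cnj b ^ k)
      = binom_coeff \<beta> k * binom_coeff \<alpha> (k + m) * of_real q ^ (2 * k + m)"
      by (simp add: mult_2 power_add)
  qed
  also have "(LINT b|bmeasure. ?G b * (\<Sum>k. binom_coeff \<beta> k * of_real q ^ k * cnj b ^ k))
     = (LINT b|bmeasure. (1 - of_real q * b) powr (- \<alpha>) * (1 - of_real q * cnj b) powr (- \<beta>) * cnj b ^ m)"
  proof (rule integral_cong_AE)
    show "AE b in bmeasure. ?G b * (\<Sum>k. binom_coeff \<beta> k * of_real q ^ k * cnj b ^ k)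
      = (1 - of_real q * b) powr (- \<alpha>) * (1 - of_real q * cnj b) powr (- \<beta>) * cnj b ^ m"
      using AE_bmeasure
    proof eventually_elim
      case (elim b)
      then show ?case using binomial_eq_suminf[of "cnj b" \<beta>] by simp
    qed
  qed measurable
  finally show ?thesis .
qed

end

section \<open>Pfaff's transformation\<close>

lemma fps_binom_coeff_mult:
  "Abs_fps (binom_coeff \<alpha>) * Abs_fps (binom_coeff \<beta>) = Abs_fps (binom_coeff (\<alpha> + \<beta>))"
proof (rule fps_ext)
  fix n
  have "binom_coeff (\<alpha> + \<beta>) n = (\<Sum>k\<le>n. of_nat (n choose k) * pochhammer \<alpha> k * pochhammer \<beta> (n - k) / fact n)"
    unfolding binom_coeff_def pochhammer_binomial_sum sum_divide_distrib ..
  also have "\<dots> = (\<Sum>k\<le>n. binom_coeff \<alpha> k * binom_coeff \<beta> (n - k))"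
    by (intro sum.cong refl) (simp add: binom_coeff_def binomial_fact)
  finally show "fps_nth (Abs_fps (binom_coeff \<alpha>) * Abs_fps (binom_coeff \<beta>)) n
      = fps_nth (Abs_fps (binom_coeff (\<alpha> + \<beta>))) n"
    by (simp add: fps_mult_nth atMost_atLeast0)
qed

lemma fps_binom_coeff_power: "Abs_fps (binom_coeff 1) ^ n = Abs_fps (binom_coeff (of_nat n))"
proof (induction n)
  case 0
  have "binom_coeff 0 k = (if k = 0 then 1 else 0)" for k
    by (simp add: binom_coeff_def pochhammer_0_left)
  then show ?case by (simp add: fps_eq_iff)
qed (simp add: fps_binom_coeff_mult add.commute)

lemma has_fps_expansion_binom_coeff:
  "(\<lambda>z. (1 - z) powr (- \<alpha>)) has_fps_expansion Abs_fps (binom_coeff \<alpha>)"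
proof (rule has_fps_expansionI)
  have "eventually (\<lambda>z::complex. z \<in> ball 0 1) (nhds 0)" by (intro eventually_nhds_in_open) auto
  then show "\<forall>\<^sub>F u in nhds 0. (\<lambda>n. fps_nth (Abs_fps (binom_coeff \<alpha>)) n * u ^ n) sums (1 - u) powr (- \<alpha>)"
    by eventually_elim (simp add: binom_coeff_sums)
qed

text \<open>The hypergeometric series F(s, s; 1; x).\<close>

definition pfaff_fps :: "complex \<Rightarrow> complex fps" where
  "pfaff_fps s = Abs_fps (\<lambda>k. (binom_coeff s k)\<^sup>2)"

text \<open>At x = q * q with q < 1 this is the series already shown to sum to a circle mean, so
  convergence comes from the integral formula instead of a ratio test.\<close>

lemma pfaff_fps_conv_radius: "fps_conv_radius (pfaff_fps s) \<ge> 1"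
  unfolding fps_conv_radius_def
proof (rule dense_le)
  fix y :: ereal assume y: "y < 1"
  show "y \<le> conv_radius (fps_nth (pfaff_fps s))"
  proof (cases "y \<le> 0")
    case True
    then show ?thesis using conv_radius_nonneg order_trans by blast
  next
    case False
    then obtain x where x: "y = ereal x" "0 < x" "x < 1" using y by (cases y) auto
    define q where "q = sqrt x"
    have q: "0 \<le> q" "q < 1" "q ^ 2 = x" using x by (auto simp: q_def)
    have "summable (\<lambda>k. fps_nth (pfaff_fps s) k * of_real x ^ k)"
      using sums_summable[OF integral_binomial_binomial[OF q(1,2), of s s 0]] q(3)
      by (simp add: pfaff_fps_def power_mult power2_eq_square[of "binom_coeff _ _"] flip: of_real_power)
    then have "ereal (norm (complex_of_real x)) \<le> conv_radius (fps_nth (pfaff_fps s))"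
      by (rule conv_radius_geI)
    then show ?thesis using x by simp
  qed
qed

text \<open>Since W has no constant term, its j-th power starts in degree j. The inner sums can
  therefore all be extended to j \<le> N, which makes the order of summation
  interchangeable.\<close>

lemma fps_compose_mult_nth:
  fixes G W B :: "complex fps"
  assumes "fps_nth W 0 = 0"
  shows "fps_nth ((G oo W) * B) N = (\<Sum>j\<le>N. fps_nth G j * fps_nth (W ^ j * B) N)"
proof -
  have "fps_nth ((G oo W) * B) N = (\<Sum>i\<le>N. (\<Sum>j\<le>N. fps_nth G j * fps_nth (W ^ j) i) * fps_nth B (N - i))"
    unfolding fps_mult_nth atMost_atLeast0
  proof (intro sum.cong refl arg_cong2[of _ _ _ _ "(*)"])
    fix i assume "i \<in> {0..N}"
    then show "fps_nth (G oo W) i = (\<Sum>j\<in>{0..N}. fps_nth G j * fps_nth (W ^ j) i)"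
      unfolding fps_compose_nth using startsby_zero_power_prefix[OF assms]
      by (intro sum.mono_neutral_left) auto
  qed
  also have "\<dots> = (\<Sum>j\<le>N. \<Sum>i\<le>N. fps_nth G j * fps_nth (W ^ j) i * fps_nth B (N - i))"
    unfolding sum_distrib_right by (rule sum.swap)
  finally show ?thesis
    by (simp add: fps_mult_nth sum_distrib_left mult.assoc atMost_atLeast0)
qed

text \<open>The inner series is W = x / (x - 1), so the j-th power of W times (1 - x) powr (-s) is,
  up to sign, the j-th power of x times (1 - x) powr (-(s + j)). Because (s)_j (s + j)_(N - j) =
  (s)_N, the coefficient of degree N is a Vandermonde sum, and (N - s) choose N = (1 - s)_N /
  N!.\<close>

lemma pfaff_fps_transform:
  "(pfaff_fps s oo (- fps_X * Abs_fps (binom_coeff 1))) * Abs_fps (binom_coeff s) = fps_hypergeo [s, 1 - s] [1] 1"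
proof (rule fps_ext)
  fix N
  define W where "W = - fps_X * Abs_fps (binom_coeff 1)"
  have W: "W ^ j * Abs_fps (binom_coeff s) = (-1) ^ j * (fps_X ^ j * Abs_fps (binom_coeff (of_nat j + s)))" for j
  proof -
    have "W = (- 1) * (fps_X * Abs_fps (binom_coeff 1))" by (simp add: W_def)
    then show ?thesis
      by (simp only: power_mult_distrib fps_binom_coeff_power mult.assoc fps_binom_coeff_mult)
  qed
  have W0: "fps_nth W 0 = 0" by (simp add: W_def)
  have sgn: "fps_nth ((-1) ^ j * F) n = (-1) ^ j * fps_nth F n" for j n and F :: "complex fps"
    by (cases "even j") auto
  have "fps_nth ((pfaff_fps s oo W) * Abs_fps (binom_coeff s)) N
    = (\<Sum>j\<le>N. (binom_coeff s j)\<^sup>2 * ((-1) ^ j * binom_coeff (s + of_nat j) (N - j)))"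
    unfolding fps_compose_mult_nth[OF W0] W sgn
    by (intro sum.cong refl) (auto simp: pfaff_fps_def fps_X_power_mult_nth add.commute)
  also have "\<dots> = (\<Sum>j\<le>N. binom_coeff s N * (((- s) gchoose j) * (of_nat N gchoose (N - j))))"
  proof (intro sum.cong refl)
    fix j assume "j \<in> {..N}"
    then have j: "j \<le> N" by simp
    have "binom_coeff s j * binom_coeff (s + of_nat j) (N - j) = binom_coeff s N * (of_nat N gchoose (N - j))"
      unfolding binom_coeff_def using pochhammer_product[OF j, of s] j
      by (simp add: binomial_gbinomial[symmetric] binomial_symmetric[OF j, symmetric] binomial_fact)
    moreover have "((- s) gchoose j) = (-1) ^ j * binom_coeff s j"
      by (simp add: gbinomial_pochhammer binom_coeff_def)
    moreover have "(binom_coeff s j)\<^sup>2 * ((-1) ^ j * binom_coeff (s + of_nat j) (N - j))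
       = ((-1) ^ j * binom_coeff s j) * (binom_coeff s j * binom_coeff (s + of_nat j) (N - j))"
      by (simp add: power2_eq_square)
    ultimately show "(binom_coeff s j)\<^sup>2 * ((-1) ^ j * binom_coeff (s + of_nat j) (N - j))
       = binom_coeff s N * (((- s) gchoose j) * (of_nat N gchoose (N - j)))"
      by (simp only: mult_ac)
  qed
  also have "\<dots> = binom_coeff s N * ((- s + of_nat N) gchoose N)"
    unfolding sum_distrib_left[symmetric] atMost_atLeast0 gbinomial_Vandermonde ..
  also have "\<dots> = pochhammer s N * pochhammer (1 - s) N / (fact N * fact N)"
    by (simp add: binom_coeff_def gbinomial_pochhammer')
  finally show "fps_nth ((pfaff_fps s oo (- fps_X * Abs_fps (binom_coeff 1))) * Abs_fps (binom_coeff s)) N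
      = fps_nth (fps_hypergeo [s, 1 - s] [1] 1) N"
    by (simp add: W_def pochhammer_fact[symmetric])
qed

text \<open>Re z < 1/2 means |z| < |z - 1|, hence |z / (z - 1)| < 1. The half-plane is convex and
  contains 0, so a holomorphic function on it with the right expansion at 0 is the principal
  branch.\<close>

lemma hyp2F1_pfaff:
  assumes z: "Re z < 1 / 2"
  shows "hyp2F1 s (1 - s) 1 z = (1 - z) powr (- s) * eval_fps (pfaff_fps s) (z / (z - 1))"
proof -
  define S where "S = {z::complex. Re z < 1 / 2}"
  have lt: "cmod (x / (x - 1)) < 1" if "x \<in> S" for x
  proof -
    have x1: "x \<noteq> 1" using that by (auto simp: S_def)
    have "(cmod x)\<^sup>2 < (cmod (x - 1))\<^sup>2"
      using that unfolding cmod_power2 S_def by (simp add: power2_eq_square algebra_simps)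
    then have "cmod x < cmod (x - 1)" by (metis norm_ge_zero power_mono not_le)
    then show ?thesis using x1 by (simp add: norm_divide)
  qed
  show ?thesis
  proof (rule hyp2F1_eqI[of S])
    show "open S" unfolding S_def by (rule open_halfspace_Re_lt)
    show "z \<in> S" using z by (simp add: S_def)
    have "convex S" unfolding S_def by (rule convex_halfspace_Re_lt)
    then show "closed_segment 0 x \<subseteq> S" if "x \<in> S" for x
      using that by (intro closed_segment_subset) (auto simp: S_def)
    have "(eval_fps (pfaff_fps s) \<circ> (\<lambda>z. z / (z - 1))) holomorphic_on S"
    proof (rule holomorphic_on_compose)
      show "(\<lambda>z. z / (z - 1)) holomorphic_on S"
        by (intro holomorphic_intros) (auto simp: S_def)
      show "eval_fps (pfaff_fps s) holomorphic_on (\<lambda>z. z / (z - 1)) ` S"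
        using lt pfaff_fps_conv_radius[of s]
        by (intro holomorphic_on_eval_fps) (force intro: order_less_le_trans[of _ "ereal 1"] simp: one_ereal_def)
    qed
    then show "(\<lambda>z. (1 - z) powr (- s) * eval_fps (pfaff_fps s) (z / (z - 1))) holomorphic_on S"
      unfolding comp_def
      by (intro holomorphic_intros) (auto simp: S_def complex_nonpos_Reals_iff)
    \<comment> \<open>The fraction z / (z - 1) in the form whose expansion at 0 is literally the
      inner series of the formal identity.\<close>
    have "(\<lambda>z. - z * (1 - z) powr (- 1)) has_fps_expansion (- fps_X * Abs_fps (binom_coeff 1))"
      by (intro fps_expansion_intros has_fps_expansion_binom_coeff)
    then have "(eval_fps (pfaff_fps s) \<circ> (\<lambda>z. - z * (1 - z) powr (- 1))) has_fps_expansion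
        (pfaff_fps s oo (- fps_X * Abs_fps (binom_coeff 1)))"
      using pfaff_fps_conv_radius[of s]
      by (intro has_fps_expansion_compose eval_fps_has_fps_expansion) (auto intro: order_less_le_trans[of _ "1 :: ereal"])
    from has_fps_expansion_mult[OF this has_fps_expansion_binom_coeff[of s]]
    have "(\<lambda>z. eval_fps (pfaff_fps s) (- z * (1 - z) powr (- 1)) * (1 - z) powr (- s))
        has_fps_expansion fps_hypergeo [s, 1 - s] [1] 1"
      unfolding pfaff_fps_transform comp_def .
    moreover have "- z * (1 - z) powr (- 1) = z / (z - 1)" for z :: complex
      by (cases "z = 1") (auto simp: powr_minus_divide divide_simps algebra_simps)
    ultimately show "(\<lambda>z. (1 - z) powr (- s) * eval_fps (pfaff_fps s) (z / (z - 1)))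
        has_fps_expansion fps_hypergeo [s, 1 - s] [1] 1"
      by (simp add: mult.commute)
  qed
qed

section \<open>Circle means of powers of the Poisson kernel\<close>

text \<open>In the right half-plane Ln (cnj w) = cnj (Ln w), so the logarithms of w and cnj w add up
  to 2 ln |w| without a multiple of 2 pi i.\<close>

lemma powr_cmod_square:
  assumes "Re w > 0"
  shows "complex_of_real ((cmod w)\<^sup>2) powr s = w powr s * cnj w powr s"
proof -
  have w: "w \<noteq> 0" "w \<notin> \<real>\<^sub>\<le>\<^sub>0" using assms by (auto simp: complex_nonpos_Reals_iff)
  have "Ln (complex_of_real ((cmod w)\<^sup>2)) = of_real (2 * ln (cmod w))"
    using w by (simp add: Ln_of_real ln_realpow del: of_real_power)
  also have "\<dots> = Ln w + Ln (cnj w)"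
    using w by (simp add: cnj_Ln[symmetric] complex_add_cnj)
  finally show ?thesis using w by (simp add: powr_def distrib_left exp_add)
qed

lemma poisson_rotate:
  assumes b: "cmod b = 1" and u: "cmod u = 1"
  shows "poisson (u * z) (u * b) = poisson z b"
proof -
  have "u * z - u * b = u * (z - b)" by (simp add: algebra_simps)
  then show ?thesis using assms by (simp add: poisson_eq norm_mult)
qed

text \<open>For |b| = 1, q - b = b (q cnj b - 1), whence |q - b| = |1 - q b|. The number 1 - q b has
  positive real part, so its squared modulus splits under powers.\<close>

lemma poisson_of_real_powr:
  assumes q: "0 \<le> q" "q < 1" and b: "cmod b = 1"
  shows "complex_of_real (poisson (of_real q) b) powr s = of_real (1 - q\<^sup>2) powr s *
      ((1 - of_real q * b) powr (- s) * (1 - of_real q * cnj b) powr (- s))"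
proof -
  define w where "w = 1 - of_real q * b"
  have "Re (of_real q * b) \<le> cmod (of_real q * b)" by (rule complex_Re_le_cmod)
  then have w: "Re w > 0" using q b by (simp add: w_def norm_mult)
  have "b * (of_real q * cnj b - 1) = of_real q * (b * cnj b) - b" by (simp add: algebra_simps)
  then have "cmod (of_real q - b) = cmod (b * (of_real q * cnj b - 1))"
    using unit_mult_cnj[OF b] by simp
  also have "\<dots> = cmod (cnj (of_real q * cnj b - 1))" using b by (simp add: norm_mult del: complex_cnj_diff)
  also have "\<dots> = cmod w" by (simp add: w_def norm_minus_commute)
  finally have "poisson (of_real q) b = (1 - q\<^sup>2) * inverse ((cmod w)\<^sup>2)"
    using q by (simp add: poisson_eq[OF b] divide_inverse)
  moreover have "1 - q\<^sup>2 > 0" using q by (simp add: power_less_one_iff)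
  moreover have "complex_of_real (inverse ((cmod w)\<^sup>2)) powr s = complex_of_real ((cmod w)\<^sup>2) powr (- s)"
    using w by (cases "w = 0") (auto simp: powr_def Ln_of_real ln_inverse simp del: of_real_power of_real_inverse)
  ultimately have "complex_of_real (poisson (of_real q) b) powr s = of_real (1 - q\<^sup>2) powr s * complex_of_real ((cmod w)\<^sup>2) powr (- s)"
    by (simp only: of_real_mult powr_times_real[of "complex_of_real (1 - q\<^sup>2)"] Reals_of_real Re_complex_of_real
        less_imp_le inverse_nonnegative_iff_nonnegative zero_le_power2)
  then show ?thesis unfolding powr_cmod_square[OF w] by (simp add: w_def)
qed

lemma poisson_measurable [measurable]: "poisson z \<in> borel_measurable borel"
proof -
  have "Arg \<in> borel_measurable borel"
  proof -
    have "Arg = (\<lambda>z. if z = 0 then 0 else Im (Ln z))" by (auto simp: fun_eq_iff Arg_eq_Im_Ln Arg_zero)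
    also have "\<dots> \<in> borel_measurable borel" by measurable
    finally show ?thesis .
  qed
  then have [measurable]: "(\<lambda>b. cos (Arg z - Arg b)) \<in> borel_measurable borel" by measurable
  show ?thesis unfolding poisson_def[abs_def] by measurable
qed

lemma poisson_powr_measurable [measurable]:
  "(\<lambda>b. complex_of_real (poisson z b) powr s) \<in> borel_measurable borel"
  by measurable

lemma integral_poisson_powr:
  assumes z: "z \<in> hdisk"
  shows "(LINT b|bmeasure. complex_of_real (poisson z b) powr s)
     = of_real (1 - (cmod z)\<^sup>2) powr s * eval_fps (pfaff_fps s) (of_real ((cmod z)\<^sup>2))"
proof -
  define q where "q = cmod z"
  have q: "0 \<le> q" "q < 1" using z by (auto simp: q_def)
  define u where "u = cis (Arg z)"
  have u: "cmod u = 1" "z = u * of_real q" by (auto simp: u_def q_def) (metis rcis_cmod_Arg rcis_def mult.commute)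
  have "(LINT b|bmeasure. complex_of_real (poisson z b) powr s)
      = (LINT b|bmeasure. complex_of_real (poisson z (u * b)) powr s)"
    by (rule integral_bmeasure_rotation[symmetric]) (use u in auto)
  also have "\<dots> = (LINT b|bmeasure. of_real (1 - q\<^sup>2) powr s *
      ((1 - of_real q * b) powr (- s) * (1 - of_real q * cnj b) powr (- s)))"
  proof (rule integral_cong_AE)
    show "AE b in bmeasure. complex_of_real (poisson z (u * b)) powr s = of_real (1 - q\<^sup>2) powr s *
      ((1 - of_real q * b) powr (- s) * (1 - of_real q * cnj b) powr (- s))"
      using AE_bmeasure
      by eventually_elim (simp only: u(2) poisson_rotate[OF _ u(1)] poisson_of_real_powr[OF q])
  qed measurable
  also have "\<dots> = of_real (1 - q\<^sup>2) powr s *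
     (LINT b|bmeasure. (1 - of_real q * b) powr (- s) * (1 - of_real q * cnj b) powr (- s))" by simp
  also have "(LINT b|bmeasure. (1 - of_real q * b) powr (- s) * (1 - of_real q * cnj b) powr (- s))
     = eval_fps (pfaff_fps s) (of_real (q\<^sup>2))"
    using sums_unique[OF integral_binomial_binomial[OF q, of s s 0]]
    by (simp add: eval_fps_def pfaff_fps_def power2_eq_square[of "binom_coeff _ _"] power_mult)
  finally show ?thesis by (simp add: q_def)
qed

text \<open>With t = cosh (r / 2) the argument of the hypergeometric function is x = 1 - t * t. Then
  x / (x - 1) is the square of tanh (r / 2), that is of |z|, and 1 - x is the inverse of 1 minus
  this square, so Pfaff's formula is the circle mean of P powr (1 - s).\<close>

lemma legendre_P_eq_integral:
  assumes r: "r \<ge> 0" and z: "cmod z = tanh (r / 2)"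
  shows "legendre_P (s - 1) (complex_of_real (cosh r)) = (LINT b|bmeasure. complex_of_real (poisson z b) powr (1 - s))"
proof -
  define t where "t = cosh (r / 2)"
  have t: "t > 0" by (simp add: t_def)
  have ch: "cosh r = 2 * t\<^sup>2 - 1" using cosh_double_cosh[of "r / 2"] by (simp add: t_def)
  have sh: "(sinh (r / 2))\<^sup>2 = t\<^sup>2 - 1" using cosh_square_eq[of "r / 2"] by (simp add: t_def)
  have zz: "(cmod z)\<^sup>2 = (t\<^sup>2 - 1) / t\<^sup>2"
    unfolding z tanh_def power_divide sh t_def ..
  have t1: "t\<^sup>2 \<ge> 1" using sh by (metis diff_ge_0_iff_ge zero_le_power2)
  have "(cmod z)\<^sup>2 < 1" unfolding zz using t by (simp add: field_simps)
  then have zd: "z \<in> hdisk" by (simp add: power_less_one_iff)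
  have w: "(1 - complex_of_real (cosh r)) / 2 = of_real (1 - t\<^sup>2)" by (simp add: ch)
  have "legendre_P (s - 1) (complex_of_real (cosh r)) = hyp2F1 (1 - s) (1 - (1 - s)) 1 (of_real (1 - t\<^sup>2))"
    unfolding legendre_P_def w by simp
  also have "\<dots> = (1 - of_real (1 - t\<^sup>2)) powr (- (1 - s)) * eval_fps (pfaff_fps (1 - s)) (of_real (1 - t\<^sup>2) / (of_real (1 - t\<^sup>2) - 1))"
    by (rule hyp2F1_pfaff) (use t1 in \<open>simp del: of_real_diff of_real_power\<close>)
  also have "of_real (1 - t\<^sup>2) / (of_real (1 - t\<^sup>2) - 1) = complex_of_real ((cmod z)\<^sup>2)"
    unfolding zz using t by (simp add: field_simps)
  also have "(1 - complex_of_real (1 - t\<^sup>2)) powr (- (1 - s)) = of_real (1 - (cmod z)\<^sup>2) powr (1 - s)"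
  proof -
    have "1 - complex_of_real (1 - t\<^sup>2) = of_real (t\<^sup>2)" by simp
    moreover have "1 - (cmod z)\<^sup>2 = inverse (t\<^sup>2)" unfolding zz using t by (simp add: field_simps)
    ultimately show ?thesis using t
      by (simp only:) (simp add: powr_def Ln_of_real ln_inverse left_diff_distrib right_diff_distrib del: of_real_power of_real_inverse of_real_diff)
  qed
  finally show ?thesis unfolding integral_poisson_powr[OF zd] .
qed

section \<open>Trigonometric polynomials are dense\<close>

definition normsq :: "(complex \<Rightarrow> complex) \<Rightarrow> real" where
  "normsq f = (LINT b|bmeasure. (cmod (f b))\<^sup>2)"

lemma L2_norm_eq: "L2_norm f = sqrt (normsq f)"
  by (simp add: L2_norm_def normsq_def)

lemma normsq_nonneg: "normsq f \<ge> 0"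
  unfolding normsq_def by (rule integral_nonneg_AE) simp

lemma L2B_measurable [measurable_dest]: "f \<in> L2B \<Longrightarrow> f \<in> borel_measurable borel"
  by (simp add: L2B_def)

lemma L2B_integrable: "f \<in> L2B \<Longrightarrow> integrable bmeasure (\<lambda>b. (cmod (f b))\<^sup>2)"
  by (simp add: L2B_def)

lemma L2B_bounded:
  assumes "f \<in> borel_measurable borel" "\<And>b. cmod b = 1 \<Longrightarrow> cmod (f b) \<le> M"
  shows "f \<in> L2B"
proof -
  have "AE b in bmeasure. norm ((cmod (f b))\<^sup>2) \<le> M\<^sup>2"
    using AE_bmeasure by eventually_elim (simp add: assms(2) power_mono)
  then have "integrable bmeasure (\<lambda>b. (cmod (f b))\<^sup>2)"
    using assms(1) by (intro bmeasure.integrable_const_bound) auto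
  then show ?thesis using assms(1) by (simp add: L2B_def)
qed

lemma continuous_imp_L2B:
  assumes "continuous_on UNIV f"
  shows "f \<in> L2B"
proof -
  have "compact (f ` sphere 0 1)"
    by (intro compact_continuous_image continuous_on_subset[OF assms]) auto
  then obtain M where "\<And>b. b \<in> sphere 0 1 \<Longrightarrow> cmod (f b) \<le> M"
    using compact_imp_bounded bounded_iff by (metis imageI)
  then show ?thesis using assms by (intro L2B_bounded[of _ M] borel_measurable_continuous_onI) auto
qed

lemma cmod_lincomb_square_le:
  "(cmod (\<alpha> * x + \<beta> * y))\<^sup>2 \<le> 2 * (cmod \<alpha>)\<^sup>2 * (cmod x)\<^sup>2 + 2 * (cmod \<beta>)\<^sup>2 * (cmod y)\<^sup>2"
proof -
  have "(cmod (\<alpha> * x + \<beta> * y))\<^sup>2 \<le> (cmod \<alpha> * cmod x + cmod \<beta> * cmod y)\<^sup>2"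
    by (intro power_mono order_trans[OF norm_triangle_ineq]) (auto simp: norm_mult)
  also have "\<dots> \<le> 2 * (cmod \<alpha> * cmod x)\<^sup>2 + 2 * (cmod \<beta> * cmod y)\<^sup>2"
    using zero_le_power2[of "cmod \<alpha> * cmod x - cmod \<beta> * cmod y"]
    unfolding power2_diff power2_sum by linarith
  finally show ?thesis by (simp add: power_mult_distrib)
qed

lemma L2B_lincomb:
  assumes f: "f \<in> L2B" and h: "h \<in> L2B"
  shows "(\<lambda>b. \<alpha> * f b + \<beta> * h b) \<in> L2B"
    and "normsq (\<lambda>b. \<alpha> * f b + \<beta> * h b) \<le> 2 * (cmod \<alpha>)\<^sup>2 * normsq f + 2 * (cmod \<beta>)\<^sup>2 * normsq h"
proof -
  note [measurable] = L2B_measurable[OF f] L2B_measurable[OF h]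
  let ?g = "\<lambda>b. 2 * (cmod \<alpha>)\<^sup>2 * (cmod (f b))\<^sup>2 + 2 * (cmod \<beta>)\<^sup>2 * (cmod (h b))\<^sup>2"
  have g: "integrable bmeasure ?g" using L2B_integrable[OF f] L2B_integrable[OF h] by simp
  have i: "integrable bmeasure (\<lambda>b. (cmod (\<alpha> * f b + \<beta> * h b))\<^sup>2)"
    by (rule Bochner_Integration.integrable_bound[OF g])
      (auto intro!: AE_I2 order_trans[OF cmod_lincomb_square_le])
  then show "(\<lambda>b. \<alpha> * f b + \<beta> * h b) \<in> L2B" by (simp add: L2B_def)
  have "normsq (\<lambda>b. \<alpha> * f b + \<beta> * h b) \<le> (LINT b|bmeasure. ?g b)"
    unfolding normsq_def by (rule integral_mono[OF i g]) (rule cmod_lincomb_square_le)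
  also have "\<dots> = 2 * (cmod \<alpha>)\<^sup>2 * normsq f + 2 * (cmod \<beta>)\<^sup>2 * normsq h"
    using L2B_integrable[OF f] L2B_integrable[OF h] by (simp add: normsq_def)
  finally show "normsq (\<lambda>b. \<alpha> * f b + \<beta> * h b) \<le> 2 * (cmod \<alpha>)\<^sup>2 * normsq f + 2 * (cmod \<beta>)\<^sup>2 * normsq h" .
qed

lemma L2B_diff: "f \<in> L2B \<Longrightarrow> h \<in> L2B \<Longrightarrow> (\<lambda>b. f b - h b) \<in> L2B"
  using L2B_lincomb(1)[of f h 1 "-1"] by simp

lemma L2B_cmult: "f \<in> L2B \<Longrightarrow> (\<lambda>b. \<alpha> * f b) \<in> L2B"
  using L2B_lincomb(1)[of f f \<alpha> 0] by simp

lemma normsq_cmult: "normsq (\<lambda>b. \<alpha> * f b) = (cmod \<alpha>)\<^sup>2 * normsq f"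
  by (simp add: normsq_def norm_mult power_mult_distrib)

lemma normsq_minus_commute: "normsq (\<lambda>b. f b - h b) = normsq (\<lambda>b. h b - f b)"
  by (simp add: normsq_def norm_minus_commute)

text \<open>A triangle inequality for squared norms, at the price of a factor 2; the fractions e /
  4, e / 8 and e / 16 in the estimates below absorb the accumulated factors.\<close>

lemma normsq_triangle:
  assumes "f \<in> L2B" "g \<in> L2B" "h \<in> L2B"
  shows "normsq (\<lambda>b. f b - h b) \<le> 2 * normsq (\<lambda>b. f b - g b) + 2 * normsq (\<lambda>b. g b - h b)"
  using L2B_lincomb(2)[OF L2B_diff[OF assms(1,2)] L2B_diff[OF assms(2,3)], of 1 1] by simp

lemma normsq_bounded:
  assumes [measurable]: "f \<in> borel_measurable borel" and b: "\<And>b. cmod b = 1 \<Longrightarrow> cmod (f b) \<le> M"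
  shows "normsq f \<le> M\<^sup>2"
proof -
  have "normsq f \<le> (LINT b|bmeasure. M\<^sup>2)"
    unfolding normsq_def
  proof (rule integral_mono_AE)
    show "integrable bmeasure (\<lambda>b. (cmod (f b))\<^sup>2)" by (rule L2B_integrable[OF L2B_bounded[OF assms]])
    show "AE b in bmeasure. (cmod (f b))\<^sup>2 \<le> M\<^sup>2"
      using AE_bmeasure by eventually_elim (simp add: b power_mono)
  qed simp
  then show ?thesis using bmeasure.prob_space by simp
qed

lemma normsq_dominated:
  fixes F :: "nat \<Rightarrow> complex \<Rightarrow> complex"
  assumes [measurable]: "\<And>n. F n \<in> borel_measurable borel" "f \<in> borel_measurable borel"
    and lim: "\<And>b. cmod b = 1 \<Longrightarrow> (\<lambda>n. F n b) \<longlonglongrightarrow> f b"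
    and dom: "\<And>n b. cmod b = 1 \<Longrightarrow> cmod (F n b - f b) \<le> g b"
    and g: "integrable bmeasure (\<lambda>b. (g b)\<^sup>2)"
  shows "(\<lambda>n. normsq (\<lambda>b. F n b - f b)) \<longlonglongrightarrow> 0"
proof -
  have "(\<lambda>n. LINT b|bmeasure. (cmod (F n b - f b))\<^sup>2) \<longlonglongrightarrow> (LINT b|bmeasure. 0)"
  proof (rule integral_dominated_convergence[OF _ _ g])
    show "AE b in bmeasure. (\<lambda>n. (cmod (F n b - f b))\<^sup>2) \<longlonglongrightarrow> 0"
      using AE_bmeasure
    proof eventually_elim
      case (elim b)
      have "(\<lambda>n. (cmod (F n b - f b))\<^sup>2) \<longlonglongrightarrow> (cmod (f b - f b))\<^sup>2"
        by (intro tendsto_intros lim elim)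
      then show ?case by simp
    qed
    show "AE b in bmeasure. norm ((cmod (F n b - f b))\<^sup>2) \<le> (g b)\<^sup>2" for n
      using AE_bmeasure by eventually_elim (simp add: dom power_mono)
  qed measurable
  then show ?thesis by (simp add: normsq_def)
qed

definition approximable :: "(complex \<Rightarrow> complex) set" where
  "approximable = {f \<in> L2B. \<forall>e>0. \<exists>h. continuous_on UNIV h \<and> normsq (\<lambda>b. f b - h b) < e}"

lemma approximableD:
  assumes "f \<in> approximable" "e > 0"
  obtains h where "continuous_on UNIV h" "normsq (\<lambda>b. f b - h b) < e"
  using assms unfolding approximable_def by auto

lemma approximable_closed:
  assumes f: "f \<in> L2B" and a: "\<And>e. e > 0 \<Longrightarrow> \<exists>g\<in>approximable. normsq (\<lambda>b. f b - g b) < e"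
  shows "f \<in> approximable"
proof -
  have "\<exists>h. continuous_on UNIV h \<and> normsq (\<lambda>b. f b - h b) < e" if e: "e > 0" for e
  proof -
    obtain g where g: "g \<in> approximable" "normsq (\<lambda>b. f b - g b) < e / 4" using a[of "e / 4"] e by auto
    obtain h where h: "continuous_on UNIV h" "normsq (\<lambda>b. g b - h b) < e / 4"
      using approximableD[OF g(1), of "e / 4"] e by auto
    have "normsq (\<lambda>b. f b - h b) \<le> 2 * normsq (\<lambda>b. f b - g b) + 2 * normsq (\<lambda>b. g b - h b)"
      using f g h by (intro normsq_triangle) (auto simp: approximable_def continuous_imp_L2B)
    then show ?thesis using g h by (intro exI[of _ h]) auto
  qed
  then show ?thesis using f by (simp add: approximable_def)
qed

lemma approximable_limit:
  assumes "f \<in> L2B" "\<And>n. F n \<in> approximable" "(\<lambda>n. normsq (\<lambda>b. F n b - f b)) \<longlonglongrightarrow> 0"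
  shows "f \<in> approximable"
proof (rule approximable_closed[OF assms(1)])
  fix e :: real assume "e > 0"
  then have "eventually (\<lambda>n. normsq (\<lambda>b. F n b - f b) < e) sequentially"
    using assms(3) by (rule order_tendstoD(2)[rotated])
  then obtain n where "normsq (\<lambda>b. F n b - f b) < e"
    using eventually_happens trivial_limit_sequentially by blast
  then show "\<exists>g\<in>approximable. normsq (\<lambda>b. f b - g b) < e"
    using assms(2) normsq_minus_commute by metis
qed

lemma approximable_lincomb:
  assumes f: "f \<in> approximable" and g: "g \<in> approximable"
  shows "(\<lambda>b. \<alpha> * f b + \<beta> * g b) \<in> approximable"
proof -
  have fg: "f \<in> L2B" "g \<in> L2B" using f g by (auto simp: approximable_def)
  have "\<exists>h. continuous_on UNIV h \<and> normsq (\<lambda>b. (\<alpha> * f b + \<beta> * g b) - h b) < e" if e: "e > 0" for e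
  proof -
    define K where "K = 2 * (cmod \<alpha>)\<^sup>2 + 2 * (cmod \<beta>)\<^sup>2 + 1"
    have K: "K > 0" unfolding K_def by (intro add_nonneg_pos add_nonneg_nonneg) auto
    have eK: "e / K > 0" using e K by simp
    obtain h where h: "continuous_on UNIV h" "normsq (\<lambda>b. f b - h b) < e / K"
      by (rule approximableD[OF f eK])
    obtain k where k: "continuous_on UNIV k" "normsq (\<lambda>b. g b - k b) < e / K"
      by (rule approximableD[OF g eK])
    have "normsq (\<lambda>b. (\<alpha> * f b + \<beta> * g b) - (\<alpha> * h b + \<beta> * k b))
      = normsq (\<lambda>b. \<alpha> * (f b - h b) + \<beta> * (g b - k b))" by (simp add: algebra_simps)
    also have "\<dots> \<le> 2 * (cmod \<alpha>)\<^sup>2 * normsq (\<lambda>b. f b - h b) + 2 * (cmod \<beta>)\<^sup>2 * normsq (\<lambda>b. g b - k b)"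
      by (rule L2B_lincomb(2)[OF L2B_diff[OF fg(1) continuous_imp_L2B[OF h(1)]]
            L2B_diff[OF fg(2) continuous_imp_L2B[OF k(1)]]])
    also have "\<dots> \<le> 2 * (cmod \<alpha>)\<^sup>2 * (e / K) + 2 * (cmod \<beta>)\<^sup>2 * (e / K)"
      using h k by (intro add_mono mult_left_mono) auto
    also have "\<dots> = (K - 1) * (e / K)" by (simp add: K_def algebra_simps add_divide_distrib)
    also have "\<dots> < e" using e K by (simp add: field_simps)
    finally show ?thesis using h k
      by (intro exI[of _ "\<lambda>b. \<alpha> * h b + \<beta> * k b"]) (auto intro!: continuous_intros)
  qed
  then show ?thesis using L2B_lincomb(1)[OF fg] by (simp add: approximable_def)
qed

lemma approximable_continuous:
  assumes "continuous_on UNIV h"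
  shows "h \<in> approximable"
proof -
  have "normsq (\<lambda>b. h b - h b) < e" if "e > 0" for e using that by (simp add: normsq_def)
  then show ?thesis unfolding approximable_def using assms continuous_imp_L2B by blast
qed

lemma indicator_L2B: "A \<in> sets borel \<Longrightarrow> indicator A \<in> L2B"
  by (rule L2B_bounded[of _ 1]) (auto simp: indicator_def)

text \<open>The functions max 0 (1 - n dist(b, C)) equal 1 on C, and as C is closed they are
  eventually 0 at each point outside. The empty set is treated separately because
  \<open>infdist\<close> to it is 0 by convention.\<close>

lemma approximable_indicator_closed:
  fixes C :: "complex set"
  assumes C: "closed C" "C \<noteq> {}"
  shows "indicator C \<in> approximable"
proof (rule approximable_limit)
  define F where "F n b = complex_of_real (max 0 (1 - real n * infdist b C))" for n b
  have F01: "cmod (F n b) \<le> 1" for n b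
    unfolding F_def norm_of_real using infdist_nonneg[of b C] by simp
  show "F n \<in> approximable" for n unfolding F_def
    by (intro approximable_continuous continuous_intros)
  show "(\<lambda>n. normsq (\<lambda>b. F n b - indicator C b)) \<longlonglongrightarrow> 0"
  proof (rule normsq_dominated[where g="\<lambda>_. 2"])
    show "F n \<in> borel_measurable borel" for n
      unfolding F_def by (intro borel_measurable_continuous_onI continuous_intros)
    show "indicator C \<in> borel_measurable borel" using C by auto
    show "cmod (F n b - indicator C b) \<le> 2" for n b
      using norm_triangle_ineq4[of "F n b" "indicator C b"] F01[of n b] by (auto simp: indicator_def)
    show "(\<lambda>n. F n b) \<longlonglongrightarrow> indicator C b" for b
    proof (cases "b \<in> C")
      case True
      then show ?thesis by (simp add: F_def)
    next
      case False
      then have pos: "infdist b C > 0" using C by (meson infdist_pos_not_in_closed)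
      then obtain m where m: "1 < real m * infdist b C" using reals_Archimedean3 by blast
      have "F n b = 0" if "n \<ge> m" for n
      proof -
        have "real m * infdist b C \<le> real n * infdist b C" using that pos by simp
        then show ?thesis using m by (simp add: F_def)
      qed
      then have "eventually (\<lambda>n. F n b = indicator C b) sequentially"
        using False by (auto simp: eventually_sequentially)
      then show ?thesis by (rule tendsto_eventually)
    qed
  qed simp
qed (use C in \<open>auto intro: indicator_L2B\<close>)

text \<open>Dynkin's argument: closed sets are stable under intersection and generate the Borel
  sets, and approximability passes to complements and to countable disjoint unions.\<close>

lemma approximable_indicator:
  fixes A :: "complex set"
  assumes "A \<in> sets borel"
  shows "indicator A \<in> approximable"
proof -
  have A: "A \<in> sigma_sets UNIV (Collect closed)" using assms by (simp add: borel_eq_closed)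
  have stable: "Int_stable (Collect closed)" by (auto simp: Int_stable_def)
  have sub: "Collect closed \<subseteq> Pow (UNIV :: complex set)" by simp
  have zero: "(\<lambda>_. 0) \<in> approximable" by (intro approximable_continuous continuous_intros)
  have borel: "X \<in> sigma_sets UNIV (Collect closed) \<Longrightarrow> X \<in> sets borel" for X :: "complex set"
    by (simp add: borel_eq_closed)
  show ?thesis
  proof (rule sigma_sets_induct_disjoint[OF stable sub A])
    fix X :: "complex set" assume "X \<in> Collect closed"
    then show "indicator X \<in> approximable"
      using approximable_indicator_closed zero by (cases "X = {}") (auto simp: indicator_def[abs_def])
  next
    show "indicator {} \<in> approximable" using zero by (simp add: indicator_def[abs_def])
  next
    fix X :: "complex set" assume X: "X \<in> sigma_sets UNIV (Collect closed)" "indicator X \<in> approximable"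
    have "(\<lambda>b. 1 * 1 + (-1) * indicator X b) \<in> approximable"
      by (rule approximable_lincomb[OF approximable_continuous X(2)]) (intro continuous_intros)
    then show "indicator (UNIV - X) \<in> approximable"
      by (rule back_subst[of "\<lambda>f. f \<in> approximable"]) (auto simp: indicator_def)
  next
    fix X :: "nat \<Rightarrow> complex set"
    assume X: "disjoint_family X" "range X \<subseteq> sigma_sets UNIV (Collect closed)" "\<And>i. indicator (X i) \<in> approximable"
    have Xb [measurable]: "X i \<in> sets borel" for i using X(2) borel by blast
    define F where "F n b = (\<Sum>i<n. indicator (X i) b :: complex)" for n b
    have F: "F n b = indicator (\<Union>i<n. X i) b" for n b
      unfolding F_def by (rule indicator_UN_disjoint[symmetric])
        (use X(1) in \<open>auto simp: disjoint_family_on_def\<close>)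
    show "indicator (\<Union>i. X i) \<in> approximable"
    proof (rule approximable_limit)
      show "F n \<in> approximable" for n
      proof (induction n)
        case 0
        then show ?case using zero by (simp add: F_def[abs_def])
      next
        case (Suc n)
        have "(\<lambda>b. 1 * F n b + 1 * indicator (X n) b) \<in> approximable"
          by (rule approximable_lincomb[OF Suc X(3)])
        then show ?case by (simp add: F_def[abs_def])
      qed
      show "indicator (\<Union>i. X i) \<in> L2B"
        using Xb by (intro indicator_L2B sets.countable_UN) auto
      show "(\<lambda>n. normsq (\<lambda>b. F n b - indicator (\<Union>i. X i) b)) \<longlonglongrightarrow> 0"
      proof (rule normsq_dominated[where g="\<lambda>_. 2"])
        show "F n \<in> borel_measurable borel" for n unfolding F_def by measurable
        show "indicator (\<Union>i. X i) \<in> borel_measurable borel"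
          using Xb by (intro borel_measurable_indicator sets.countable_UN) auto
        show "cmod (F n b - indicator (\<Union>i. X i) b) \<le> 2" for n b
          unfolding F by (auto simp: indicator_def)
        show "(\<lambda>n. F n b) \<longlonglongrightarrow> indicator (\<Union>i. X i) b" for b
        proof (cases "b \<in> (\<Union>i. X i)")
          case True
          then obtain m where "b \<in> X m" by blast
          then have "eventually (\<lambda>n. F n b = indicator (\<Union>i. X i) b) sequentially"
            unfolding F by (intro eventually_sequentiallyI[of "Suc m"]) (auto simp: indicator_def)
          then show ?thesis by (rule tendsto_eventually)
        next
          case False
          then have "F n b = indicator (\<Union>i. X i) b" for n unfolding F by (auto simp: indicator_def)
          then show ?thesis by simp
        qed
      qed simp
    qed
  qed
qed

lemma L2B_approximable:
  assumes f: "f \<in> L2B"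
  shows "f \<in> approximable"
proof -
  have "f \<in> borel_measurable bmeasure"
    using L2B_measurable[OF f] measurable_cong_sets[OF sets_bmeasure refl] by blast
  then obtain F where F: "\<And>i. simple_function bmeasure (F i)"
    "\<And>x. (\<lambda>i. F i x) \<longlonglongrightarrow> f x" "\<And>i x. dist (F i x) 0 \<le> 2 * dist (f x) 0"
    using borel_measurable_implies_sequence_metric[of f bmeasure 0] by auto
  have Fm [measurable]: "F i \<in> borel_measurable borel" for i
    using borel_measurable_simple_function[OF F(1)] by simp
  show ?thesis
  proof (rule approximable_limit[OF f])
    show "F i \<in> approximable" for i
    proof -
      have fin: "finite (range (F i))" using simple_functionD(1)[OF F(1)[of i]] by simp
      have eq: "F i = (\<lambda>b. \<Sum>y\<in>range (F i). y * indicator (F i -` {y}) b)"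
      proof
        fix b
        have "(\<Sum>y\<in>range (F i). y * indicator (F i -` {y}) b) = (\<Sum>y\<in>{F i b}. y * indicator (F i -` {y}) b)"
          by (intro sum.mono_neutral_right fin) (auto simp: indicator_def)
        then show "F i b = (\<Sum>y\<in>range (F i). y * indicator (F i -` {y}) b)" by simp
      qed
      have "(\<lambda>b. \<Sum>y\<in>S. y * indicator (F i -` {y}) b) \<in> approximable" if "finite S" for S
        using that
      proof induction
        case empty
        show ?case by (simp, intro approximable_continuous continuous_intros)
      next
        case (insert y S)
        have "F i -` {y} \<in> sets borel" by (rule measurable_sets_borel[OF Fm]) auto
        from approximable_lincomb[OF approximable_indicator[OF this] insert.IH, of y 1]
        show ?case unfolding sum.insert[OF insert.hyps] mult_1_left .
      qed
      from this[OF fin] show ?thesis using eq by simp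
    qed
    show "(\<lambda>i. normsq (\<lambda>b. F i b - f b)) \<longlonglongrightarrow> 0"
    \<comment> \<open>The approximating simple functions have modulus at most 2 |f|, so they differ
      from f by at most 3 |f|.\<close>
    proof (rule normsq_dominated[where g="\<lambda>b. 3 * cmod (f b)"])
      show "cmod (F n b - f b) \<le> 3 * cmod (f b)" for n b
        using norm_triangle_ineq4[of "F n b" "f b"] F(3)[of n b] by simp
      show "integrable bmeasure (\<lambda>b. (3 * cmod (f b))\<^sup>2)"
        using L2B_integrable[OF f] by (simp add: power_mult_distrib)
    qed (use F f in \<open>auto simp: L2B_def\<close>)
  qed
qed

section \<open>Trigonometric polynomials and the Stone-Weierstrass theorem\<close>

inductive trig_poly :: "(complex \<Rightarrow> complex) \<Rightarrow> bool" where
  monom: "trig_poly (\<lambda>b. b powi n)"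
| lincomb: "trig_poly f \<Longrightarrow> trig_poly h \<Longrightarrow> trig_poly (\<lambda>b. \<alpha> * f b + \<beta> * h b)"

text \<open>Equality is claimed on the circle only: at b = 0 the exponent law for
  \<open>powi\<close> fails, for instance for exponents 1 and -1.\<close>

lemma trig_poly_mult:
  assumes "trig_poly f" "trig_poly h"
  shows "\<exists>k. trig_poly k \<and> (\<forall>b. cmod b = 1 \<longrightarrow> k b = f b * h b)"
  using assms
proof (induction arbitrary: h)
  case (monom m)
  show ?case using monom
  proof induction
    case (monom n)
    have "\<forall>b. cmod b = 1 \<longrightarrow> b powi (m + n) = b powi m * b powi n"
      by (auto intro!: power_int_add)
    then show ?case using trig_poly.monom by blast
  next
    case (lincomb f h \<alpha> \<beta>)
    then obtain k1 k2 where "trig_poly k1" "\<forall>b. cmod b = 1 \<longrightarrow> k1 b = b powi m * f b"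
      "trig_poly k2" "\<forall>b. cmod b = 1 \<longrightarrow> k2 b = b powi m * h b" by blast
    then show ?case
      by (intro exI[of _ "\<lambda>b. \<alpha> * k1 b + \<beta> * k2 b"] conjI trig_poly.lincomb) (auto simp: algebra_simps)
  qed
next
  case (lincomb f f' \<alpha> \<beta>)
  obtain k1 k2 where "trig_poly k1" "\<forall>b. cmod b = 1 \<longrightarrow> k1 b = f b * h b"
    "trig_poly k2" "\<forall>b. cmod b = 1 \<longrightarrow> k2 b = f' b * h b"
    using lincomb.IH(1)[OF lincomb.prems] lincomb.IH(2)[OF lincomb.prems] by blast
  then show ?case
    by (intro exI[of _ "\<lambda>b. \<alpha> * k1 b + \<beta> * k2 b"] conjI trig_poly.lincomb) (auto simp: algebra_simps)
qed

text \<open>The link to the real Stone-Weierstrass theorem: on the circle 1 / b = cnj b, so the real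
  coordinates, and with them all real polynomials, are trigonometric polynomials.\<close>

lemma trig_poly_real_polynomial:
  assumes "real_polynomial_function p"
  shows "\<exists>k. trig_poly k \<and> (\<forall>b. cmod b = 1 \<longrightarrow> k b = complex_of_real (p b))"
  using assms
proof induction
  case (linear p)
  interpret bounded_linear p by fact
  have p: "p b = Re b * p 1 + Im b * p \<i>" for b
  proof -
    have "b = Re b *\<^sub>R 1 + Im b *\<^sub>R \<i>" by (simp add: complex_eq_iff)
    then have "p b = p (Re b *\<^sub>R 1 + Im b *\<^sub>R \<i>)" by simp
    also have "\<dots> = Re b * p 1 + Im b * p \<i>" by (simp only: add scaleR real_scaleR_def)
    finally show ?thesis .
  qed
  \<comment> \<open>From Re b = (b + 1/b) / 2 and Im b = (b - 1/b) / (2 \<i>) on the circle.\<close>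
  let ?x = "(of_real (p 1) - \<i> * of_real (p \<i>)) / 2" and ?y = "(of_real (p 1) + \<i> * of_real (p \<i>)) / 2"
  have "?x * b powi 1 + ?y * b powi (- 1) = complex_of_real (p b)" if "cmod b = 1" for b
  proof -
    have "b * cnj b = 1" using complex_norm_square[of b] that by simp
    then have "inverse b = cnj b" by (rule inverse_unique)
    then have "b powi (- 1) = cnj b" by (simp add: power_int_minus)
    then show ?thesis using p[of b] by (simp add: complex_eq_iff) (simp add: field_simps)
  qed
  then show ?case
    by (intro exI[of _ "\<lambda>b. ?x * b powi 1 + ?y * b powi (- 1)"] conjI trig_poly.lincomb trig_poly.monom) auto
next
  case (const c)
  have "trig_poly (\<lambda>b. of_real c * b powi 0 + 0 * b powi 0)" by (intro trig_poly.lincomb trig_poly.monom)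
  then show ?case by auto
next
  case (add f g)
  then obtain k1 k2 where "trig_poly k1" "\<forall>b. cmod b = 1 \<longrightarrow> k1 b = of_real (f b)"
    "trig_poly k2" "\<forall>b. cmod b = 1 \<longrightarrow> k2 b = of_real (g b)" by blast
  then show ?case
    by (intro exI[of _ "\<lambda>b. 1 * k1 b + 1 * k2 b"] conjI trig_poly.lincomb) auto
next
  case (mult f g)
  then obtain k1 k2 where k: "trig_poly k1" "\<forall>b. cmod b = 1 \<longrightarrow> k1 b = of_real (f b)"
    "trig_poly k2" "\<forall>b. cmod b = 1 \<longrightarrow> k2 b = of_real (g b)" by blast
  then show ?case using trig_poly_mult[OF k(1,3)] by auto
qed

lemma trig_poly_measurable [measurable_dest]: "trig_poly f \<Longrightarrow> f \<in> borel_measurable borel"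
  by (induction rule: trig_poly.induct)
    (auto intro!: borel_measurable_add borel_measurable_times power_int_borel_measurable)

lemma power_int_L2B: "(\<lambda>b. b powi n) \<in> L2B"
  by (rule L2B_bounded[of _ 1]) (auto simp: norm_power_int)

lemma trig_poly_L2B: "trig_poly f \<Longrightarrow> f \<in> L2B"
  by (induction rule: trig_poly.induct) (auto intro: L2B_lincomb power_int_L2B)

lemma trig_poly_dense:
  assumes f: "f \<in> L2B" and e: "e > 0"
  shows "\<exists>k. trig_poly k \<and> normsq (\<lambda>b. f b - k b) < e"
proof -
  obtain h where h: "continuous_on UNIV h" "normsq (\<lambda>b. f b - h b) < e / 4"
    using approximableD[OF L2B_approximable[OF f], of "e / 4"] e by auto
  \<comment> \<open>Real and imaginary parts each contribute d, and the square of 2 d is e / 8; the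
    total error then stays below 2 (e / 4) + 2 (e / 8) < e.\<close>
  define d where "d = sqrt (e / 8) / 2"
  have d: "d > 0" using e by (simp add: d_def)
  have hc: "continuous_on (sphere 0 1) h" using h(1) continuous_on_subset by blast
  obtain p where p: "real_polynomial_function p" "\<And>b. b \<in> sphere 0 1 \<Longrightarrow> \<bar>Re (h b) - p b\<bar> < d"
    by (rule Stone_Weierstrass_real_polynomial_function[of "sphere 0 1" "\<lambda>b. Re (h b)" d])
      (use d hc in \<open>auto intro!: continuous_intros\<close>)
  obtain q where q: "real_polynomial_function q" "\<And>b. b \<in> sphere 0 1 \<Longrightarrow> \<bar>Im (h b) - q b\<bar> < d"
    by (rule Stone_Weierstrass_real_polynomial_function[of "sphere 0 1" "\<lambda>b. Im (h b)" d])
      (use d hc in \<open>auto intro!: continuous_intros\<close>)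
  obtain k1 k2 where k: "trig_poly k1" "\<forall>b. cmod b = 1 \<longrightarrow> k1 b = of_real (p b)"
    "trig_poly k2" "\<forall>b. cmod b = 1 \<longrightarrow> k2 b = of_real (q b)"
    using trig_poly_real_polynomial[OF p(1)] trig_poly_real_polynomial[OF q(1)] by blast
  define k where "k b = 1 * k1 b + \<i> * k2 b" for b
  have kt: "trig_poly k" unfolding k_def by (intro trig_poly.lincomb k)
  have "cmod (h b - k b) \<le> 2 * d" if b: "cmod b = 1" for b
  proof -
    have "cmod (h b - k b) \<le> \<bar>Re (h b - k b)\<bar> + \<bar>Im (h b - k b)\<bar>" by (rule cmod_le)
    moreover have "Re (h b - k b) = Re (h b) - p b" "Im (h b - k b) = Im (h b) - q b"
      using k b by (simp_all add: k_def)
    ultimately show ?thesis using p(2)[of b] q(2)[of b] b by simp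
  qed
  then have "normsq (\<lambda>b. h b - k b) \<le> (2 * d)\<^sup>2"
    by (intro normsq_bounded borel_measurable_diff borel_measurable_continuous_onI[OF h(1)]
        trig_poly_measurable[OF kt])
  also have "\<dots> = e / 8" using e by (simp add: d_def)
  finally have "normsq (\<lambda>b. h b - k b) \<le> e / 8" .
  moreover have "normsq (\<lambda>b. f b - k b) \<le> 2 * normsq (\<lambda>b. f b - h b) + 2 * normsq (\<lambda>b. h b - k b)"
    by (rule normsq_triangle[OF f continuous_imp_L2B[OF h(1)] trig_poly_L2B[OF kt]])
  ultimately have "normsq (\<lambda>b. f b - k b) < e" using h e by simp
  then show ?thesis using kt by blast
qed

section \<open>The group SU(1,1)\<close>

definition su :: "complex \<Rightarrow> complex \<Rightarrow> complex^2^2" where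
  "su a c = (\<chi> i j. if i = 1 then (if j = 1 then a else c) else (if j = 1 then cnj c else cnj a))"

lemma su_nth [simp]: "su a c $ 1 $ 1 = a" "su a c $ 1 $ 2 = c" "su a c $ 2 $ 1 = cnj c" "su a c $ 2 $ 2 = cnj a"
  by (simp_all add: su_def)

lemma su_mult: "su a c ** su a' c' = su (a * a' + c * cnj c') (a * c' + c * cnj a')"
  by (simp add: vec_eq_iff forall_2 matrix_matrix_mult_def sum_2 algebra_simps)

lemma su_one: "mat 1 = su 1 0"
  by (simp add: vec_eq_iff forall_2 mat_def)

lemma carrier_SU11: "g \<in> carrier SU11 \<longleftrightarrow> (\<exists>a c. (cmod a)\<^sup>2 - (cmod c)\<^sup>2 = 1 \<and> g = su a c)"
proof
  assume "g \<in> carrier SU11"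
  then have "(cmod (g $ 1 $ 1))\<^sup>2 - (cmod (g $ 1 $ 2))\<^sup>2 = 1" "g = su (g $ 1 $ 1) (g $ 1 $ 2)"
    by (simp_all add: SU11_def vec_eq_iff forall_2)
  then show "\<exists>a c. (cmod a)\<^sup>2 - (cmod c)\<^sup>2 = 1 \<and> g = su a c" by blast
qed (auto simp: SU11_def)

lemma su_in_carrier [simp]: "su a c \<in> carrier SU11 \<longleftrightarrow> (cmod a)\<^sup>2 - (cmod c)\<^sup>2 = 1"
  by (simp add: SU11_def)

lemma carrierE:
  assumes "g \<in> carrier SU11"
  obtains a c where "g = su a c" "(cmod a)\<^sup>2 - (cmod c)\<^sup>2 = 1"
  using assms carrier_SU11 by blast

lemma mult_SU11 [simp]: "x \<otimes>\<^bsub>SU11\<^esub> y = x ** y" and one_SU11 [simp]: "\<one>\<^bsub>SU11\<^esub> = mat 1"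
  by (simp_all add: SU11_def)

text \<open>The determinant condition as a polynomial equation in the entries and their conjugates,
  in which its multiplicativity is plain algebra.\<close>

lemma det_condition_iff: "(cmod a)\<^sup>2 - (cmod c)\<^sup>2 = 1 \<longleftrightarrow> a * cnj a - c * cnj c = 1"
proof -
  have "a * cnj a - c * cnj c = of_real ((cmod a)\<^sup>2 - (cmod c)\<^sup>2)"
    by (simp only: of_real_diff complex_norm_square)
  then show ?thesis by (metis of_real_eq_1_iff)
qed

lemma det_condition_mult:
  assumes "(cmod a)\<^sup>2 - (cmod c)\<^sup>2 = 1" "(cmod a')\<^sup>2 - (cmod c')\<^sup>2 = 1"
  shows "(cmod (a * a' + c * cnj c'))\<^sup>2 - (cmod (a * c' + c * cnj a'))\<^sup>2 = 1"
proof -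
  have "(a * a' + c * cnj c') * cnj (a * a' + c * cnj c') - (a * c' + c * cnj a') * cnj (a * c' + c * cnj a')
      = (a * cnj a - c * cnj c) * (a' * cnj a' - c' * cnj c')"
    by (simp add: algebra_simps)
  then show ?thesis using assms by (simp only: det_condition_iff mult_1)
qed

lemma su_inverse:
  assumes "(cmod a)\<^sup>2 - (cmod c)\<^sup>2 = 1"
  shows "su (cnj a) (- c) ** su a c = mat 1" "su a c ** su (cnj a) (- c) = mat 1"
  using assms by (simp_all add: su_mult su_one det_condition_iff mult.commute)

lemma group_SU11: "group SU11"
proof (rule groupI)
  show "x \<otimes>\<^bsub>SU11\<^esub> y \<in> carrier SU11" if "x \<in> carrier SU11" "y \<in> carrier SU11" for x y
    using that det_condition_mult by (auto simp: su_mult elim!: carrierE)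
  show "\<one>\<^bsub>SU11\<^esub> \<in> carrier SU11" by (simp add: su_one)
  show "\<exists>y\<in>carrier SU11. y \<otimes>\<^bsub>SU11\<^esub> x = \<one>\<^bsub>SU11\<^esub>" if x: "x \<in> carrier SU11" for x
  proof -
    obtain a c where "x = su a c" "(cmod a)\<^sup>2 - (cmod c)\<^sup>2 = 1" using x by (rule carrierE)
    then show ?thesis by (intro bexI[of _ "su (cnj a) (- c)"]) (auto simp: su_inverse)
  qed
qed (auto simp: matrix_mul_assoc)

lemma inv_SU11:
  assumes "(cmod a)\<^sup>2 - (cmod c)\<^sup>2 = 1"
  shows "inv\<^bsub>SU11\<^esub> (su a c) = su (cnj a) (- c)"
  by (rule group.inv_equality[OF group_SU11]) (use assms in \<open>auto simp: su_inverse\<close>)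

lemma moebius_su: "moebius (su a c) z = (a * z + c) / (cnj c * z + cnj a)"
  by (simp add: moebius_def)

lemma cmod_less_of_det:
  assumes "(cmod a)\<^sup>2 - (cmod c)\<^sup>2 = 1"
  shows "cmod c < cmod a"
  by (rule power2_less_imp_less) (use assms in auto)

lemma moebius_denom_nonzero:
  assumes "(cmod a)\<^sup>2 - (cmod c)\<^sup>2 = 1" "cmod z \<le> 1"
  shows "cnj c * z + cnj a \<noteq> 0"
proof
  assume "cnj c * z + cnj a = 0"
  then have "cmod (cnj a) = cmod (cnj c * z)" by (metis add_eq_0_iff norm_minus_cancel)
  also have "\<dots> \<le> cmod c" using assms(2) by (simp add: norm_mult mult_left_le)
  finally show False using cmod_less_of_det[OF assms(1)] by simp
qed

lemma moebius_compose:
  assumes "(cmod a')\<^sup>2 - (cmod c')\<^sup>2 = 1" "cmod z \<le> 1"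
  shows "moebius (su a c ** su a' c') z = moebius (su a c) (moebius (su a' c') z)"
proof -
  define N D where "N = a' * z + c'" and "D = cnj c' * z + cnj a'"
  have D: "D \<noteq> 0" unfolding D_def using moebius_denom_nonzero[OF assms] .
  have "moebius (su a c ** su a' c') z = (a * N + c * D) / (cnj c * N + cnj a * D)"
    by (simp add: su_mult moebius_su N_def D_def algebra_simps)
  also have "\<dots> = ((a * N + c * D) / D) / ((cnj c * N + cnj a * D) / D)" using D by simp
  also have "\<dots> = moebius (su a c) (N / D)" using D by (simp add: moebius_su add_divide_distrib)
  finally show ?thesis by (simp add: moebius_su N_def D_def)
qed

lemma moebius_one: "moebius (mat 1) z = z"
  by (simp add: su_one moebius_su)

text \<open>For numerator N and denominator D, |D|^2 - |N|^2 is the determinant times 1 - |z|^2. The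
  identity yields invariance of both the disk and the circle.\<close>

lemma moebius_cmod:
  assumes "(cmod a)\<^sup>2 - (cmod c)\<^sup>2 = 1" "cmod z \<le> 1"
  shows "1 - (cmod (moebius (su a c) z))\<^sup>2 = (1 - (cmod z)\<^sup>2) / (cmod (cnj c * z + cnj a))\<^sup>2"
proof -
  define N D where "N = a * z + c" and "D = cnj c * z + cnj a"
  have D: "D \<noteq> 0" unfolding D_def using moebius_denom_nonzero[OF assms] .
  have "of_real ((cmod D)\<^sup>2 - (cmod N)\<^sup>2) = D * cnj D - N * cnj N"
    by (simp only: of_real_diff complex_norm_square)
  also have "\<dots> = (a * cnj a - c * cnj c) * (1 - z * cnj z)"
    by (simp add: N_def D_def algebra_simps)
  also have "\<dots> = of_real (1 - (cmod z)\<^sup>2)"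
    using assms(1) by (simp only: det_condition_iff of_real_diff complex_norm_square) simp
  finally have "(cmod D)\<^sup>2 - (cmod N)\<^sup>2 = 1 - (cmod z)\<^sup>2" by (simp only: of_real_eq_iff)
  moreover have "(cmod D)\<^sup>2 \<noteq> 0" using D by simp
  ultimately show ?thesis
    by (simp add: moebius_su norm_divide power_divide N_def[symmetric] D_def[symmetric] diff_divide_distrib[symmetric]
        eq_divide_eq left_diff_distrib)
qed

lemma moebius_disk:
  assumes "(cmod a)\<^sup>2 - (cmod c)\<^sup>2 = 1" "z \<in> hdisk"
  shows "moebius (su a c) z \<in> hdisk"
proof -
  have "(cmod z)\<^sup>2 < 1" using assms(2) by (simp add: power_less_one_iff)
  moreover have "cnj c * z + cnj a \<noteq> 0" using moebius_denom_nonzero[OF assms(1)] assms(2) by simp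
  ultimately have "0 < 1 - (cmod (moebius (su a c) z))\<^sup>2"
    using moebius_cmod[OF assms(1), of z] assms(2) by simp
  then show ?thesis by (simp add: power_less_one_iff)
qed

lemma moebius_circle:
  assumes "(cmod a)\<^sup>2 - (cmod c)\<^sup>2 = 1" "cmod z = 1"
  shows "cmod (moebius (su a c) z) = 1"
proof -
  have "(cmod (moebius (su a c) z))\<^sup>2 = 1\<^sup>2" using moebius_cmod[OF assms(1), of z] assms(2) by simp
  then show ?thesis by (rule power2_eq_imp_eq) auto
qed

lemma SU11_action_Bij:
  assumes "g \<in> carrier SU11"
  shows "SU11_action g \<in> Bij hdisk"
proof -
  obtain a c where g: "g = su a c" "(cmod a)\<^sup>2 - (cmod c)\<^sup>2 = 1" using assms by (rule carrierE)
  then have g': "(cmod (cnj a))\<^sup>2 - (cmod (- c))\<^sup>2 = 1" by simp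
  have inv: "moebius (su (cnj a) (- c)) (moebius (su a c) z) = z"
    "moebius (su a c) (moebius (su (cnj a) (- c)) z) = z" if "z \<in> hdisk" for z
    using that g(2) g' moebius_compose[of a c z "cnj a" "- c"] moebius_compose[of "cnj a" "- c" z a c]
    by (simp_all add: su_inverse moebius_one)
  have "bij_betw (SU11_action g) hdisk hdisk"
    by (rule bij_betw_byWitness[where f'="moebius (su (cnj a) (- c))"])
      (use g g' inv moebius_disk[OF g(2)] moebius_disk[OF g'] in \<open>auto simp: SU11_action_def\<close>)
  then show ?thesis by (simp add: Bij_def SU11_action_def)
qed

lemma transitive_action_SU11: "transitive_action SU11 hdisk SU11_action"
proof -
  have "SU11_action (x ** y) = compose hdisk (SU11_action x) (SU11_action y)"
    if xy: "x \<in> carrier SU11" "y \<in> carrier SU11" for x y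
  proof -
    obtain a c where x: "x = su a c" "(cmod a)\<^sup>2 - (cmod c)\<^sup>2 = 1" using xy(1) by (rule carrierE)
    obtain a' c' where y: "y = su a' c'" "(cmod a')\<^sup>2 - (cmod c')\<^sup>2 = 1" using xy(2) by (rule carrierE)
    show ?thesis
      using moebius_compose[OF y(2)] moebius_disk[OF y(2)]
      by (auto simp: fun_eq_iff compose_def SU11_action_def x y restrict_def)
  qed
  then have "SU11_action \<in> hom SU11 (BijGroup hdisk)"
    using SU11_action_Bij by (auto simp: hom_def BijGroup_def)
  then have "group_action SU11 hdisk SU11_action"
    unfolding group_action_def group_hom_def group_hom_axioms_def
    using group_SU11 group_BijGroup by blast
  then interpret group_action SU11 hdisk SU11_action .
  have base: "\<exists>g\<in>carrier SU11. SU11_action g 0 = x" if x: "x \<in> hdisk" for x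
  proof -
    \<comment> \<open>The matrix with first row (t, t x) sends 0 to x, and this t gives it
      determinant 1. It suffices to reach every point from 0.\<close>
    define t where "t = 1 / sqrt (1 - (cmod x)\<^sup>2)"
    have x1: "1 - (cmod x)\<^sup>2 > 0" using x by (simp add: power_less_one_iff)
    then have t: "t > 0" "t\<^sup>2 = 1 / (1 - (cmod x)\<^sup>2)" by (simp_all add: t_def power_divide)
    have "(cmod (of_real t))\<^sup>2 - (cmod (of_real t * x))\<^sup>2 = t\<^sup>2 * (1 - (cmod x)\<^sup>2)"
      using t by (simp add: norm_mult power_mult_distrib right_diff_distrib)
    also have "\<dots> = 1" using t x1 by simp
    finally show ?thesis using t(1)
      by (intro bexI[of _ "su (of_real t) (of_real t * x)"]) (auto simp: SU11_action_def moebius_su)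
  qed
  show ?thesis
  proof
    fix x y assume xy: "x \<in> hdisk" "y \<in> hdisk"
    obtain g h where g: "g \<in> carrier SU11" "SU11_action g 0 = x" and h: "h \<in> carrier SU11" "SU11_action h 0 = y"
      using base xy by blast
    have gi: "inv\<^bsub>SU11\<^esub> g \<in> carrier SU11" using group.inv_closed[OF group_SU11 g(1)] .
    have "SU11_action (inv\<^bsub>SU11\<^esub> g) x = 0"
      using composition_rule[OF _ gi g(1), of 0] g(2) id_eq_one group.l_inv[OF group_SU11 g(1)]
      by (metis centre_in_ball restrict_apply' zero_less_one)
    then have "SU11_action (h \<otimes>\<^bsub>SU11\<^esub> inv\<^bsub>SU11\<^esub> g) x = y"
      using composition_rule[OF xy(1) h(1) gi] h(2) by simp
    then show "\<exists>g\<in>carrier SU11. SU11_action g x = y"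
      using h(1) gi group_SU11 by (metis group.is_monoid monoid.m_closed)
  qed
qed

text \<open>Dividing by a brings the inverse transformation to the form u (b - cnj k) / (1 - k b)
  with |k| < 1 = |u|. The determinant condition gives 1 - |k|^2 = 1 / |a|^2, which simplifies the
  Jacobian.\<close>

lemma distr_moebius_bmeasure:
  assumes d: "(cmod a)\<^sup>2 - (cmod c)\<^sup>2 = 1"
  shows "distr (density bmeasure (\<lambda>b. ennreal (1 / (cmod (a - cnj c * b))\<^sup>2))) borel
    (moebius (su (cnj a) (- c))) = bmeasure"
proof -
  define k u where "k = cnj c / a" and "u = cnj a / a"
  have a0: "a \<noteq> 0" using cmod_less_of_det[OF d] by auto
  have k: "cmod k < 1" using cmod_less_of_det[OF d] a0 by (simp add: k_def norm_divide)
  have u: "cmod u = 1" using a0 by (simp add: u_def norm_divide)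
  have den: "a - cnj c * b = a * (1 - k * b)" for b using a0 by (simp add: k_def algebra_simps)
  have "u * (b - cnj k) = (cnj a * b - c) / a" for b using a0 by (simp add: u_def k_def field_simps)
  then have m: "u * (b - cnj k) / (1 - k * b) = moebius (su (cnj a) (- c)) b" for b
    using a0 den[of b] by (simp add: moebius_su)
  have "1 - (cmod k)\<^sup>2 = ((cmod a)\<^sup>2 - (cmod c)\<^sup>2) / (cmod a)\<^sup>2"
    using a0 by (simp add: k_def norm_divide power_divide diff_divide_distrib)
  then have "(1 - (cmod k)\<^sup>2) / (cmod (1 - k * b))\<^sup>2 = 1 / (cmod (a - cnj c * b))\<^sup>2" for b
    unfolding den d by (simp add: norm_mult power_mult_distrib)
  then show ?thesis using distr_disk_automorphism_bmeasure[OF k u] unfolding m by simp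
qed

section \<open>The fundamental series\<close>

definition jacobian_factor :: "real \<Rightarrow> complex^2^2 \<Rightarrow> complex \<Rightarrow> complex" where
  "jacobian_factor lam g b = complex_of_real (cmod (g $ 1 $ 1 - g $ 2 $ 1 * b)) powr (- 1 + 2 * \<i> * of_real lam)"

lemma fundamental_series_su:
  assumes "(cmod a)\<^sup>2 - (cmod c)\<^sup>2 = 1"
  shows "fundamental_series lam (su a c) f b = jacobian_factor lam (su a c) b * f (moebius (su (cnj a) (- c)) b)"
  by (simp add: fundamental_series_def jacobian_factor_def inv_SU11[OF assms])

text \<open>The exponent has real part -1, so the modulus is independent of lam and equals the
  square root of the Jacobian; this is what makes the operators unitary. Where the base vanishes
  both sides are 0 by convention.\<close>

lemma cmod_jacobian_factor: "cmod (jacobian_factor lam g b) = 1 / cmod (g $ 1 $ 1 - g $ 2 $ 1 * b)"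
  unfolding jacobian_factor_def
  by (cases "g $ 1 $ 1 - g $ 2 $ 1 * b = 0")
    (auto simp: norm_powr_real_powr powr_minus divide_inverse)

lemma moebius_measurable [measurable]: "moebius g \<in> borel_measurable borel"
  unfolding moebius_def[abs_def] by measurable

lemma jacobian_factor_measurable [measurable]: "jacobian_factor lam g \<in> borel_measurable borel"
  unfolding jacobian_factor_def[abs_def] by measurable

lemma fundamental_series_measurable:
  assumes "f \<in> borel_measurable borel"
  shows "fundamental_series lam g f \<in> borel_measurable borel"
proof -
  note [measurable] = assms
  have "(\<lambda>b. jacobian_factor lam g b * f (moebius (inv\<^bsub>SU11\<^esub> g) b)) \<in> borel_measurable borel" by measurable
  then show ?thesis unfolding fundamental_series_def[abs_def] jacobian_factor_def[abs_def] .
qed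

lemma integral_moebius_bmeasure:
  fixes F :: "complex \<Rightarrow> 'a :: {banach, second_countable_topology}"
  assumes d: "(cmod a)\<^sup>2 - (cmod c)\<^sup>2 = 1" and [measurable]: "F \<in> borel_measurable borel"
  shows "(LINT b|bmeasure. (1 / (cmod (a - cnj c * b))\<^sup>2) *\<^sub>R F (moebius (su (cnj a) (- c)) b)) = (LINT b|bmeasure. F b)"
    and "integrable bmeasure (\<lambda>b. (1 / (cmod (a - cnj c * b))\<^sup>2) *\<^sub>R F (moebius (su (cnj a) (- c)) b)) \<longleftrightarrow> integrable bmeasure F"
proof -
  let ?m = "moebius (su (cnj a) (- c))"
  let ?D = "density bmeasure (\<lambda>b. ennreal (1 / (cmod (a - cnj c * b))\<^sup>2))"
  have [measurable]: "(\<lambda>b. F (?m b)) \<in> borel_measurable bmeasure"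
    "(\<lambda>b. 1 / (cmod (a - cnj c * b))\<^sup>2) \<in> borel_measurable bmeasure" by measurable
  have [measurable]: "?m \<in> measurable ?D borel" by measurable
  have "(LINT b|bmeasure. F b) = (LINT b|distr ?D borel ?m. F b)"
    using distr_moebius_bmeasure[OF d] by simp
  also have "\<dots> = (LINT b|?D. F (?m b))" by (rule integral_distr) measurable
  also have "\<dots> = (LINT b|bmeasure. (1 / (cmod (a - cnj c * b))\<^sup>2) *\<^sub>R F (?m b))"
    by (rule integral_density) auto
  finally show "(LINT b|bmeasure. (1 / (cmod (a - cnj c * b))\<^sup>2) *\<^sub>R F (?m b)) = (LINT b|bmeasure. F b)" ..
  have "integrable bmeasure F \<longleftrightarrow> integrable (distr ?D borel ?m) F"
    using distr_moebius_bmeasure[OF d] by simp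
  also have "\<dots> \<longleftrightarrow> integrable ?D (\<lambda>b. F (?m b))" by (rule integrable_distr_eq) measurable
  also have "\<dots> \<longleftrightarrow> integrable bmeasure (\<lambda>b. (1 / (cmod (a - cnj c * b))\<^sup>2) *\<^sub>R F (?m b))"
    by (rule integrable_density) auto
  finally show "integrable bmeasure (\<lambda>b. (1 / (cmod (a - cnj c * b))\<^sup>2) *\<^sub>R F (?m b)) \<longleftrightarrow> integrable bmeasure F" ..
qed

lemma fundamental_series_L2:
  assumes g: "g \<in> carrier SU11" and f: "f \<in> L2B"
  shows "fundamental_series lam g f \<in> L2B" and "normsq (fundamental_series lam g f) = normsq f"
proof -
  obtain a c where su: "g = su a c" and d: "(cmod a)\<^sup>2 - (cmod c)\<^sup>2 = 1" using g by (rule carrierE)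
  note [measurable] = L2B_measurable[OF f]
  have sq: "(cmod (fundamental_series lam g f b))\<^sup>2
     = (1 / (cmod (a - cnj c * b))\<^sup>2) *\<^sub>R (\<lambda>b. (cmod (f b))\<^sup>2) (moebius (su (cnj a) (- c)) b)" for b
    unfolding su fundamental_series_su[OF d] norm_mult cmod_jacobian_factor
    by (simp add: power_divide power_mult_distrib)
  have "integrable bmeasure (\<lambda>b. (cmod (fundamental_series lam g f b))\<^sup>2)"
    unfolding sq using L2B_integrable[OF f] by (subst integral_moebius_bmeasure(2)[OF d]) auto
  then show "fundamental_series lam g f \<in> L2B"
    using fundamental_series_measurable[OF L2B_measurable[OF f]] by (simp add: L2B_def)
  show "normsq (fundamental_series lam g f) = normsq f"
    unfolding normsq_def sq by (rule integral_moebius_bmeasure(1)[OF d]) auto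
qed

lemma fundamental_series_inner:
  assumes g: "g \<in> carrier SU11" and f: "f \<in> L2B" and h: "h \<in> L2B"
  shows "L2_inner (fundamental_series lam g f) (fundamental_series lam g h) = L2_inner f h"
proof -
  obtain a c where su: "g = su a c" and d: "(cmod a)\<^sup>2 - (cmod c)\<^sup>2 = 1" using g by (rule carrierE)
  note [measurable] = L2B_measurable[OF f] L2B_measurable[OF h]
  have "fundamental_series lam g f b * cnj (fundamental_series lam g h b)
     = (1 / (cmod (a - cnj c * b))\<^sup>2) *\<^sub>R (\<lambda>b. f b * cnj (h b)) (moebius (su (cnj a) (- c)) b)" for b
  proof -
    have "jacobian_factor lam g b * cnj (jacobian_factor lam g b) = of_real (1 / (cmod (a - cnj c * b))\<^sup>2)"
      unfolding complex_norm_square[symmetric] cmod_jacobian_factor su by (simp add: power_divide)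
    then show ?thesis unfolding su fundamental_series_su[OF d]
      by (simp add: scaleR_conv_of_real mult_ac) (simp add: mult.assoc[symmetric])
  qed
  then show ?thesis unfolding L2_inner_def
    by (simp only:) (rule integral_moebius_bmeasure(1)[OF d], measurable)
qed

text \<open>The cocycle property, i.e. the chain rule for Jacobians: the denominator of a product of
  matrices is the product of the denominators along the orbit, and the inverse matrices compose in
  reversed order. On the circle no denominator vanishes.\<close>

lemma fundamental_series_mult:
  assumes g: "g \<in> carrier SU11" and h: "h \<in> carrier SU11" and b: "cmod b = 1"
  shows "fundamental_series lam (g ** h) f b = fundamental_series lam g (fundamental_series lam h f) b"
proof -
  obtain a c where su: "g = su a c" and d: "(cmod a)\<^sup>2 - (cmod c)\<^sup>2 = 1" using g by (rule carrierE)
  obtain a' c' where su': "h = su a' c'" and d': "(cmod a')\<^sup>2 - (cmod c')\<^sup>2 = 1" using h by (rule carrierE)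
  have di: "(cmod (cnj a))\<^sup>2 - (cmod (- c))\<^sup>2 = 1" "(cmod (cnj a'))\<^sup>2 - (cmod (- c'))\<^sup>2 = 1" using d d' by auto
  let ?m = "moebius (su (cnj a) (- c)) b"
  have den: "a - cnj c * b \<noteq> 0" using moebius_denom_nonzero[OF di(1), of b] b by simp
  have "moebius (su (cnj a') (- c') ** su (cnj a) (- c)) b = moebius (su (cnj a') (- c')) ?m"
    by (rule moebius_compose[OF di(1)]) (simp add: b)
  moreover have "su (cnj a') (- c') ** su (cnj a) (- c) = su (cnj (a * a' + c * cnj c')) (- (a * c' + c * cnj a'))"
    by (simp add: su_mult algebra_simps)
  ultimately have m: "moebius (su (cnj (a * a' + c * cnj c')) (- (a * c' + c * cnj a'))) b = moebius (su (cnj a') (- c')) ?m"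
    by simp
  have "(a - cnj c * b) * (a' - cnj c' * ?m) = (a * a' + c * cnj c') - cnj (a * c' + c * cnj a') * b"
  proof -
    have "?m = (cnj a * b - c) / (a - cnj c * b)" by (simp add: moebius_su)
    then have "(a - cnj c * b) * (a' - cnj c' * ?m) = (a - cnj c * b) * a' - cnj c' * (cnj a * b - c)"
      using den by (simp add: right_diff_distrib[of "a - cnj c * b"])
    then show ?thesis by (simp add: algebra_simps)
  qed
  then have "cmod ((a * a' + c * cnj c') - cnj (a * c' + c * cnj a') * b)
      = cmod (a - cnj c * b) * cmod (a' - cnj c' * ?m)"
    by (metis norm_mult)
  then have "jacobian_factor lam (su (a * a' + c * cnj c') (a * c' + c * cnj a')) b
     = jacobian_factor lam (su a c) b * jacobian_factor lam (su a' c') ?m"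
    unfolding jacobian_factor_def su_nth
    by (simp only: of_real_mult) (rule powr_times_real, auto)
  then show ?thesis
    unfolding su su' su_mult fundamental_series_su[OF det_condition_mult[OF d d']]
      fundamental_series_su[OF d] fundamental_series_su[OF d'] m by simp
qed

text \<open>The inverse of |a| - |c| is |a| + |c| because |a|^2 - |c|^2 = 1, so convergence of the
  entries bounds the factors uniformly on the circle. This provides the dominating constant for
  strong continuity.\<close>

lemma carrier_sequence_bound:
  assumes X: "\<And>n. X n \<in> carrier SU11" and lim: "X \<longlonglongrightarrow> g"
  shows "\<exists>K. \<forall>n b. cmod b = 1 \<longrightarrow> cmod (jacobian_factor lam (X n) b) \<le> K"
proof -
  have "(\<lambda>n. cmod (X n $ 1 $ 1) + cmod (X n $ 2 $ 1)) \<longlonglongrightarrow> cmod (g $ 1 $ 1) + cmod (g $ 2 $ 1)"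
    by (intro tendsto_intros lim)
  then have "Bseq (\<lambda>n. cmod (X n $ 1 $ 1) + cmod (X n $ 2 $ 1))"
    using convergent_def convergent_imp_Bseq by blast
  then obtain K where K: "\<And>n. norm (cmod (X n $ 1 $ 1) + cmod (X n $ 2 $ 1)) \<le> K"
    unfolding Bseq_def by blast
  have "cmod (jacobian_factor lam (X n) b) \<le> K" if b: "cmod b = 1" for n b
  proof -
    obtain a c where su: "X n = su a c" and d: "(cmod a)\<^sup>2 - (cmod c)\<^sup>2 = 1" using X by (rule carrierE)
    have lt: "cmod c < cmod a" by (rule cmod_less_of_det[OF d])
    have "cmod a - cmod c \<le> cmod (a - cnj c * b)"
      using norm_triangle_ineq2[of a "cnj c * b"] b by (simp add: norm_mult)
    then have "1 / cmod (a - cnj c * b) \<le> 1 / (cmod a - cmod c)" using lt by (intro frac_le) auto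
    also have "\<dots> = cmod a + cmod c"
      using d lt by (simp add: field_simps power2_eq_square)
    finally show ?thesis using K[of n] by (simp add: cmod_jacobian_factor su)
  qed
  then show ?thesis by blast
qed

lemma fundamental_series_continuous_test_function:
  assumes X: "\<And>n. X n \<in> carrier SU11" and g: "g \<in> carrier SU11" and lim: "X \<longlonglongrightarrow> g"
    and h: "continuous_on UNIV h"
  shows "(\<lambda>n. normsq (\<lambda>b. fundamental_series lam (X n) h b - fundamental_series lam g h b)) \<longlonglongrightarrow> 0"
proof -
  have "compact (h ` sphere 0 1)"
    by (intro compact_continuous_image continuous_on_subset[OF h]) auto
  then obtain M where M: "\<And>b. b \<in> sphere 0 1 \<Longrightarrow> cmod (h b) \<le> M"
    using compact_imp_bounded bounded_iff by (metis imageI)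
  then have M0: "M \<ge> 0" using order_trans[OF norm_ge_zero, of "h 1"] by auto
  obtain K where K: "\<And>n b. cmod b = 1 \<Longrightarrow> cmod (jacobian_factor lam (X n) b) \<le> K"
    using carrier_sequence_bound[OF X lim] by blast
  obtain K' where K': "\<And>b. cmod b = 1 \<Longrightarrow> cmod (jacobian_factor lam g b) \<le> K'"
    using carrier_sequence_bound[of "\<lambda>_. g" g lam] g by auto
  have bound: "cmod (fundamental_series lam x h b) \<le> L * M"
    if x: "x \<in> carrier SU11" and L: "cmod (jacobian_factor lam x b) \<le> L" and b: "cmod b = 1" for x L b
  proof -
    obtain a c where su: "x = su a c" and d: "(cmod a)\<^sup>2 - (cmod c)\<^sup>2 = 1" using x by (rule carrierE)
    have "cmod (moebius (su (cnj a) (- c)) b) = 1" by (rule moebius_circle) (use d b in auto)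
    then have "cmod (h (moebius (su (cnj a) (- c)) b)) \<le> M" by (intro M) simp
    then show ?thesis unfolding su fundamental_series_su[OF d] norm_mult
      using L[unfolded su] M0 by (intro mult_mono order_trans[OF norm_ge_zero L[unfolded su]]) auto
  qed
  have hm: "h \<in> borel_measurable borel" using h by (rule borel_measurable_continuous_onI)
  show ?thesis
  proof (rule normsq_dominated[where g="\<lambda>_. K * M + K' * M"])
    show "cmod (fundamental_series lam (X n) h b - fundamental_series lam g h b) \<le> K * M + K' * M"
      if "cmod b = 1" for n b
      using norm_triangle_ineq4[of "fundamental_series lam (X n) h b" "fundamental_series lam g h b"]
        bound[OF X K[OF that] that, of n] bound[OF g K'[OF that] that] by linarith
    show "(\<lambda>n. fundamental_series lam (X n) h b) \<longlonglongrightarrow> fundamental_series lam g h b" if b: "cmod b = 1" for b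
    proof -
      have eq: "fundamental_series lam x h b = of_real (cmod (x $ 1 $ 1 - x $ 2 $ 1 * b)) powr (- 1 + 2 * \<i> * of_real lam)
          * h ((x $ 2 $ 2 * b - x $ 1 $ 2) / (x $ 1 $ 1 - x $ 2 $ 1 * b))" if x: "x \<in> carrier SU11" for x
      proof -
        obtain a c where su: "x = su a c" and d: "(cmod a)\<^sup>2 - (cmod c)\<^sup>2 = 1" using x by (rule carrierE)
        show ?thesis unfolding su fundamental_series_su[OF d] jacobian_factor_def moebius_su by simp
      qed
      have nz: "g $ 1 $ 1 - g $ 2 $ 1 * b \<noteq> 0"
      proof -
        obtain a c where su: "g = su a c" and d: "(cmod a)\<^sup>2 - (cmod c)\<^sup>2 = 1" using g by (rule carrierE)
        then show ?thesis using moebius_denom_nonzero[of "cnj a" "- c" b] b by simp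
      qed
      have e: "(\<lambda>n. X n $ i $ j) \<longlonglongrightarrow> g $ i $ j" for i j by (intro tendsto_vec_nth lim)
      have num: "(\<lambda>n. X n $ 2 $ 2 * b - X n $ 1 $ 2) \<longlonglongrightarrow> g $ 2 $ 2 * b - g $ 1 $ 2"
        and den: "(\<lambda>n. X n $ 1 $ 1 - X n $ 2 $ 1 * b) \<longlonglongrightarrow> g $ 1 $ 1 - g $ 2 $ 1 * b"
        by (intro tendsto_diff tendsto_mult e tendsto_const)+
      have quot: "(\<lambda>n. (X n $ 2 $ 2 * b - X n $ 1 $ 2) / (X n $ 1 $ 1 - X n $ 2 $ 1 * b))
        \<longlonglongrightarrow> (g $ 2 $ 2 * b - g $ 1 $ 2) / (g $ 1 $ 1 - g $ 2 $ 1 * b)"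
        by (rule tendsto_divide[OF num den nz])
      have "(\<lambda>n. h ((X n $ 2 $ 2 * b - X n $ 1 $ 2) / (X n $ 1 $ 1 - X n $ 2 $ 1 * b)))
        \<longlonglongrightarrow> h ((g $ 2 $ 2 * b - g $ 1 $ 2) / (g $ 1 $ 1 - g $ 2 $ 1 * b))"
        by (rule continuous_on_tendsto_compose[OF h quot]) auto
      moreover have "(\<lambda>n. of_real (cmod (X n $ 1 $ 1 - X n $ 2 $ 1 * b)) powr (- 1 + 2 * \<i> * complex_of_real lam))
        \<longlonglongrightarrow> of_real (cmod (g $ 1 $ 1 - g $ 2 $ 1 * b)) powr (- 1 + 2 * \<i> * of_real lam)"
      proof (rule tendsto_powr_complex)
        show "complex_of_real (cmod (g $ 1 $ 1 - g $ 2 $ 1 * b)) \<notin> \<real>\<^sub>\<le>\<^sub>0"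
          using nz by (simp only: nonpos_Reals_of_real_iff not_le zero_less_norm_iff not_False_eq_True)
        show "(\<lambda>n. complex_of_real (cmod (X n $ 1 $ 1 - X n $ 2 $ 1 * b)))
          \<longlonglongrightarrow> complex_of_real (cmod (g $ 1 $ 1 - g $ 2 $ 1 * b))"
          by (intro tendsto_of_real tendsto_norm den)
      qed (rule tendsto_const)
      ultimately show ?thesis unfolding eq[OF X] eq[OF g] by (intro tendsto_mult)
    qed
  qed (use fundamental_series_measurable[OF hm] in auto)
qed

lemma fundamental_series_diff:
  "fundamental_series lam g (\<lambda>b. f b - h b) = (\<lambda>b. fundamental_series lam g f b - fundamental_series lam g h b)"
  by (simp add: fun_eq_iff fundamental_series_def right_diff_distrib)

text \<open>Approximation by a continuous function h: since all operators preserve the norm, f may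
  be replaced by h with an error independent of the group element.\<close>

lemma fundamental_series_strongly_continuous:
  assumes g: "g \<in> carrier SU11" and f: "f \<in> L2B"
  shows "((\<lambda>x. L2_norm (\<lambda>b. fundamental_series lam x f b - fundamental_series lam g f b)) \<longlongrightarrow> 0) (at g within carrier SU11)"
  unfolding tendsto_at_iff_sequentially comp_def
proof (intro allI impI)
  fix X assume "\<forall>i. X i \<in> carrier SU11 - {g}" and lim: "X \<longlonglongrightarrow> g"
  then have X: "\<And>n. X n \<in> carrier SU11" by blast
  let ?T = "fundamental_series lam"
  have "(\<lambda>n. normsq (\<lambda>b. ?T (X n) f b - ?T g f b)) \<longlonglongrightarrow> 0"
  proof (rule LIMSEQ_I)
    fix e :: real assume e: "e > 0"
    \<comment> \<open>Two uses of the weak triangle inequality leave 2 + 4 + 4 = 10 sixteenths of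
      e.\<close>
    obtain h where h: "continuous_on UNIV h" "normsq (\<lambda>b. f b - h b) < e / 16"
      by (rule approximableD[OF L2B_approximable[OF f], of "e / 16"]) (use e in auto)
    have hL: "h \<in> L2B" by (rule continuous_imp_L2B[OF h(1)])
    obtain N where N: "\<And>n. n \<ge> N \<Longrightarrow> normsq (\<lambda>b. ?T (X n) h b - ?T g h b) < e / 16"
      using order_tendstoD(2)[OF fundamental_series_continuous_test_function[OF X g lim h(1), of lam], of "e / 16"] e
      unfolding eventually_sequentially by auto
    have "norm (normsq (\<lambda>b. ?T (X n) f b - ?T g f b) - 0) < e" if n: "n \<ge> N" for n
    proof -
      note L2 = fundamental_series_L2(1)[OF X f] fundamental_series_L2(1)[OF X hL]
        fundamental_series_L2(1)[OF g f] fundamental_series_L2(1)[OF g hL]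
      have fh: "normsq (\<lambda>b. ?T x f b - ?T x h b) < e / 16" if "x \<in> carrier SU11" for x
        using fundamental_series_L2(2)[OF that L2B_diff[OF f hL], of lam] h(2)
        by (simp add: fundamental_series_diff)
      have "normsq (\<lambda>b. ?T (X n) f b - ?T g f b)
         \<le> 2 * normsq (\<lambda>b. ?T (X n) f b - ?T (X n) h b) + 2 * normsq (\<lambda>b. ?T (X n) h b - ?T g f b)"
        by (intro normsq_triangle L2)
      also have "normsq (\<lambda>b. ?T (X n) h b - ?T g f b)
         \<le> 2 * normsq (\<lambda>b. ?T (X n) h b - ?T g h b) + 2 * normsq (\<lambda>b. ?T g h b - ?T g f b)"
        by (intro normsq_triangle L2)
      finally have "normsq (\<lambda>b. ?T (X n) f b - ?T g f b) < e"
        using fh[OF X, of n] fh[OF g] N[OF n] e normsq_minus_commute[of "?T g h" "?T g f"] by simp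
      then show ?thesis using normsq_nonneg by simp
    qed
    then show "\<exists>no. \<forall>n\<ge>no. norm (normsq (\<lambda>b. ?T (X n) f b - ?T g f b) - 0) < e" by blast
  qed
  from tendsto_real_sqrt[OF this]
  show "(\<lambda>n. L2_norm (\<lambda>b. ?T (X n) f b - ?T g f b)) \<longlonglongrightarrow> 0" by (simp add: L2_norm_eq)
qed

lemma unitary_rep_fundamental_series: "unitary_rep SU11 (fundamental_series lam)"
proof -
  have one: "fundamental_series lam (mat 1) f b = f b" for f b
    using fundamental_series_su[of 1 0 lam f b] by (simp add: su_one moebius_su jacobian_factor_def)
  have "AE b in bmeasure. fundamental_series lam (g ** h) f b = fundamental_series lam g (fundamental_series lam h f) b"
    if "g \<in> carrier SU11" "h \<in> carrier SU11" for g h f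
    using AE_bmeasure by eventually_elim (rule fundamental_series_mult[OF that])
  moreover have "fundamental_series lam g (\<lambda>b. \<alpha> * f b + \<beta> * h b) = (\<lambda>b. \<alpha> * fundamental_series lam g f b + \<beta> * fundamental_series lam g h b)"
    for g \<alpha> f \<beta> h by (simp add: fun_eq_iff fundamental_series_def algebra_simps)
  ultimately show ?thesis
    unfolding unitary_rep_def L2_eq_def
    using group_SU11 fundamental_series_L2(1) fundamental_series_inner fundamental_series_strongly_continuous
    by (auto simp: one)
qed

section \<open>The conical function as a spherical function\<close>

text \<open>The stabilizer of 0 consists of the diagonal matrices with |a| = 1, whose Jacobian is 1,
  so they fix the constant 1. For general g the Jacobian is P(g 0, b), and the matrix coefficient
  becomes the circle mean for z = g 0.\<close>

lemma spherical_function_fundamental_series: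
  "spherical_function (fundamental_series lam)
     (\<lambda>g. legendre_P (- 1 / 2 + \<i> * complex_of_real lam)
                    (complex_of_real (cosh (hyp_dist0 (SU11_action g 0)))))"
  unfolding spherical_function_def
proof (intro bexI conjI ballI)
  show "(\<lambda>_. 1) \<in> L2B" by (rule L2B_bounded[of _ 1]) auto
  show "L2_norm (\<lambda>_. 1) = 1" using bmeasure.prob_space by (simp add: L2_norm_def)
next
  fix k assume "k \<in> stabilizer SU11 SU11_action 0"
  then have k: "k \<in> carrier SU11" "SU11_action k 0 = 0" by (auto simp: stabilizer_def)
  obtain a c where su: "k = su a c" and d: "(cmod a)\<^sup>2 - (cmod c)\<^sup>2 = 1" using k(1) by (rule carrierE)
  have "a \<noteq> 0" using cmod_less_of_det[OF d] by auto
  then have "c = 0" using k(2) by (simp add: SU11_action_def su moebius_su)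
  then have "cmod a = 1" using d by (metis diff_zero norm_ge_zero norm_zero one_power2 power2_eq_imp_eq zero_eq_power2 zero_le_one)
  then have "fundamental_series lam k (\<lambda>_. 1) b = 1" for b
    unfolding su fundamental_series_su[OF d] using \<open>c = 0\<close> by (simp add: jacobian_factor_def)
  then show "L2_eq (fundamental_series lam k (\<lambda>_. 1)) (\<lambda>_. 1)" by (simp add: L2_eq_def)
next
  fix g assume "g \<in> carrier SU11"
  then obtain a c where su: "g = su a c" and d: "(cmod a)\<^sup>2 - (cmod c)\<^sup>2 = 1" by (rule carrierE)
  define z where "z = c / cnj a"
  have a0: "a \<noteq> 0" using cmod_less_of_det[OF d] by auto
  have z: "SU11_action g 0 = z" by (simp add: SU11_action_def su moebius_su z_def)
  have z1: "cmod z < 1" using cmod_less_of_det[OF d] a0 by (simp add: z_def norm_divide)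
  define r where "r = hyp_dist0 z"
  have r0: "r \<ge> 0" unfolding r_def hyp_dist0_def using z1 by (intro ln_ge_zero) (simp add: field_simps)
  have "exp r = (1 + cmod z) / (1 - cmod z)"
    unfolding r_def hyp_dist0_def using z1 norm_ge_zero[of z]
    by (intro exp_ln divide_pos_pos) linarith+
  moreover have "tanh (r / 2) = (exp r - 1) / (exp r + 1)"
  proof -
    have "1 - exp (- r) = (exp r - 1) / exp r" "1 + exp (- r) = (exp r + 1) / exp r"
      by (simp_all add: exp_minus field_simps)
    then show ?thesis by (simp add: tanh_real_altdef)
  qed
  moreover have "exp r + 1 > 0" by (simp add: add_pos_pos)
  ultimately have "cmod z * (exp r + 1) = exp r - 1" using z1 by (simp add: field_simps)
  with \<open>exp r + 1 > 0\<close> have "cmod z = (exp r - 1) / (exp r + 1)" by (intro nonzero_eq_divide_eq[THEN iffD2]) auto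
  with \<open>tanh (r / 2) = (exp r - 1) / (exp r + 1)\<close> have t: "cmod z = tanh (r / 2)" by simp
  \<comment> \<open>Chosen so that the Legendre index is s - 1; the exponent of the Poisson kernel
    is then 1 - s = 1/2 - \<i> lam.\<close>
  define s where "s = 1 / 2 + \<i> * complex_of_real lam"
  have "legendre_P (- 1 / 2 + \<i> * complex_of_real lam) (complex_of_real (cosh r))
      = (LINT b|bmeasure. complex_of_real (poisson z b) powr (1 - s))"
    using legendre_P_eq_integral[OF r0 t, of s] by (simp add: s_def)
  also have "\<dots> = (LINT b|bmeasure. fundamental_series lam g (\<lambda>_. 1) b * cnj 1)"
  proof (rule integral_cong_AE)
    show "AE b in bmeasure. complex_of_real (poisson z b) powr (1 - s) = fundamental_series lam g (\<lambda>_. 1) b * cnj 1"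
      using AE_bmeasure
    proof eventually_elim
      case (elim b)
      have nz: "a - cnj c * b \<noteq> 0" using moebius_denom_nonzero[of "cnj a" "- c" b] d elim by simp
      have "cmod (a - cnj c * b) = cmod (cnj b * (a - cnj c * b))" using elim by (simp add: norm_mult)
      also have "cnj b * (a - cnj c * b) = cnj b * a - cnj c"
        using unit_mult_cnj[OF elim] by (simp add: algebra_simps)
      also have "cmod \<dots> = cmod (cnj (cnj b * a - cnj c))" by (simp only: complex_mod_cnj)
      also have "cnj (cnj b * a - cnj c) = - (cnj a * (z - b))" using a0 by (simp add: z_def algebra_simps)
      finally have n: "cmod (a - cnj c * b) = cmod a * cmod (z - b)" by (simp add: norm_mult)
      have "1 - (cmod z)\<^sup>2 = 1 / (cmod a)\<^sup>2"
      proof -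
        have "(cmod a)\<^sup>2 \<noteq> 0" using a0 by simp
        then have "1 - (cmod c)\<^sup>2 / (cmod a)\<^sup>2 = ((cmod a)\<^sup>2 - (cmod c)\<^sup>2) / (cmod a)\<^sup>2"
          by (simp add: diff_divide_distrib)
        then show ?thesis unfolding d by (simp add: z_def norm_divide power_divide)
      qed
      then have "poisson z b = 1 / (cmod (a - cnj c * b))\<^sup>2"
        unfolding poisson_eq[OF elim] n by (simp add: power_mult_distrib)
      moreover have "ln (1 / (cmod (a - cnj c * b))\<^sup>2) = - 2 * ln (cmod (a - cnj c * b))"
        using nz by (simp add: ln_div ln_realpow)
      ultimately have "Ln (complex_of_real (poisson z b)) = of_real (- 2 * ln (cmod (a - cnj c * b)))"
        using nz by (subst Ln_of_real) simp_all
      moreover have "poisson z b \<noteq> 0" using poisson_pos[of z b] z1 elim by simp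
      ultimately have "complex_of_real (poisson z b) powr (1 - s)
          = exp ((1 - s) * of_real (- 2 * ln (cmod (a - cnj c * b))))"
        by (simp only: powr_def of_real_eq_0_iff if_False)
      also have "(1 - s) * of_real (- 2 * ln (cmod (a - cnj c * b)))
          = (- 1 + 2 * \<i> * of_real lam) * of_real (ln (cmod (a - cnj c * b)))"
        by (simp add: s_def field_simps)
      also have "exp \<dots> = jacobian_factor lam (su a c) b"
        using nz by (simp add: jacobian_factor_def powr_def Ln_of_real)
      finally show ?case by (simp add: su fundamental_series_su[OF d])
    qed
    show "(\<lambda>b. fundamental_series lam g (\<lambda>_. 1) b * cnj 1) \<in> borel_measurable bmeasure"
      using fundamental_series_measurable[of "\<lambda>_. 1" lam g] by simp
  qed measurable
  finally show "legendre_P (- 1 / 2 + \<i> * complex_of_real lam) (complex_of_real (cosh (hyp_dist0 (SU11_action g 0))))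
      = L2_inner (fundamental_series lam g (\<lambda>_. 1)) (\<lambda>_. 1)"
    by (simp add: L2_inner_def z r_def)
qed

section \<open>Irreducibility\<close>

definition fourier :: "(complex \<Rightarrow> complex) \<Rightarrow> int \<Rightarrow> complex" where
  "fourier f n = (LINT b|bmeasure. f b * b powi (- n))"

lemma L2B_integrable_mult_power_int:
  assumes f: "f \<in> L2B"
  shows "integrable bmeasure (\<lambda>b. f b * b powi n)"
proof -
  note [measurable] = L2B_measurable[OF f]
  have "integrable bmeasure (\<lambda>b. 1 + (cmod (f b))\<^sup>2)" using L2B_integrable[OF f] by simp
  then show ?thesis
  proof (rule Bochner_Integration.integrable_bound)
    show "AE b in bmeasure. norm (f b * b powi n) \<le> norm (1 + (cmod (f b))\<^sup>2)"
      using AE_bmeasure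
    proof eventually_elim
      case (elim b)
      have "0 \<le> (cmod (f b) - 1)\<^sup>2" by simp
      then have "2 * cmod (f b) \<le> 1 + (cmod (f b))\<^sup>2" by (simp add: power2_diff)
      then have "cmod (f b) \<le> 1 + (cmod (f b))\<^sup>2" using norm_ge_zero[of "f b"] by linarith
      then show ?case using elim by (simp add: norm_mult norm_power_int)
    qed
  qed measurable
qed

lemma fourier_lincomb:
  assumes "f \<in> L2B" "h \<in> L2B"
  shows "fourier (\<lambda>b. \<alpha> * f b + \<beta> * h b) n = \<alpha> * fourier f n + \<beta> * fourier h n"
  using L2B_integrable_mult_power_int[OF assms(1)] L2B_integrable_mult_power_int[OF assms(2)]
  by (simp add: fourier_def distrib_right mult.assoc)

lemma fourier_power_int: "fourier (\<lambda>b. b powi m) n = (if m = n then 1 else 0)"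
proof -
  have "fourier (\<lambda>b. b powi m) n = (LINT b|bmeasure. b powi (m - n))"
    unfolding fourier_def
  proof (rule integral_cong_AE)
    show "AE b in bmeasure. b powi m * b powi (- n) = b powi (m - n)"
      using AE_bmeasure
    proof eventually_elim
      case (elim b)
      then have "b \<noteq> 0" by auto
      then show ?case by (simp add: power_int_diff power_int_minus divide_inverse)
    qed
  qed simp_all
  then show ?thesis by (simp add: integral_bmeasure_power_int)
qed

text \<open>For a probability measure this Cauchy-Schwarz inequality says that the variance of |f|
  is nonnegative.\<close>

lemma cmod_integral_square_le:
  assumes "integrable bmeasure f" "integrable bmeasure (\<lambda>b. (cmod (f b))\<^sup>2)"
  shows "(cmod (LINT b|bmeasure. f b))\<^sup>2 \<le> (LINT b|bmeasure. (cmod (f b))\<^sup>2)"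
proof -
  have i: "integrable bmeasure (\<lambda>b. cmod (f b))" using assms(1) by simp
  have "(cmod (LINT b|bmeasure. f b))\<^sup>2 \<le> (LINT b|bmeasure. cmod (f b))\<^sup>2"
    by (intro power_mono integral_norm_bound) simp
  also have "\<dots> \<le> (LINT b|bmeasure. (cmod (f b))\<^sup>2)"
    using bmeasure.variance_eq[OF i assms(2)] bmeasure.variance_positive[of "\<lambda>b. cmod (f b)"] by simp
  finally show ?thesis .
qed

lemma cmod_fourier_le:
  assumes f: "f \<in> L2B"
  shows "(cmod (fourier f n))\<^sup>2 \<le> normsq f"
proof -
  note [measurable] = L2B_measurable[OF f]
  have ae: "AE b in bmeasure. (cmod (f b * b powi (- n)))\<^sup>2 = (cmod (f b))\<^sup>2"
    using AE_bmeasure by eventually_elim (simp add: norm_mult norm_power_int)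
  have "integrable bmeasure (\<lambda>b. (cmod (f b * b powi (- n)))\<^sup>2)"
    using L2B_integrable[OF f] by (subst integrable_cong_AE[OF _ _ ae]) auto
  then have "(cmod (fourier f n))\<^sup>2 \<le> (LINT b|bmeasure. (cmod (f b * b powi (- n)))\<^sup>2)"
    unfolding fourier_def by (intro cmod_integral_square_le L2B_integrable_mult_power_int[OF f])
  also have "\<dots> = normsq f" unfolding normsq_def by (rule integral_cong_AE[OF _ _ ae]) auto
  finally show ?thesis .
qed

section \<open>Projection onto a Fourier mode by averaging\<close>

definition rotation_average :: "int \<Rightarrow> nat \<Rightarrow> (complex \<Rightarrow> complex) \<Rightarrow> complex \<Rightarrow> complex" where
  "rotation_average n N f b =
     (\<Sum>j<N. cis (2 * pi * real j / real N) powi n * f (cis (- (2 * pi * real j / real N)) * b)) / of_nat N"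

lemma rotation_average_lincomb:
  "rotation_average n N (\<lambda>b. \<alpha> * f b + \<beta> * h b) b = \<alpha> * rotation_average n N f b + \<beta> * rotation_average n N h b"
  unfolding rotation_average_def
  by (simp add: distrib_left sum.distrib sum_distrib_left add_divide_distrib mult.left_commute)

text \<open>The average is a geometric sum of powers of an N-th root of unity w, and w = 1 only if N
  divides n - m. The bound on N excludes this for m \<noteq> n, so the projection is exact; hence it
  is exact on a trigonometric polynomial for all large N.\<close>

lemma rotation_average_power_int:
  assumes N: "N > nat \<bar>n - m\<bar>"
  shows "rotation_average n N (\<lambda>b. b powi m) b = (if m = n then b powi n else 0)"
proof -
  define w where "w = cis (2 * pi / real N) powi (n - m)"
  have N0: "N > 0" using N by simp
  have summand: "cis (2 * pi * real j / real N) powi n * (cis (- (2 * pi * real j / real N)) * b) powi m = b powi m * w ^ j" for j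
  proof -
    have "cis (2 * pi * real j / real N) powi n * cis (- (2 * pi * real j / real N)) powi m
        = cis (of_int n * (2 * pi * real j / real N) - of_int m * (2 * pi * real j / real N))"
      by (simp add: cis_power_int cis_mult)
    also have "of_int n * (2 * pi * real j / real N) - of_int m * (2 * pi * real j / real N)
        = real j * (of_int (n - m) * (2 * pi / real N))"
      by (simp add: algebra_simps diff_divide_distrib)
    also have "cis \<dots> = w ^ j" unfolding w_def cis_power_int by (rule Complex.DeMoivre[symmetric])
    finally show ?thesis by (simp add: power_int_mult_distrib mult_ac)
  qed
  have avg: "rotation_average n N (\<lambda>b. b powi m) b = b powi m * (\<Sum>j<N. w ^ j) / of_nat N"
    unfolding rotation_average_def summand sum_distrib_left ..
  show ?thesis
  proof (cases "m = n")
    case True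
    then show ?thesis unfolding avg using N0 by (simp add: w_def)
  next
    case False
    have "w = cis (2 * pi * (real_of_int (n - m) / real N))"
      unfolding w_def cis_power_int by (simp add: field_simps)
    moreover have "cis (2 * pi * x) = 1 \<longleftrightarrow> x \<in> \<int>" for x
    proof -
      have "cis (2 * pi * x) = 1 \<longleftrightarrow> cos (2 * pi * x) = 1"
        by (auto simp: complex_eq_iff intro: cos_one_sin_zero)
      also have "\<dots> \<longleftrightarrow> x \<in> \<int>" unfolding cos_one_2pi_int
        by (auto simp: Ints_def field_simps)
      finally show ?thesis .
    qed
    moreover have "real_of_int (n - m) / real N \<notin> \<int>"
    proof
      assume "real_of_int (n - m) / real N \<in> \<int>"
      then obtain k where "real_of_int (n - m) / real N = of_int k" by (auto elim: Ints_cases)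
      then have "real_of_int (n - m) = of_int (k * int N)" using N0 by (simp add: field_simps)
      then have k: "n - m = k * int N" by linarith
      then have "k \<noteq> 0" using False by auto
      then have "1 \<le> \<bar>k\<bar>" by linarith
      then have "int N \<le> \<bar>k\<bar> * int N" by (simp add: mult_le_cancel_right1)
      also have "\<dots> = \<bar>n - m\<bar>" by (simp add: k abs_mult)
      finally show False using N by linarith
    qed
    ultimately have w1: "w \<noteq> 1" by (simp only: simp_thms)
    have "w ^ N = 1"
    proof -
      have "w ^ N = cis (real N * (real_of_int (n - m) * (2 * pi / real N)))"
        unfolding w_def cis_power_int by (rule Complex.DeMoivre)
      also have "real N * (real_of_int (n - m) * (2 * pi / real N)) = 2 * pi * real_of_int (n - m)"
        using N0 by (simp add: field_simps)
      also have "cis \<dots> = 1" by (rule cis_multiple_2pi) simp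
      finally show ?thesis .
    qed
    then have "(\<Sum>j<N. w ^ j) = 0" using w1 by (simp add: geometric_sum)
    then show ?thesis using False by (simp add: avg)
  qed
qed

lemma rotation_average_trig_poly:
  assumes "trig_poly p"
  shows "\<exists>N0>0. \<forall>N\<ge>N0. \<forall>b. rotation_average n N p b = fourier p n * b powi n"
  using assms
proof induction
  case (monom m)
  show ?case
    by (intro exI[of _ "Suc (nat \<bar>n - m\<bar>)"]) (auto simp: rotation_average_power_int fourier_power_int)
next
  case (lincomb f h \<alpha> \<beta>)
  then obtain N1 N2 where "N1 > 0" "\<forall>N\<ge>N1. \<forall>b. rotation_average n N f b = fourier f n * b powi n"
    "N2 > 0" "\<forall>N\<ge>N2. \<forall>b. rotation_average n N h b = fourier h n * b powi n" by blast
  then show ?case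
    using lincomb.hyps
    by (intro exI[of _ "max N1 N2"])
      (auto simp: rotation_average_lincomb fourier_lincomb trig_poly_L2B algebra_simps)
qed

lemma rotation_L2:
  assumes f: "f \<in> L2B" and u: "cmod u = 1"
  shows "(\<lambda>b. f (u * b)) \<in> L2B" and "normsq (\<lambda>b. f (u * b)) = normsq f"
proof -
  note [measurable] = L2B_measurable[OF f]
  show "normsq (\<lambda>b. f (u * b)) = normsq f"
    unfolding normsq_def using integral_bmeasure_rotation[of "\<lambda>b. (cmod (f b))\<^sup>2" u] u by simp
  have "integrable (distr bmeasure borel (\<lambda>b. u * b)) (\<lambda>b. (cmod (f b))\<^sup>2)"
    using L2B_integrable[OF f] distr_rotation_bmeasure[OF u] by simp
  then have "integrable bmeasure (\<lambda>b. (cmod (f (u * b)))\<^sup>2)"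
    by (subst (asm) integrable_distr_eq) auto
  then show "(\<lambda>b. f (u * b)) \<in> L2B" by (simp add: L2B_def)
qed

text \<open>The averages are contractions, uniformly in N: the rotates all have the norm of f, and
  Cauchy-Schwarz bounds the squared modulus of a mean by the mean of the squared moduli.\<close>

lemma rotation_average_L2:
  assumes f: "f \<in> L2B" and N: "N > 0"
  shows "rotation_average n N f \<in> L2B" and "normsq (rotation_average n N f) \<le> normsq f"
proof -
  let ?u = "\<lambda>j. cis (2 * pi * real j / real N) powi n"
  let ?g = "\<lambda>j b. f (cis (- (2 * pi * real j / real N)) * b)"
  have g: "?g j \<in> L2B" "normsq (?g j) = normsq f" for j by (rule rotation_L2[OF f]; simp)+
  note [measurable] = L2B_measurable[OF f] L2B_measurable[OF g(1)]
  have sq: "(cmod (rotation_average n N f b))\<^sup>2 \<le> (\<Sum>j<N. (cmod (?g j b))\<^sup>2) / real N" for b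
  proof -
    have "cmod (rotation_average n N f b) \<le> (\<Sum>j<N. cmod (?g j b)) / real N"
      unfolding rotation_average_def norm_divide norm_of_nat
      by (intro divide_right_mono order_trans[OF norm_sum] sum_mono) (auto simp: norm_mult norm_power_int)
    then have "(cmod (rotation_average n N f b))\<^sup>2 \<le> ((\<Sum>j<N. cmod (?g j b)) / real N)\<^sup>2"
      by (intro power_mono) auto
    also have "\<dots> \<le> (real N * (\<Sum>j<N. (cmod (?g j b))\<^sup>2)) / (real N)\<^sup>2"
      unfolding power_divide using sum_squared_le_sum_of_squares[of "\<lambda>j. cmod (?g j b)" "{..<N}"]
      by (intro divide_right_mono) (auto simp: mult.commute)
    also have "\<dots> = (\<Sum>j<N. (cmod (?g j b))\<^sup>2) / real N" using N by (simp add: power2_eq_square)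
    finally show ?thesis .
  qed
  have i: "integrable bmeasure (\<lambda>b. (\<Sum>j<N. (cmod (?g j b))\<^sup>2) / real N)"
    using L2B_integrable[OF g(1)] by simp
  have m [measurable]: "rotation_average n N f \<in> borel_measurable borel"
    unfolding rotation_average_def[abs_def] by measurable
  have i2: "integrable bmeasure (\<lambda>b. (cmod (rotation_average n N f b))\<^sup>2)"
    by (rule Bochner_Integration.integrable_bound[OF i]) (use order_trans[OF sq abs_ge_self] in auto)
  then show "rotation_average n N f \<in> L2B" using m by (simp add: L2B_def)
  have "normsq (rotation_average n N f) \<le> (LINT b|bmeasure. (\<Sum>j<N. (cmod (?g j b))\<^sup>2) / real N)"
    unfolding normsq_def by (rule integral_mono[OF i2 i sq])
  also have "\<dots> = (\<Sum>j<N. normsq (?g j)) / real N"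
    using L2B_integrable[OF g(1)] by (simp add: normsq_def)
  also have "\<dots> = normsq f" unfolding g(2) using N by simp
  finally show "normsq (rotation_average n N f) \<le> normsq f" .
qed

text \<open>The averages and the map to the n-th mode are contractions that agree on a given
  trigonometric polynomial once N is large, so density carries the limit over to f. The shift to
  \<open>Suc N\<close> avoids the empty average.\<close>

lemma rotation_average_tendsto:
  assumes f: "f \<in> L2B"
  shows "(\<lambda>N. normsq (\<lambda>b. rotation_average n (Suc N) f b - fourier f n * b powi n)) \<longlonglongrightarrow> 0"
proof (rule LIMSEQ_I)
  fix e :: real assume e: "e > 0"
  obtain p where p: "trig_poly p" "normsq (\<lambda>b. f b - p b) < e / 8"
    using trig_poly_dense[OF f, of "e / 8"] e by auto
  have pL: "p \<in> L2B" by (rule trig_poly_L2B[OF p(1)])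
  obtain N0 where N0: "\<And>N b. N \<ge> N0 \<Longrightarrow> rotation_average n N p b = fourier p n * b powi n"
    using rotation_average_trig_poly[OF p(1)] by blast
  have "norm (normsq (\<lambda>b. rotation_average n (Suc N) f b - fourier f n * b powi n) - 0) < e" if N: "N \<ge> N0" for N
  proof -
    let ?A = "rotation_average n (Suc N)"
    have d: "(\<lambda>b. f b - p b) \<in> L2B" by (rule L2B_diff[OF f pL])
    have A: "?A (\<lambda>b. f b - p b) b = ?A f b - fourier p n * b powi n" for b
      using rotation_average_lincomb[of n "Suc N" 1 f "-1" p b] N0[of "Suc N" b] N by simp
    have "fourier (\<lambda>b. f b - p b) n = fourier f n - fourier p n"
      using fourier_lincomb[OF f pL, of 1 "-1" n] by simp
    then have "normsq (\<lambda>b. fourier p n * b powi n - fourier f n * b powi n)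
        = normsq (\<lambda>b. - fourier (\<lambda>b. f b - p b) n * b powi n)" by (simp add: left_diff_distrib)
    also have "\<dots> = (cmod (fourier (\<lambda>b. f b - p b) n))\<^sup>2 * normsq (\<lambda>b. b powi n)" by (simp only: normsq_cmult norm_minus_cancel)
    also have "\<dots> \<le> normsq (\<lambda>b. f b - p b) * 1\<^sup>2"
      by (intro mult_mono cmod_fourier_le d normsq_bounded normsq_nonneg) (auto simp: norm_power_int)
    finally have 1: "normsq (\<lambda>b. fourier p n * b powi n - fourier f n * b powi n) < e / 8" using p(2) by simp
    have "normsq (\<lambda>b. ?A f b - fourier p n * b powi n) = normsq (?A (\<lambda>b. f b - p b))"
      unfolding A[symmetric] ..
    also have "\<dots> \<le> normsq (\<lambda>b. f b - p b)" by (rule rotation_average_L2(2)[OF d]) simp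
    finally have 2: "normsq (\<lambda>b. ?A f b - fourier p n * b powi n) < e / 8" using p(2) by simp
    have "normsq (\<lambda>b. ?A f b - fourier f n * b powi n)
       \<le> 2 * normsq (\<lambda>b. ?A f b - fourier p n * b powi n)
         + 2 * normsq (\<lambda>b. fourier p n * b powi n - fourier f n * b powi n)"
      by (intro normsq_triangle rotation_average_L2 f L2B_cmult power_int_L2B) simp
    then show ?thesis using 1 2 e normsq_nonneg by simp
  qed
  then show "\<exists>no. \<forall>N\<ge>no. norm (normsq (\<lambda>b. rotation_average n (Suc N) f b - fourier f n * b powi n) - 0) < e"
    by blast
qed

text \<open>Such an f is orthogonal to every trigonometric polynomial p, so f - p is never shorter
  than f; density then forces the norm of f to be 0.\<close>

lemma fourier_eq_0_imp:
  assumes f: "f \<in> L2B" and z: "\<And>n. fourier f n = 0"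
  shows "f \<in> L2_null"
proof -
  note [measurable] = L2B_measurable[OF f]
  have int: "integrable bmeasure (\<lambda>b. f b * cnj (p b)) \<and> (LINT b|bmeasure. f b * cnj (p b)) = 0" if "trig_poly p" for p
    using that
  proof induction
    case (monom n)
    have ae: "AE b in bmeasure. f b * cnj (b powi n) = f b * b powi (- n)"
      using AE_bmeasure
    proof eventually_elim
      case (elim b)
      then have "cnj b = inverse b" using inverse_unique[OF unit_mult_cnj] by simp
      then show ?case by (simp add: power_int_def)
    qed
    have "integrable bmeasure (\<lambda>b. f b * cnj (b powi n))"
      using L2B_integrable_mult_power_int[OF f, of "- n"] by (subst integrable_cong_AE[OF _ _ ae]) auto
    moreover have "(LINT b|bmeasure. f b * cnj (b powi n)) = fourier f n"
      unfolding fourier_def by (rule integral_cong_AE[OF _ _ ae]) auto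
    ultimately show ?case using z by simp
  next
    case (lincomb p q \<alpha> \<beta>)
    have "(\<lambda>b. f b * cnj (\<alpha> * p b + \<beta> * q b)) = (\<lambda>b. cnj \<alpha> * (f b * cnj (p b)) + cnj \<beta> * (f b * cnj (q b)))"
      by (simp add: fun_eq_iff algebra_simps)
    then show ?case using lincomb.IH by simp
  qed
  have le: "normsq f \<le> normsq (\<lambda>b. f b - p b)" if p: "trig_poly p" for p
  proof -
    have pi: "integrable bmeasure (\<lambda>b. f b * cnj (p b))" "(LINT b|bmeasure. f b * cnj (p b)) = 0" using int[OF p] by auto
    have eq: "(cmod (f b - p b))\<^sup>2 = (cmod (f b))\<^sup>2 - 2 * Re (f b * cnj (p b)) + (cmod (p b))\<^sup>2" for b
      unfolding cmod_power2 by (simp add: power2_eq_square algebra_simps)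
    have "(LINT b|bmeasure. Re (f b * cnj (p b))) = Re (LINT b|bmeasure. f b * cnj (p b))"
      by (rule integral_Re[OF pi(1)])
    then have Re0: "(LINT b|bmeasure. Re (f b * cnj (p b))) = 0" using pi(2) by simp
    have Rei: "integrable bmeasure (\<lambda>b. Re (f b * cnj (p b)))" using integrable_Re[OF pi(1)] .
    have "normsq (\<lambda>b. f b - p b) = normsq f - 2 * (LINT b|bmeasure. Re (f b * cnj (p b))) + normsq p"
      unfolding normsq_def eq using L2B_integrable[OF f] L2B_integrable[OF trig_poly_L2B[OF p]] Rei by (simp del: times_complex.sel)
    then show ?thesis using Re0 normsq_nonneg[of p] by simp
  qed
  have "normsq f = 0"
  proof (rule ccontr)
    assume "normsq f \<noteq> 0"
    then have "normsq f > 0" using normsq_nonneg[of f] by simp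
    then obtain p where "trig_poly p" "normsq (\<lambda>b. f b - p b) < normsq f" using trig_poly_dense[OF f] by blast
    then show False using le by fastforce
  qed
  then have "AE b in bmeasure. (cmod (f b))\<^sup>2 = 0"
    unfolding normsq_def by (subst (asm) integral_nonneg_eq_0_iff_AE) (auto simp: L2B_integrable[OF f])
  then show ?thesis using f by (simp add: L2_null_def L2_eq_def)
qed

section \<open>Boosts acting on Fourier modes\<close>

text \<open>The integral is q times a power series in q * q with constant term \<alpha>. If it
  vanished for all q in (0, 1), the series would vanish along a sequence tending to 0, and so would
  its constant term.\<close>

lemma exists_integral_binomial_nonzero:
  assumes a: "\<alpha> \<noteq> 0"
  shows "\<exists>q>0. q < 1 \<and> (LINT b|bmeasure. (1 - of_real q * b) powr (- \<alpha>) * (1 - of_real q * cnj b) powr (- \<beta>) * cnj b) \<noteq> 0"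
proof (rule ccontr)
  assume "\<not> ?thesis"
  then have z: "(LINT b|bmeasure. (1 - of_real q * b) powr (- \<alpha>) * (1 - of_real q * cnj b) powr (- \<beta>) * cnj b) = 0"
    if "0 < q" "q < 1" for q using that by blast
  define c where "c k = binom_coeff \<beta> k * binom_coeff \<alpha> (k + 1)" for k
  have sums0: "(\<lambda>k. c k * complex_of_real (q\<^sup>2) ^ k) sums 0" if q: "0 < q" "q < 1" for q
  proof -
    have "(\<lambda>k. c k * of_real q ^ (2 * k + 1)) sums 0"
      using integral_binomial_binomial[of q \<beta> \<alpha> 1] z[OF q] q by (simp add: c_def)
    then have "(\<lambda>k. c k * of_real q ^ (2 * k + 1) * inverse (of_real q)) sums (0 * inverse (of_real q))"
      by (rule sums_mult2)
    moreover have "c k * of_real q ^ (2 * k + 1) * inverse (of_real q) = c k * complex_of_real (q\<^sup>2) ^ k" for k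
      using q by (simp add: power_mult)
    ultimately show ?thesis by (simp only: mult_zero_left)
  qed
  define f where "f x = (\<Sum>k. c k * x ^ k)" for x
  have "(f \<longlongrightarrow> c 0) (at 0)"
  proof (rule powser_limit_0)
    show "(\<lambda>k. c k * x ^ k) sums f x" if "norm x < 1 / 4" for x
    proof -
      have "summable (\<lambda>k. c k * complex_of_real ((1 / 2)\<^sup>2) ^ k)" by (rule sums_summable[OF sums0]) auto
      then have "summable (\<lambda>k. c k * x ^ k)"
        by (rule powser_inside) (use that in \<open>simp add: power2_eq_square norm_divide\<close>)
      then show ?thesis unfolding f_def by (rule summable_sums)
    qed
  qed simp
  \<comment> \<open>Squares of q = 1 / (n + 2); the offset 2 keeps q strictly between 0 and
    1.\<close>
  moreover define X where "X n = complex_of_real ((1 / real (n + 2))\<^sup>2)" for n :: nat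
  have "X n \<in> UNIV - {0}" for n by (simp add: X_def del: of_real_power of_real_divide)
  moreover have "X \<longlonglongrightarrow> 0"
  proof -
    have "(\<lambda>n. 1 / real (n + 2)) \<longlonglongrightarrow> 0" using LIMSEQ_ignore_initial_segment[OF lim_1_over_n, of 2] by simp
    from tendsto_power[OF this, of 2] have "(\<lambda>n. (1 / real (n + 2))\<^sup>2) \<longlonglongrightarrow> 0" by simp
    then have "(\<lambda>n. complex_of_real ((1 / real (n + 2))\<^sup>2)) \<longlonglongrightarrow> complex_of_real 0" by (rule tendsto_of_real)
    then show ?thesis unfolding X_def[abs_def] by (simp only: of_real_0)
  qed
  ultimately have "(f \<circ> X) \<longlonglongrightarrow> c 0" unfolding tendsto_at_iff_sequentially by blast
  moreover have "(f \<circ> X) = (\<lambda>_. 0)"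
    using sums_unique[OF sums0, symmetric] by (simp add: fun_eq_iff f_def X_def del: of_real_power of_real_divide)
  ultimately have "c 0 = 0" by (metis LIMSEQ_unique tendsto_const)
  then show False using a by (simp add: c_def binom_coeff_def)
qed

lemma powr_minus_times_power_int:
  fixes w :: complex
  assumes "w \<noteq> 0"
  shows "w powr (- s) * w powi n = w powr (- (s - of_int n))"
proof -
  have "w powi n = w powr of_int n" using assms by (simp add: complex_powr_of_int)
  then show ?thesis using assms by (simp add: powr_add[symmetric])
qed

text \<open>The boost takes 0 to q. With w = 1 - q b its inverse sends b to b cnj w / w and its
  Jacobian factor is a constant times w powr (-s) * cnj w powr (-s), so the n-th power merely shifts
  the two exponents in opposite directions.\<close>

lemma fundamental_series_boost:
  fixes q lam :: real
  assumes q: "0 < q" "q < 1"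
  defines "t \<equiv> 1 / sqrt (1 - q\<^sup>2)" and "s \<equiv> 1 / 2 - \<i> * complex_of_real lam"
  assumes b: "cmod b = 1"
  shows "su (of_real t) (of_real (q * t)) \<in> carrier SU11"
    and "fundamental_series lam (su (of_real t) (of_real (q * t))) (\<lambda>b. b powi n) b
      = of_real t powr (- 1 + 2 * \<i> * of_real lam) * ((1 - of_real q * b) powr (- (s + of_int n))
         * (1 - of_real q * cnj b) powr (- (s - of_int n)) * b powi n)"
proof -
  have q1: "1 - q\<^sup>2 > 0" using q by (simp add: power_less_one_iff)
  have t: "t > 0" "t\<^sup>2 * (1 - q\<^sup>2) = 1" using q1 by (simp_all add: t_def power_divide)
  have d: "(cmod (of_real t))\<^sup>2 - (cmod (of_real (q * t)))\<^sup>2 = 1"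
    using t(2) unfolding norm_of_real power2_abs by (simp add: power_mult_distrib algebra_simps)
  then show "su (of_real t) (of_real (q * t)) \<in> carrier SU11" by simp
  define w where "w = 1 - of_real q * b"
  have "Re (of_real q * b) \<le> cmod (of_real q * b)" by (rule complex_Re_le_cmod)
  also have "\<dots> = q" using q b by (simp add: norm_mult)
  finally have w: "Re w > 0" unfolding w_def minus_complex.sel one_complex.sel using q by linarith
  then have w0: "w \<noteq> 0" "cnj w \<noteq> 0" by auto
  have cw: "cnj w = 1 - of_real q * cnj b" by (simp add: w_def)
  have "b * cnj w = b - of_real q" using unit_mult_cnj[OF b] by (simp add: cw algebra_simps)
  moreover have "moebius (su (cnj (of_real t)) (- of_real (q * t))) b = (of_real t * (b - of_real q)) / (of_real t * w)"
    by (simp add: moebius_su w_def algebra_simps)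
  ultimately have m: "moebius (su (cnj (of_real t)) (- of_real (q * t))) b = b * cnj w * inverse w"
    using t(1) by (simp add: divide_inverse)
  have "jacobian_factor lam (su (of_real t) (of_real (q * t))) b = of_real (cmod (of_real t * w)) powr (- 1 + 2 * \<i> * of_real lam)"
    by (simp add: jacobian_factor_def w_def algebra_simps)
  also have "\<dots> = of_real t powr (- 1 + 2 * \<i> * of_real lam) * of_real (cmod w) powr (- 1 + 2 * \<i> * of_real lam)"
    using t(1) unfolding norm_mult of_real_mult by (subst powr_times_real) auto
  also have "of_real (cmod w) powr (- 1 + 2 * \<i> * of_real lam) = complex_of_real ((cmod w)\<^sup>2) powr (- s)"
    using w0 by (simp add: powr_def Ln_of_real ln_realpow s_def del: of_real_power) (simp add: algebra_simps)
  also have "\<dots> = w powr (- s) * cnj w powr (- s)" by (rule powr_cmod_square[OF w])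
  finally have j: "jacobian_factor lam (su (of_real t) (of_real (q * t))) b
     = of_real t powr (- 1 + 2 * \<i> * of_real lam) * (w powr (- s) * cnj w powr (- s))" .
  have "fundamental_series lam (su (of_real t) (of_real (q * t))) (\<lambda>b. b powi n) b
     = of_real t powr (- 1 + 2 * \<i> * of_real lam) *
       ((w powr (- s) * w powi (- n)) * (cnj w powr (- s) * cnj w powi n) * b powi n)"
    unfolding fundamental_series_su[OF d] j m
    by (simp add: power_int_mult_distrib power_int_minus power_int_inverse mult_ac)
  then show "fundamental_series lam (su (of_real t) (of_real (q * t))) (\<lambda>b. b powi n) b
      = of_real t powr (- 1 + 2 * \<i> * of_real lam) * ((1 - of_real q * b) powr (- (s + of_int n))
         * (1 - of_real q * cnj b) powr (- (s - of_int n)) * b powi n)"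
    unfolding powr_minus_times_power_int[OF w0(1)] powr_minus_times_power_int[OF w0(2)]
    unfolding cw by (simp add: w_def)
qed

section \<open>Closed invariant subspaces\<close>

context
  fixes lam :: real and V :: "(complex \<Rightarrow> complex) set"
  assumes V: "closed_subspace V"
    and inv: "\<And>g f. g \<in> carrier SU11 \<Longrightarrow> f \<in> V \<Longrightarrow> fundamental_series lam g f \<in> V"
begin

lemma subspace_L2B: "f \<in> V \<Longrightarrow> f \<in> L2B"
  using V by (auto simp: closed_subspace_def)

lemma subspace_lincomb: "f \<in> V \<Longrightarrow> h \<in> V \<Longrightarrow> (\<lambda>b. \<alpha> * f b + \<beta> * h b) \<in> V"
  using V by (auto simp: closed_subspace_def)

lemma subspace_cmult_cancel:
  assumes "(\<lambda>b. \<alpha> * f b) \<in> V" "\<alpha> \<noteq> 0"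
  shows "f \<in> V"
proof -
  have "(\<lambda>b. inverse \<alpha> * (\<alpha> * f b) + 0 * (\<alpha> * f b)) = f"
    using assms(2) by (simp add: fun_eq_iff field_simps)
  then show ?thesis using subspace_lincomb[OF assms(1) assms(1), of "inverse \<alpha>" 0] by simp
qed

lemma subspace_limit:
  assumes "\<And>n. F n \<in> V" "f \<in> L2B" "(\<lambda>n. normsq (\<lambda>b. F n b - f b)) \<longlonglongrightarrow> 0"
  shows "f \<in> V"
proof -
  have "(\<lambda>n. L2_norm (\<lambda>b. F n b - f b)) \<longlonglongrightarrow> 0"
    using tendsto_real_sqrt[OF assms(3)] by (simp add: L2_norm_eq)
  then show ?thesis using V assms unfolding closed_subspace_def by blast
qed

lemma subspace_sum:
  assumes "\<And>j. j < N \<Longrightarrow> g j \<in> V"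
  shows "(\<lambda>b. \<Sum>j<(N::nat). a j * g j b) \<in> V"
  using assms
proof (induction N)
  case 0
  then show ?case using V by (simp add: closed_subspace_def)
next
  case (Suc N)
  from subspace_lincomb[OF Suc.IH Suc.prems[of N], of 1 "a N"] Suc.prems show ?case by simp
qed

lemma subspace_rotation:
  assumes "f \<in> V"
  shows "(\<lambda>b. f (cis (- x) * b)) \<in> V"
proof -
  \<comment> \<open>Half the angle, because the diagonal matrix with entries a and cnj a rotates by
    the square of a.\<close>
  have d: "(cmod (cis (x / 2)))\<^sup>2 - (cmod 0)\<^sup>2 = 1" by simp
  have "fundamental_series lam (su (cis (x / 2)) 0) f = (\<lambda>b. f (cis (- x) * b))"
  proof
    fix b
    have "cnj (cis (x / 2)) / cis (x / 2) = cis (- x)" by (simp add: cis_cnj cis_divide)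
    then have "cnj (cis (x / 2)) * b / cis (x / 2) = cis (- x) * b" by (simp only: times_divide_eq_left[symmetric])
    then show "fundamental_series lam (su (cis (x / 2)) 0) f b = f (cis (- x) * b)"
      unfolding fundamental_series_su[OF d] by (simp add: jacobian_factor_def moebius_su)
  qed
  then show ?thesis using inv[of "su (cis (x / 2)) 0" f] assms by simp
qed

lemma subspace_fourier:
  assumes f: "f \<in> V"
  shows "(\<lambda>b. fourier f n * b powi n) \<in> V"
proof (rule subspace_limit)
  show "rotation_average n (Suc N) f \<in> V" for N
  proof -
    have "rotation_average n (Suc N) f = (\<lambda>b. \<Sum>j<Suc N. (cis (2 * pi * real j / real (Suc N)) powi n / of_nat (Suc N))
       * f (cis (- (2 * pi * real j / real (Suc N))) * b))"
      unfolding rotation_average_def sum_divide_distrib by simp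
    then show ?thesis by (simp only:) (rule subspace_sum, rule subspace_rotation[OF f])
  qed
  show "(\<lambda>b. fourier f n * b powi n) \<in> L2B" by (intro L2B_cmult power_int_L2B)
qed (rule rotation_average_tendsto[OF subspace_L2B[OF f]])

lemma subspace_power_int_of_fourier: "f \<in> V \<Longrightarrow> fourier f n \<noteq> 0 \<Longrightarrow> (\<lambda>b. b powi n) \<in> V"
  by (rule subspace_cmult_cancel[OF subspace_fourier])

text \<open>For n + 1 the relevant Fourier coefficient is the binomial integral with leading
  coefficient s + n. For n - 1 the weight is b in place of cnj b; complex conjugation exchanges the
  two factors and leads to the same integral with leading coefficient cnj (s - n).\<close>

lemma subspace_ladder:
  assumes e: "(\<lambda>b. b powi n) \<in> V"
  shows "(\<lambda>b. b powi (n + 1)) \<in> V" and "(\<lambda>b. b powi (n - 1)) \<in> V"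
proof -
  define s where "s = 1 / 2 - \<i> * complex_of_real lam"
  have "Re (s + of_int n) \<noteq> 0" "Re (cnj (s - of_int n)) \<noteq> 0"
  proof -
    \<comment> \<open>Twice the real parts in question, up to conjugation: odd integers, since Re s
      = 1/2.\<close>
    have "real_of_int (2 * n + 1) \<noteq> 0" "real_of_int (1 - 2 * n) \<noteq> 0" unfolding of_int_eq_0_iff by presburger+
    then show "Re (s + of_int n) \<noteq> 0" "Re (cnj (s - of_int n)) \<noteq> 0" by (auto simp: s_def)
  qed
  then have nz: "s + of_int n \<noteq> 0" "cnj (s - of_int n) \<noteq> 0" by (metis zero_complex.sel(1))+
  define J where "J q b = (1 - of_real q * b) powr (- (s + of_int n)) * (1 - of_real q * cnj b) powr (- (s - of_int n))" for q b
  have [measurable]: "J q \<in> borel_measurable borel" for q unfolding J_def by measurable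
  have step: "(\<lambda>b. b powi (n - k)) \<in> V"
    if q: "0 < q" "q < 1" and I: "(LINT b|bmeasure. J q b * b powi k) \<noteq> 0" for q k
  proof (rule subspace_power_int_of_fourier)
    let ?t = "1 / sqrt (1 - q\<^sup>2)"
    let ?g = "su (of_real ?t) (of_real (q * ?t))"
    let ?K = "of_real ?t powr (- 1 + 2 * \<i> * complex_of_real lam)"
    have g: "?g \<in> carrier SU11" by (rule fundamental_series_boost(1)[OF q, of 1]) simp
    show T: "fundamental_series lam ?g (\<lambda>b. b powi n) \<in> V" by (rule inv[OF g e])
    have "fourier (fundamental_series lam ?g (\<lambda>b. b powi n)) (n - k) = (LINT b|bmeasure. ?K * (J q b * b powi k))"
      unfolding fourier_def
    proof (rule integral_cong_AE)
      show "AE b in bmeasure. fundamental_series lam ?g (\<lambda>b. b powi n) b * b powi (- (n - k)) = ?K * (J q b * b powi k)"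
        using AE_bmeasure
      proof eventually_elim
        case (elim b)
        then have "b \<noteq> 0" by auto
        then have "b powi k = b powi n * b powi (- (n - k))" by (simp flip: power_int_add)
        then show ?case unfolding fundamental_series_boost(2)[OF q elim] J_def s_def by (simp add: mult_ac)
      qed
      show "(\<lambda>b. fundamental_series lam ?g (\<lambda>b. b powi n) b * b powi (- (n - k))) \<in> borel_measurable bmeasure"
        using L2B_measurable[OF subspace_L2B[OF T]] by measurable
    qed measurable
    also have "\<dots> = ?K * (LINT b|bmeasure. J q b * b powi k)" by simp
    also have "\<dots> \<noteq> 0"
    proof -
      have "1 - q\<^sup>2 > 0" using q by (simp add: power_less_one_iff)
      then show ?thesis using I by simp
    qed
    finally show "fourier (fundamental_series lam ?g (\<lambda>b. b powi n)) (n - k) \<noteq> 0" .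
  qed
  have AE_inv: "AE b in bmeasure. b powi (- 1) = cnj b"
    using AE_bmeasure
  proof eventually_elim
    case (elim b)
    then show ?case using inverse_unique[OF unit_mult_cnj[OF elim]] by (simp add: power_int_minus)
  qed
  obtain q where q: "0 < q" "q < 1" "(LINT b|bmeasure. J q b * cnj b) \<noteq> 0"
    using exists_integral_binomial_nonzero[OF nz(1), of "s - of_int n"] unfolding J_def by blast
  have "(LINT b|bmeasure. J q b * b powi (- 1)) = (LINT b|bmeasure. J q b * cnj b)"
    by (rule integral_cong_AE) (use AE_inv in auto)
  then show "(\<lambda>b. b powi (n + 1)) \<in> V" using step[OF q(1,2), of "- 1"] q(3) by simp
  obtain p where p: "0 < p" "p < 1" "(LINT b|bmeasure. (1 - of_real p * b) powr (- cnj (s - of_int n))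
      * (1 - of_real p * cnj b) powr (- cnj (s + of_int n)) * cnj b) \<noteq> 0"
    using exists_integral_binomial_nonzero[OF nz(2), of "cnj (s + of_int n)"] by blast
  have "(LINT b|bmeasure. (1 - of_real p * b) powr (- cnj (s - of_int n))
      * (1 - of_real p * cnj b) powr (- cnj (s + of_int n)) * cnj b) = (LINT b|bmeasure. cnj (J p b * b powi 1))"
  proof (rule integral_cong_AE)
    show "AE b in bmeasure. (1 - of_real p * b) powr (- cnj (s - of_int n))
      * (1 - of_real p * cnj b) powr (- cnj (s + of_int n)) * cnj b = cnj (J p b * b powi 1)"
      using AE_bmeasure
    proof eventually_elim
      case (elim b)
      have pos: "Re (1 - of_real p * x) \<ge> 0" if "cmod x = 1" for x
      proof -
        have "Re (of_real p * x) \<le> cmod (of_real p * x)" by (rule complex_Re_le_cmod)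
        also have "\<dots> = p" using p that by (simp add: norm_mult)
        finally show ?thesis unfolding minus_complex.sel one_complex.sel using p(2) by linarith
      qed
      have "cnj ((1 - of_real p * b) powr (- (s + of_int n))) = (1 - of_real p * cnj b) powr (- cnj (s + of_int n))"
        by (subst cnj_powr) (rule pos[OF elim], simp)
      moreover have "cnj ((1 - of_real p * cnj b) powr (- (s - of_int n))) = (1 - of_real p * b) powr (- cnj (s - of_int n))"
        by (subst cnj_powr) (rule pos, use elim in simp_all)
      ultimately show ?case unfolding J_def complex_cnj_mult by simp
    qed
  qed measurable
  also have "\<dots> = cnj (LINT b|bmeasure. J p b * b powi 1)"
    by (rule Bochner_Integration.integral_cnj)
  finally have "(LINT b|bmeasure. J p b * b powi 1) \<noteq> 0" using p(3) by auto
  then show "(\<lambda>b. b powi (n - 1)) \<in> V" by (rule step[OF p(1,2)])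
qed

lemma subspace_cases: "V = L2_null \<or> V = L2B"
proof (cases "V \<subseteq> L2_null")
  case True
  \<comment> \<open>Every closed subspace contains the null functions: the constant sequence 0
    converges to each of them in norm.\<close>
  have "f \<in> V" if f: "f \<in> L2_null" for f
  proof (rule subspace_limit)
    show "(\<lambda>_. 0) \<in> V" using V by (simp add: closed_subspace_def)
    show "f \<in> L2B" using f by (simp add: L2_null_def)
    have "normsq (\<lambda>b. 0 - f b) = (LINT b|bmeasure. 0)"
      unfolding normsq_def
    proof (rule integral_cong_AE)
      show "AE b in bmeasure. (cmod (0 - f b))\<^sup>2 = 0"
        using f by (auto simp: L2_null_def L2_eq_def elim!: eventually_mono)
    qed (use L2B_measurable[OF \<open>f \<in> L2B\<close>] in auto)
    then show "(\<lambda>n. normsq (\<lambda>b. 0 - f b)) \<longlonglongrightarrow> 0" by simp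
  qed
  then show ?thesis using True by blast
next
  case False
  then obtain f where f: "f \<in> V" "f \<notin> L2_null" by blast
  then obtain n where "fourier f n \<noteq> 0" using fourier_eq_0_imp[OF subspace_L2B[OF f(1)]] by blast
  then have en: "(\<lambda>b. b powi n) \<in> V" by (rule subspace_power_int_of_fourier[OF f(1)])
  have em: "(\<lambda>b. b powi m) \<in> V" for m
    by (induction m rule: int_induct[where k=n]) (use en subspace_ladder in auto)
  have trig: "p \<in> V" if "trig_poly p" for p
    using that by induction (use em subspace_lincomb in auto)
  have "h \<in> V" if h: "h \<in> L2B" for h
  proof -
    have "\<exists>p. trig_poly p \<and> normsq (\<lambda>b. h b - p b) < 1 / real (Suc k)" for k
      by (rule trig_poly_dense[OF h]) simp
    then obtain P where P: "\<And>k. trig_poly (P k)" "\<And>k. normsq (\<lambda>b. h b - P k b) < 1 / real (Suc k)" by metis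
    show ?thesis
    proof (rule subspace_limit[OF _ h])
      show "P k \<in> V" for k by (rule trig[OF P(1)])
      show "(\<lambda>k. normsq (\<lambda>b. P k b - h b)) \<longlonglongrightarrow> 0"
      proof (rule tendsto_sandwich[of "\<lambda>_. 0" _ _ "\<lambda>k. 1 / real (Suc k)"])
        show "(\<lambda>k. 1 / real (Suc k)) \<longlonglongrightarrow> 0" by (rule LIMSEQ_inverse_real_of_nat[unfolded inverse_eq_divide])
        show "eventually (\<lambda>k. normsq (\<lambda>b. P k b - h b) \<le> 1 / real (Suc k)) sequentially"
          using P(2) normsq_minus_commute[of h] by (auto intro!: always_eventually less_imp_le)
      qed (auto simp: normsq_nonneg)
    qed
  qed
  then show ?thesis using subspace_L2B by blast
qed

end

lemma irreducible_rep_fundamental_series: "irreducible_rep SU11 (fundamental_series lam)"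
proof -
  have "(\<lambda>_. 1) \<in> L2B" by (rule L2B_bounded[of _ 1]) auto
  moreover have "(\<lambda>_. 1) \<notin> L2_null"
    using bmeasure.prob_space by (simp add: L2_null_def L2_eq_def bmeasure.AE_False)
  ultimately have "L2B \<noteq> L2_null" by blast
  then show ?thesis unfolding irreducible_rep_def using subspace_cases by blast
qed

text \<open>For index -1/2 + \<i> lam the upper parameters are 1/2 - \<i> lam and 1/2 + \<i> lam, so
  this symmetry is the invariance of the conical function under lam \<mapsto> -lam.\<close>

lemma hyp2F1_commute: "hyp2F1 a b c z = hyp2F1 b a c z"
proof -
  have "fps_hypergeo [a, b] [c] 1 = fps_hypergeo [b, a] [c] 1" by (rule fps_ext) (simp add: mult.commute)
  then show ?thesis unfolding hyp2F1_def by (simp only:)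
qed

lemma legendre_P_eq_integral_horo_bracket:
  assumes r: "r \<ge> 0" and z: "cmod \<zeta> = tanh (r / 2)"
  shows "legendre_P (- 1 / 2 + \<i> * complex_of_real lam) (complex_of_real (cosh r)) =
    (LINT b|bmeasure. exp ((1 / 2 - \<i> * complex_of_real lam) * complex_of_real (horo_bracket \<zeta> b)))"
proof -
  have zd: "\<zeta> \<in> hdisk" using tanh_real_lt_1[of "r / 2"] z by simp
  note [measurable] = horo_bracket_measurable[OF zd]
  have "legendre_P (- 1 / 2 + \<i> * complex_of_real lam) (complex_of_real (cosh r))
      = (LINT b|bmeasure. complex_of_real (poisson \<zeta> b) powr (1 / 2 - \<i> * complex_of_real lam))"
    using legendre_P_eq_integral[OF r z, of "1 / 2 + \<i> * complex_of_real lam"] by simp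
  also have "\<dots> = (LINT b|bmeasure. exp ((1 / 2 - \<i> * complex_of_real lam) * complex_of_real (horo_bracket \<zeta> b)))"
  proof (rule integral_cong_AE)
    show "AE b in bmeasure. complex_of_real (poisson \<zeta> b) powr (1 / 2 - \<i> * complex_of_real lam)
        = exp ((1 / 2 - \<i> * complex_of_real lam) * complex_of_real (horo_bracket \<zeta> b))"
      using AE_bmeasure by eventually_elim (rule exp_horo_bracket[OF zd, symmetric])
  qed measurable
  finally show ?thesis .
qed

theorem proposition2:
  shows
    "(\<forall>b\<in>hboundary. \<forall>H. horocycle b H \<longrightarrow> (\<lambda>\<zeta>. poisson \<zeta> b) constant_on H)
   \<and> (\<forall>\<nu>::complex. \<forall>b\<in>hboundary.
        laplace_eigenfunction (\<lambda>\<zeta>. complex_of_real (poisson \<zeta> b) powr \<nu>) (\<nu> * (\<nu> - 1)))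
   \<and> (\<forall>\<nu>::complex. \<forall>\<zeta>\<in>hdisk. \<forall>b\<in>hboundary.
        exp (\<nu> * complex_of_real (horo_bracket \<zeta> b)) = complex_of_real (poisson \<zeta> b) powr \<nu>)
   \<and> ((\<forall>lam::real. \<forall>r::real. \<forall>\<zeta>. r \<ge> 0 \<and> cmod \<zeta> = tanh (r / 2) \<longrightarrow>
         legendre_P (- 1 / 2 + \<i> * complex_of_real lam) (complex_of_real (cosh r)) =
           (LINT b|bmeasure. exp ((1 / 2 - \<i> * complex_of_real lam) * complex_of_real (horo_bracket \<zeta> b))))
      \<and> (\<forall>lam::real.
           unitary_rep SU11 (fundamental_series lam) \<and>
           irreducible_rep SU11 (fundamental_series lam) \<and>
           spherical_function (fundamental_series lam)
             (\<lambda>g. legendre_P (- 1 / 2 + \<i> * complex_of_real lam)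
                    (complex_of_real (cosh (hyp_dist0 (SU11_action g 0))))))
      \<and> transitive_action SU11 hdisk SU11_action)
   \<and> (\<forall>lam::real. \<forall>r::real. r \<ge> 0 \<longrightarrow>
        legendre_P (- 1 / 2 + \<i> * complex_of_real lam) (complex_of_real (cosh r)) =
        legendre_P (- 1 / 2 - \<i> * complex_of_real lam) (complex_of_real (cosh r)))"
proof (intro conjI allI ballI impI)
  fix b H assume b: "b \<in> hboundary" and "horocycle b H"
  then obtain c r where "horo_circle b c r" "H = sphere c r - {b}" by (auto simp: horocycle_def)
  then show "(\<lambda>\<zeta>. poisson \<zeta> b) constant_on H"
    unfolding constant_on_def using poisson_horo_circle[of b c r] b by (intro exI[of _ "(1 - r) / r"]) auto
next
  fix \<nu> b :: complex assume "b \<in> hboundary"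
  then show "laplace_eigenfunction (\<lambda>\<zeta>. complex_of_real (poisson \<zeta> b) powr \<nu>) (\<nu> * (\<nu> - 1))"
    by (intro laplace_eigenfunction_poisson) simp
next
  fix \<nu> \<zeta> b :: complex assume "\<zeta> \<in> hdisk" "b \<in> hboundary"
  then show "exp (\<nu> * complex_of_real (horo_bracket \<zeta> b)) = complex_of_real (poisson \<zeta> b) powr \<nu>"
    by (intro exp_horo_bracket) simp_all
next
  fix lam r \<zeta> assume "r \<ge> 0 \<and> cmod \<zeta> = tanh (r / 2)"
  then show "legendre_P (- 1 / 2 + \<i> * complex_of_real lam) (complex_of_real (cosh r)) =
      (LINT b|bmeasure. exp ((1 / 2 - \<i> * complex_of_real lam) * complex_of_real (horo_bracket \<zeta> b)))"
    by (intro legendre_P_eq_integral_horo_bracket) simp_all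
next
  fix lam r :: real
  show "legendre_P (- 1 / 2 + \<i> * complex_of_real lam) (complex_of_real (cosh r)) =
      legendre_P (- 1 / 2 - \<i> * complex_of_real lam) (complex_of_real (cosh r))"
    unfolding legendre_P_def by (subst hyp2F1_commute) (simp add: algebra_simps)
qed (rule unitary_rep_fundamental_series irreducible_rep_fundamental_series
      spherical_function_fundamental_series transitive_action_SU11)+

end
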